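(* For every vector $(\alpha_{03},\beta_{03},\beta_{14},\beta_{06},\beta_{25},\beta_{26},\gamma_{36})\in\mathcal{V}=\mathbb{F}_2^7$, setting $$j_{24}=\beta_{03}\gamma_{36}+\alpha_{03}(\beta_{25}+\beta_{26}),$$ there exists a unique isomorphism class of $\mathcal{A}^{\mathbb{R}}$-module structures on $\mathcal{A}^{\mathbb{R}}(1)$ (extending its $\mathcal{A}^{\mathbb{R}}(1)$-module structure) determined by the formulas (i) $\mathrm{Sq}^4(x_{0,0})=\beta_{03}(\rho\cdot y_{3,1})+(1+\beta_{03}+\beta_{14})(\tau\cdot y_{4,1})+\alpha_{03}(\rho\cdot x_{3,1})$; (ii) $\mathrm{Sq}^4(x_{1,0})=y_{5,2}+\beta_{14}(\rho\cdot y_{4,1})$; (iii) $\mathrm{Sq}^4(x_{2,1})=\beta_{26}(\tau\cdot y_{6,2})+\beta_{25}(\rho\cdot y_{5,2})+j_{24}(\rho^2\cdot y_{4,1})$; (iv) $\mathrm{Sq}^4(x_{3,1})=(\beta_{25}+\beta_{26})(\rho\cdot y_{6,2})$; (v) $\mathrm{Sq}^4(y_{3,1})=\gamma_{36}(\rho\cdot y_{6,2})$; (vi) $\mathrm{Sq}^8(x_{0,0})=\beta_{06}(\rho^2\cdot y_{6,2})$. Further, any $\mathcal{A}^{\mathbb{R}}$-module whose underlying $\mathcal{A}^{\mathbb{R}}(1)$-module is free on one generator (in bidegree $(0,0)$) is isomorphic to one listed above.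
   Context: $\mathbb{M}_2^{\mathbb{R}}=\mathbb{F}_2[\tau,\rho]$ is the mod $2$ motivic cohomology of a point over $\mathbb{R}$, with cohomological bidegrees (topological degree, weight) $|\tau|=(0,1)$, $|\rho|=(1,1)$ (homotopical bidegrees $(0,-1)$ and $(-1,-1)$). $\mathcal{A}^{\mathbb{R}}$ is the $\mathbb{R}$-motivic mod $2$ Steenrod algebra (Voevodsky), generated over $\mathbb{M}_2^{\mathbb{R}}$ by the motivic squares $\mathrm{Sq}^{2k}$ of bidegree $(2k,k)$ and $\mathrm{Sq}^{2k+1}$ of bidegree $(2k+1,k)$; it acts on $\mathbb{M}_2^{\mathbb{R}}$ (with $\mathrm{Sq}^1(\tau)=\rho$) and on products by the motivic Cartan formula. $\mathcal{A}^{\mathbb{R}}(1)$ is the $\mathbb{M}_2^{\mathbb{R}}$-subalgebra generated by $\mathrm{Sq}^1,\mathrm{Sq}^2$. Fix an $\mathbb{M}_2^{\mathbb{R}}$-basis $\{x_{0,0},x_{1,0},x_{2,1},x_{3,1},y_{3,1},y_{4,1},y_{5,2},y_{6,2}\}$ of $\mathcal{A}^{\mathbb{R}}(1)$ (subscripts are bidegrees) with $\mathrm{Sq}^1(x_{0,0})=x_{1,0}$, $\mathrm{Sq}^1(x_{2,1})=x_{3,1}$, $\mathrm{Sq}^1(y_{3,1})=y_{4,1}$, $\mathrm{Sq}^1(y_{5,2})=y_{6,2}$, $\mathrm{Sq}^2(x_{0,0})=x_{2,1}$, $\mathrm{Sq}^2(x_{1,0})=y_{3,1}$, $\mathrm{Sq}^2(x_{2,1})=\tau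 y_{4,1}$, $\mathrm{Sq}^2(x_{3,1})=y_{5,2}$, $\mathrm{Sq}^2(y_{4,1})=y_{6,2}$. *)

theory Defs
  imports
    "HOL-Library.Poly_Mapping"
    "HOL-Library.Z2"
    "HOL-Library.Product_Plus"
    "HOL-Computational_Algebra.Polynomial"
begin

section \<open>The \<open>\<real>\<close>-motivic mod 2 Steenrod algebra\<close>

text \<open>
  Voevodsky defines the algebra as the algebra of bistable operations generated by the coefficients
  \<open>F\<^sub>2[\<tau>, \<rho>]\<close> and the squares, and shows that the admissible monomials form a left basis over
  \<open>F\<^sub>2[\<tau>, \<rho>]\<close>; hence it has the following presentation over \<open>F\<^sub>2\<close>, which we take as the definition.
  Generators: \<open>\<tau>\<close>, \<open>\<rho>\<close> and \<open>Sq\<^sup>n\<close>. Relations: \<open>\<tau>\<close> and \<open>\<rho>\<close> commute, \<open>Sq\<^sup>0 = 1\<close>, squares commute past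
  \<open>\<tau>\<close> and \<open>\<rho>\<close> according to the motivic Cartan formula, and the motivic Adem relations (in the form
  corrected by Riou).
\<close>

datatype letter = Tau | Rho | Square nat

datatype word = Word (letters: "letter list")

instantiation word :: monoid_add
begin
definition "0 = Word []"
definition "u + v = Word (letters u @ letters v)"
instance
  by standard (simp_all add: zero_word_def plus_word_def)
end

text \<open>The free associative algebra, i.e. the monoid algebra of the free monoid of words.\<close>

type_synonym free_alg = "word \<Rightarrow>\<^sub>0 bit"

definition gen :: "letter \<Rightarrow> free_alg" where
  "gen l = Poly_Mapping.single (Word [l]) 1"

abbreviation "fT \<equiv> gen Tau"
abbreviation "fR \<equiv> gen Rho"
abbreviation "fS n \<equiv> gen (Square n)"

text \<open>The truncated subtractions below never truncate: \<open>2 * c \<le> a < 2 * b\<close> throughout.\<close>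

definition adem_rhs :: "nat \<Rightarrow> nat \<Rightarrow> free_alg" where
  "adem_rhs a b =
    (if even a \<and> even b then
       (\<Sum>c\<le>a div 2. of_nat ((b - 1 - c) choose (a - 2 * c)) * fT ^ (c mod 2) * fS (a + b - c) * fS c)
     else if even a \<and> odd b then
       (\<Sum>c\<le>a div 2. of_nat ((b - 1 - c) choose (a - 2 * c)) * fS (a + b - c) * fS c)
       + (\<Sum>c\<in>{c. c \<le> a div 2 \<and> odd c}.
            of_nat ((b - 1 - c) choose (a - 2 * c)) * fR * fS (a + b - c - 1) * fS c)
     else if odd a \<and> even b then
       (\<Sum>c\<in>{c. c \<le> a div 2 \<and> even c}.
            of_nat ((b - 1 - c) choose (a - 2 * c)) * fS (a + b - c) * fS c)
       + (\<Sum>c\<in>{c. c \<le> a div 2 \<and> odd c}.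
            of_nat ((b - 1 - c) choose (a - 1 - 2 * c)) * fR * fS (a + b - c - 1) * fS c)
     else
       (\<Sum>c\<in>{c. c \<le> a div 2 \<and> odd c}.
            of_nat ((b - 1 - c) choose (a - 2 * c)) * fS (a + b - c) * fS c))"

text \<open>
  The relators involving \<open>Sq\<^sup>n \<tau>\<close> and \<open>Sq\<^sup>n \<rho>\<close> are the motivic Cartan formula
  \<open>Sq\<^sup>2\<^sup>k(x y) = \<Sum>\<^bsub>r+s=k\<^esub> Sq\<^sup>2\<^sup>r x Sq\<^sup>2\<^sup>s y + \<tau> \<Sum>\<^bsub>r+s=k-1\<^esub> Sq\<^bsup>2r+1\<^esup> x Sq\<^bsup>2s+1\<^esup> y\<close>,
  \<open>Sq\<^bsup>2k+1\<^esup>(x y) = \<Sum>\<^bsub>r+s=2k+1\<^esub> Sq\<^sup>r x Sq\<^sup>s y + \<rho> \<Sum>\<^bsub>r+s=k-1\<^esub> Sq\<^bsup>2r+1\<^esup> x Sq\<^bsup>2s+1\<^esup> y\<close>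
  for \<open>x = \<tau>\<close> and \<open>x = \<rho>\<close>, where \<open>Sq\<^sup>1 \<tau> = \<rho>\<close>, \<open>Sq\<^sup>1 \<rho> = 0\<close>, and \<open>Sq\<^sup>i\<close> kills \<open>\<tau>\<close> and \<open>\<rho>\<close> for \<open>i \<ge> 2\<close>.
\<close>

inductive_set relators :: "free_alg set" where
  Sq_zero: "fS 0 - 1 \<in> relators"
| tau_rho: "fT * fR - fR * fT \<in> relators"
| Sq_rho: "fS n * fR - fR * fS n \<in> relators"
| Sq_one_tau: "fS 1 * fT - (fT * fS 1 + fR) \<in> relators"
| Sq_even_tau: "fS (2 * k + 2) * fT - (fT * fS (2 * k + 2) + fT * fR * fS (2 * k + 1)) \<in> relators"
| Sq_odd_tau: "fS (2 * k + 3) * fT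
    - (fT * fS (2 * k + 3) + fR * fS (2 * k + 2) + fR ^ 2 * fS (2 * k + 1)) \<in> relators"
| adem: "0 < a \<Longrightarrow> a < 2 * b \<Longrightarrow> fS a * fS b - adem_rhs a b \<in> relators"

inductive_set rel_ideal :: "free_alg set" where
  relator: "r \<in> relators \<Longrightarrow> r \<in> rel_ideal"
| zero: "0 \<in> rel_ideal"
| diff: "p \<in> rel_ideal \<Longrightarrow> q \<in> rel_ideal \<Longrightarrow> p - q \<in> rel_ideal"
| mult_left: "p \<in> rel_ideal \<Longrightarrow> q * p \<in> rel_ideal"
| mult_right: "p \<in> rel_ideal \<Longrightarrow> p * q \<in> rel_ideal"

definition rel_eq :: "free_alg \<Rightarrow> free_alg \<Rightarrow> bool" where
  "rel_eq p q \<longleftrightarrow> p - q \<in> rel_ideal"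

lemma rel_ideal_uminus: "p \<in> rel_ideal \<Longrightarrow> - p \<in> rel_ideal"
  using rel_ideal.diff[OF rel_ideal.zero] by fastforce

lemma rel_ideal_add: "p \<in> rel_ideal \<Longrightarrow> q \<in> rel_ideal \<Longrightarrow> p + q \<in> rel_ideal"
  using rel_ideal.diff[OF _ rel_ideal_uminus] by fastforce

lemma equivp_rel_eq: "equivp rel_eq"
proof (rule equivpI)
  show "reflp rel_eq"
    by (rule reflpI) (simp add: rel_eq_def rel_ideal.zero)
  show "symp rel_eq"
    by (rule sympI) (metis rel_eq_def rel_ideal_uminus minus_diff_eq)
  show "transp rel_eq"
  proof (rule transpI)
    fix p q r assume "rel_eq p q" "rel_eq q r"
    then have "(p - q) + (q - r) \<in> rel_ideal"
      unfolding rel_eq_def by (rule rel_ideal_add)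
    then show "rel_eq p r" by (simp add: rel_eq_def)
  qed
qed

quotient_type AR = free_alg / rel_eq
  by (rule equivp_rel_eq)

text \<open>Nontriviality: the algebra maps to \<open>F\<^sub>2\<close> by \<open>\<tau>, \<rho>, Sq\<^sup>n \<mapsto> 0\<close> for \<open>n > 0\<close> and \<open>Sq\<^sup>0 \<mapsto> 1\<close>.\<close>

definition aug_word :: "word \<Rightarrow> bit" where
  "aug_word w = (if set (letters w) \<subseteq> {Square 0} then 1 else 0)"

definition aug :: "free_alg \<Rightarrow> bit" where
  "aug p = (\<Sum>w\<in>Poly_Mapping.keys p. Poly_Mapping.lookup p w * aug_word w)"

lemma aug_word_add: "aug_word (u + v) = aug_word u * aug_word v"
  by (auto simp: aug_word_def plus_word_def)

lemma aug_superset: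
  assumes "finite S" "Poly_Mapping.keys p \<subseteq> S"
  shows "aug p = (\<Sum>w\<in>S. Poly_Mapping.lookup p w * aug_word w)"
  unfolding aug_def using assms
  by (intro sum.mono_neutral_left) (auto simp: Poly_Mapping.in_keys_iff)

lemma aug_add: "aug (p + q) = aug p + aug q"
proof -
  let ?S = "Poly_Mapping.keys p \<union> Poly_Mapping.keys q"
  have "aug (p + q) = (\<Sum>w\<in>?S. Poly_Mapping.lookup (p + q) w * aug_word w)"
    by (rule aug_superset) (use Poly_Mapping.keys_add[of p q] in auto)
  also have "\<dots> = (\<Sum>w\<in>?S. Poly_Mapping.lookup p w * aug_word w) + (\<Sum>w\<in>?S. Poly_Mapping.lookup q w * aug_word w)"
    by (simp only: Poly_Mapping.lookup_add distrib_right sum.distrib)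
  also have "(\<Sum>w\<in>?S. Poly_Mapping.lookup p w * aug_word w) = aug p"
    by (rule aug_superset[symmetric]) auto
  also have "(\<Sum>w\<in>?S. Poly_Mapping.lookup q w * aug_word w) = aug q"
    by (rule aug_superset[symmetric]) auto
  finally show ?thesis .
qed

lemma aug_single: "aug (Poly_Mapping.single w b) = b * aug_word w"
  by (cases "b = 0") (simp_all add: aug_def)

lemma aug_sum: "aug (sum f A) = (\<Sum>x\<in>A. aug (f x))"
proof (induction A rule: infinite_finite_induct)
  case (insert x F) then show ?case by (simp add: aug_add del: add_bit_eq_xor)
qed (simp_all add: aug_def)

lemma free_alg_decomp:
  "(p :: free_alg) = (\<Sum>w\<in>Poly_Mapping.keys p. Poly_Mapping.single w (Poly_Mapping.lookup p w))"
  by (rule poly_mapping_eqI)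
     (simp add: Poly_Mapping.lookup_sum Poly_Mapping.lookup_single when_def Poly_Mapping.in_keys_iff sum.delta cong: if_cong)

lemma aug_mult: "aug (p * q) = aug p * aug q"
proof -
  have "p * q = (\<Sum>u\<in>Poly_Mapping.keys p. Poly_Mapping.single u (Poly_Mapping.lookup p u)) *
                (\<Sum>v\<in>Poly_Mapping.keys q. Poly_Mapping.single v (Poly_Mapping.lookup q v))"
    using free_alg_decomp[of p] free_alg_decomp[of q] by metis
  then have "aug (p * q) = (\<Sum>u\<in>Poly_Mapping.keys p. \<Sum>v\<in>Poly_Mapping.keys q.
      Poly_Mapping.lookup p u * Poly_Mapping.lookup q v * aug_word (u + v))"
    by (simp only: sum_product aug_sum Poly_Mapping.mult_single aug_single)
  also have "\<dots> = aug p * aug q"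
    unfolding aug_def sum_product aug_word_add
    by (intro sum.cong refl) (simp only: ac_simps)
  finally show ?thesis .
qed

lemma aug_zero: "aug 0 = 0" by (simp add: aug_def)
lemma aug_one: "aug 1 = 1"
  by (metis aug_single aug_word_def empty_subsetI list.set(1) mult_1 Poly_Mapping.single_one word.sel zero_word_def)
lemma aug_diff: "aug (p - q) = aug p - aug q"
  using aug_add[of "p - q" q] by (simp add: algebra_simps del: add_bit_eq_xor)

lemma aug_gen: "aug (gen l) = (if l = Square 0 then 1 else 0)"
  by (simp add: gen_def aug_single aug_word_def)

lemma aug_adem_rhs:
  assumes "0 < a" "a < 2 * b"
  shows "aug (adem_rhs a b) = 0"
proof -
  have Sq: "aug (x * fS (a + b - c) * y) = 0" if "c \<le> a div 2" for x y c
  proof -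
    have "a + b - c \<noteq> 0" using that assms by linarith
    then show ?thesis by (simp add: aug_mult aug_gen)
  qed
  have Rho: "aug (x * fR * y * z) = 0" for x y z
    by (simp add: aug_mult aug_gen)
  show ?thesis
    by (simp add: adem_rhs_def aug_add aug_sum Sq Rho)
qed

lemma aug_rel_ideal: "p \<in> rel_ideal \<Longrightarrow> aug p = 0"
proof (induction rule: rel_ideal.induct)
  case (relator r)
  then show ?case
    by (induction rule: relators.induct)
       (simp_all add: aug_diff aug_add aug_mult aug_gen aug_one aug_adem_rhs power2_eq_square)
qed (simp_all add: aug_diff aug_mult aug_zero)

instantiation AR :: ring_1
begin

lift_definition zero_AR :: AR is "0 :: free_alg" .
lift_definition one_AR :: AR is "1 :: free_alg" .

lift_definition plus_AR :: "AR \<Rightarrow> AR \<Rightarrow> AR" is "(+)"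
  unfolding rel_eq_def by (metis rel_ideal_add add_diff_add)

lift_definition minus_AR :: "AR \<Rightarrow> AR \<Rightarrow> AR" is "(-)"
proof -
  fix p p' q q' assume "rel_eq p p'" "rel_eq q q'"
  then have "(p - p') - (q - q') \<in> rel_ideal"
    unfolding rel_eq_def by (rule rel_ideal.diff)
  then show "rel_eq (p - q) (p' - q')"
    unfolding rel_eq_def by (simp add: algebra_simps)
qed

lift_definition uminus_AR :: "AR \<Rightarrow> AR" is "uminus"
proof -
  fix p p' assume "rel_eq p p'"
  then have "- (p - p') \<in> rel_ideal" unfolding rel_eq_def by (rule rel_ideal_uminus)
  then show "rel_eq (- p) (- p')" unfolding rel_eq_def by (simp add: algebra_simps)
qed

lift_definition times_AR :: "AR \<Rightarrow> AR \<Rightarrow> AR" is "(*)"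
proof -
  fix p p' q q' assume "rel_eq p p'" "rel_eq q q'"
  then have "(p - p') * q + p' * (q - q') \<in> rel_ideal"
    unfolding rel_eq_def by (intro rel_ideal_add rel_ideal.mult_left rel_ideal.mult_right)
  then show "rel_eq (p * q) (p' * q')"
    unfolding rel_eq_def by (simp add: algebra_simps)
qed

instance
proof
  show "(0::AR) \<noteq> 1"
  proof transfer
    show "\<not> rel_eq 0 1"
      using aug_rel_ideal[of "0 - 1"] aug_diff[of 0 1] by (auto simp: rel_eq_def aug_zero aug_one)
  qed
qed (transfer, simp add: rel_eq_def rel_ideal.zero algebra_simps)+

end

lift_definition tau :: AR is fT .
lift_definition rho :: AR is fR .
lift_definition Sq :: "nat \<Rightarrow> AR" is "\<lambda>n. fS n" .

text \<open>Bidegrees are cohomological: (topological degree, weight).\<close>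

primrec letter_deg :: "letter \<Rightarrow> int \<times> int" where
  "letter_deg Tau = (0, 1)"
| "letter_deg Rho = (1, 1)"
| "letter_deg (Square n) = (int n, int (n div 2))"

definition word_deg :: "word \<Rightarrow> int \<times> int" where
  "word_deg w = sum_list (map letter_deg (letters w))"

definition AR_deg :: "int \<times> int \<Rightarrow> AR set" where
  "AR_deg d = abs_AR ` {p. \<forall>w\<in>Poly_Mapping.keys p. word_deg w = d}"

text \<open>
  The coefficient ring \<open>F\<^sub>2[\<tau>, \<rho>]\<close> is rendered as \<open>F\<^sub>2[\<rho>][\<tau>]\<close>: the coefficient of \<open>\<tau>\<^sup>i \<rho>\<^sup>j\<close> in \<open>m\<close> is
  \<open>coeff (coeff m i) j\<close>.
\<close>

type_synonym M2 = "bit poly poly"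

definition bit_AR :: "bit \<Rightarrow> AR" where
  "bit_AR b = (if b = 1 then 1 else 0)"

definition M2_unit :: "M2 \<Rightarrow> AR" where
  "M2_unit m = (\<Sum>i\<le>degree m. \<Sum>j\<le>degree (coeff m i). bit_AR (coeff (coeff m i) j) * tau ^ i * rho ^ j)"

inductive_set A1 :: "AR set" where
  tau: "tau \<in> A1"
| rho: "rho \<in> A1"
| Sq1: "Sq 1 \<in> A1"
| Sq2: "Sq 2 \<in> A1"
| one: "1 \<in> A1"
| diff: "x \<in> A1 \<Longrightarrow> y \<in> A1 \<Longrightarrow> x - y \<in> A1"
| mult: "x \<in> A1 \<Longrightarrow> y \<in> A1 \<Longrightarrow> x * y \<in> A1"

definition A1_deg :: "int \<times> int \<Rightarrow> AR set" where
  "A1_deg d = A1 \<inter> AR_deg d"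

section \<open>Bigraded modules\<close>

definition add_subgroup :: "'m::ab_group_add set \<Rightarrow> bool" where
  "add_subgroup S \<longleftrightarrow> 0 \<in> S \<and> (\<forall>x\<in>S. \<forall>y\<in>S. x - y \<in> S)"

text \<open>
  Left modules, with underlying abelian group \<open>M\<close>, over a bigraded subring \<open>R\<close> of the Steenrod algebra; \<open>M\<close> is
  the internal direct sum of the subgroups \<open>G d\<close>. Values of \<open>act\<close> outside \<open>R\<close> and \<open>M\<close> are irrelevant.
\<close>

locale bigraded_module =
  fixes R :: "AR set"
    and M :: "'m::ab_group_add set"
    and G :: "int \<times> int \<Rightarrow> 'm set"
    and act :: "AR \<Rightarrow> 'm \<Rightarrow> 'm"
  assumes subgroup: "add_subgroup M"
    and act_closed: "a \<in> R \<Longrightarrow> x \<in> M \<Longrightarrow> act a x \<in> M"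
    and act_add_right: "a \<in> R \<Longrightarrow> x \<in> M \<Longrightarrow> y \<in> M \<Longrightarrow> act a (x + y) = act a x + act a y"
    and act_add_left: "a \<in> R \<Longrightarrow> b \<in> R \<Longrightarrow> x \<in> M \<Longrightarrow> act (a + b) x = act a x + act b x"
    and act_mult: "a \<in> R \<Longrightarrow> b \<in> R \<Longrightarrow> x \<in> M \<Longrightarrow> act (a * b) x = act a (act b x)"
    and act_one: "x \<in> M \<Longrightarrow> act 1 x = x"
    and G_subgroup: "add_subgroup (G d)"
    and G_subset: "G d \<subseteq> M"
    and direct_sum: "x \<in> M \<Longrightarrow>
      \<exists>!c. finite {d. c d \<noteq> 0} \<and> (\<forall>d. c d \<in> G d) \<and> x = (\<Sum>d\<in>{d. c d \<noteq> 0}. c d)"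
    and act_deg: "a \<in> R \<inter> AR_deg d \<Longrightarrow> x \<in> G e \<Longrightarrow> act a x \<in> G (d + e)"

definition bigraded_isomorphic ::
  "AR set \<Rightarrow> 'm::ab_group_add set \<Rightarrow> (int \<times> int \<Rightarrow> 'm set) \<Rightarrow> (AR \<Rightarrow> 'm \<Rightarrow> 'm)
    \<Rightarrow> 'n::ab_group_add set \<Rightarrow> (int \<times> int \<Rightarrow> 'n set) \<Rightarrow> (AR \<Rightarrow> 'n \<Rightarrow> 'n) \<Rightarrow> bool" where
  "bigraded_isomorphic R M G act N H act' \<longleftrightarrow>
    (\<exists>f. bij_betw f M N
       \<and> (\<forall>x\<in>M. \<forall>y\<in>M. f (x + y) = f x + f y)
       \<and> (\<forall>a\<in>R. \<forall>x\<in>M. f (act a x) = act' a (f x))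
       \<and> (\<forall>d. f ` G d = H d))"

text \<open>For a module over \<open>A1\<close>: free on one generator of bidegree \<open>(0, 0)\<close>.\<close>

definition A1_free_rank_one ::
  "'m::ab_group_add set \<Rightarrow> (int \<times> int \<Rightarrow> 'm set) \<Rightarrow> (AR \<Rightarrow> 'm \<Rightarrow> 'm) \<Rightarrow> bool" where
  "A1_free_rank_one M G act \<longleftrightarrow>
    bigraded_module A1 M G act \<and> (\<exists>g\<in>G (0, 0). bij_betw (\<lambda>a. act a g) A1 M)"

section \<open>Module structures on \<open>A1\<close>\<close>

definition A1_structures :: "(AR \<Rightarrow> AR \<Rightarrow> AR) set" where
  "A1_structures = {act. bigraded_module UNIV A1 A1_deg act \<and> (\<forall>a\<in>A1. \<forall>x\<in>A1. act a x = a * x)}"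

definition A1_structure_iso :: "((AR \<Rightarrow> AR \<Rightarrow> AR) \<times> (AR \<Rightarrow> AR \<Rightarrow> AR)) set" where
  "A1_structure_iso = {(act, act'). act \<in> A1_structures \<and> act' \<in> A1_structures
     \<and> bigraded_isomorphic UNIV A1 A1_deg act A1 A1_deg act'}"

definition M2_basis_of_A1 :: "AR list \<Rightarrow> bool" where
  "M2_basis_of_A1 bs \<longleftrightarrow> set bs \<subseteq> A1 \<and>
    (\<forall>a\<in>A1. \<exists>!ms :: M2 list. length ms = length bs \<and>
       a = (\<Sum>i<length bs. M2_unit (ms ! i) * bs ! i))"

locale A1_basis =
  fixes x00 x10 x21 x31 y31 y41 y52 y62 :: AR
  assumes basis: "M2_basis_of_A1 [x00, x10, x21, x31, y31, y41, y52, y62]"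
    and bidegrees:
      "x00 \<in> AR_deg (0, 0)" "x10 \<in> AR_deg (1, 0)" "x21 \<in> AR_deg (2, 1)" "x31 \<in> AR_deg (3, 1)"
      "y31 \<in> AR_deg (3, 1)" "y41 \<in> AR_deg (4, 1)" "y52 \<in> AR_deg (5, 2)" "y62 \<in> AR_deg (6, 2)"
    and Sq1:
      "Sq 1 * x00 = x10" "Sq 1 * x21 = x31" "Sq 1 * y31 = y41" "Sq 1 * y52 = y62"
    and Sq2:
      "Sq 2 * x00 = x21" "Sq 2 * x10 = y31" "Sq 2 * x21 = tau * y41" "Sq 2 * x31 = y52"
      "Sq 2 * y41 = y62"

text \<open>Parameters \<open>(\<alpha>\<^sub>0\<^sub>3, \<beta>\<^sub>0\<^sub>3, \<beta>\<^sub>1\<^sub>4, \<beta>\<^sub>0\<^sub>6, \<beta>\<^sub>2\<^sub>5, \<beta>\<^sub>2\<^sub>6, \<gamma>\<^sub>3\<^sub>6)\<close>.\<close>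

type_synonym param = "bit \<times> bit \<times> bit \<times> bit \<times> bit \<times> bit \<times> bit"

definition j24 :: "param \<Rightarrow> bit" where
  "j24 = (\<lambda>(\<alpha>03, \<beta>03, \<beta>14, \<beta>06, \<beta>25, \<beta>26, \<gamma>36). \<beta>03 * \<gamma>36 + \<alpha>03 * (\<beta>25 + \<beta>26))"

definition Sq_formulas ::
  "AR \<Rightarrow> AR \<Rightarrow> AR \<Rightarrow> AR \<Rightarrow> AR \<Rightarrow> AR \<Rightarrow> AR \<Rightarrow> AR \<Rightarrow> param \<Rightarrow> (AR \<Rightarrow> AR \<Rightarrow> AR) \<Rightarrow> bool" where
  "Sq_formulas x00 x10 x21 x31 y31 y41 y52 y62 v act \<longleftrightarrow>
    (case v of (\<alpha>03, \<beta>03, \<beta>14, \<beta>06, \<beta>25, \<beta>26, \<gamma>36) \<Rightarrow>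
       act (Sq 4) x00 = bit_AR \<beta>03 * (rho * y31) + bit_AR (1 + \<beta>03 + \<beta>14) * (tau * y41)
                          + bit_AR \<alpha>03 * (rho * x31)
     \<and> act (Sq 4) x10 = y52 + bit_AR \<beta>14 * (rho * y41)
     \<and> act (Sq 4) x21 = bit_AR \<beta>26 * (tau * y62) + bit_AR \<beta>25 * (rho * y52)
                          + bit_AR (j24 v) * (rho ^ 2 * y41)
     \<and> act (Sq 4) x31 = bit_AR (\<beta>25 + \<beta>26) * (rho * y62)
     \<and> act (Sq 4) y31 = bit_AR \<gamma>36 * (rho * y62)
     \<and> act (Sq 8) x00 = bit_AR \<beta>06 * (rho ^ 2 * y62))"

end

theory Submission
  imports Defs
begin

text \<open>
  Existence: on the free \<open>F\<^sub>2[\<tau>, \<rho>]\<close>-module on the eight basis elements, any table of values \<open>Sq\<^sup>n x\<close> on the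
  generators extends uniquely to operations satisfying the Cartan formula, so only the Adem relations
  are at stake. If all of them hold at \<open>v\<close>, then all hold at \<open>\<tau> v\<close>: moving \<open>\<tau>\<close> to the left turns the relation
  for \<open>(a, b)\<close> into a combination of relations for smaller indices, coefficient by coefficient, by Pascal's
  rule modulo 2. Hence they need checking on generators only, and there all but seven of them vanish,
  because degree minus weight is at most 4 on the module.

  Uniqueness and completeness: a graded structure is determined by \<open>Sq\<^sup>4\<close> and \<open>Sq\<^sup>8\<close> on the generators,
  again for degree reasons, and the degrees leave finitely many coefficients in \<open>F\<^sub>2\<close>. The relation
  for \<open>Sq\<^sup>2 Sq\<^sup>3\<close> on \<open>x00\<close> and \<open>x21\<close> gives \<open>Sq\<^sup>4 x10\<close> and \<open>Sq\<^sup>4 x31\<close>, and the relation for \<open>Sq\<^sup>4 Sq\<^sup>4\<close> on \<open>x00\<close> gives the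
  formula for \<open>j24\<close>; the remaining coefficients are the seven parameters.
\<close>

text \<open>All that is known of \<open>AR\<close> is its presentation. An action can therefore only
  be produced from additive maps for the letters that annihilate the relators, and even the grading
  of \<open>AR\<close> is obtained from such an action; \<open>A1\<close> is reached through the
  given basis, by the coordinate map \<open>Phi\<close>. The obstacle is that squares are not linear
  over \<tau>: the Adem relation at \<tau>\<open>v\<close> is not \<tau> times the relation at
  \<open>v\<close>. The guiding invariant is degree minus weight. \<open>Sq n\<close> raises it by
  \<open>(n + 1) div 2\<close>, \<rho> preserves it and \<tau> lowers it by 1, while on the eight
  basis elements it is 0, 1, 1, 2, 2, 3, 3, 4. So \<open>Sq 4\<close> can be nonzero only on the
  first five of them, \<open>Sq 8\<close> only on \<open>x00\<close>, and later squares on none;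
  \<open>Sq 5\<close>, \<open>Sq 6\<close>, \<open>Sq 7\<close> are expressed by \<open>Sq 4\<close>
  and elements of \<open>A1\<close>. The coefficient \<open>1 + \<beta>03 + \<beta>14\<close> is not
  free because \<open>x10 = Sq 1 * x00\<close>, so that \<open>Sq 4\<close> on \<open>x10\<close> is
  tied to \<open>Sq 4\<close> on \<open>x00\<close>.\<close>

section \<open>Adem relations and multiplication by \<open>\<tau>\<close>\<close>

text \<open>The binomial coefficient modulo 2, with \<open>binom2 (-1) q = 1\<close> for \<open>q \<ge> 0\<close>
  so that Pascal's rule still holds in row 0.\<close>

definition binom2 :: "int \<Rightarrow> int \<Rightarrow> 'a::semiring_1" where
  "binom2 p q = (if q < 0 then 0 else if p < 0 then 1 else of_nat (nat p choose nat q))"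

lemma binom2_neg: "q < 0 \<Longrightarrow> binom2 p q = 0"
  by (simp add: binom2_def)

lemma binom2_0: "binom2 p 0 = 1"
  by (simp add: binom2_def)

lemma binom2_minus_1: "0 \<le> q \<Longrightarrow> binom2 (- 1) q = 1"
  by (simp add: binom2_def)

lemma binom2_gt: "0 \<le> p \<Longrightarrow> p < q \<Longrightarrow> binom2 p q = 0"
  by (simp add: binom2_def binomial_eq_0 nat_less_eq_zless)

locale char2_ring =
  fixes ty :: "'a::comm_ring_1 itself"
  assumes char2: "(1::'a) + 1 = 0"
begin

lemma add_self: "(x::'a) + x = 0"
  by (metis char2 distrib_left mult.right_neutral mult_zero_right)

lemma add_self_left: "(x::'a) + (x + y) = y"
  by (simp add: add_self flip: add.assoc)

text \<open>Row 0 is where characteristic 2 enters: for \<open>q > 0\<close> both terms on the right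
  are 1 by the convention for negative rows. The hypothesis excludes \<open>p < 0 \<le> q\<close>,
  where this convention breaks the rule as soon as \<open>q > 0\<close>.\<close>

lemma binom2_pascal:
  assumes "0 \<le> p \<or> q < 0"
  shows "(binom2 p q :: 'a) = binom2 (p - 1) q + binom2 (p - 1) (q - 1)"
proof -
  consider "q < 0" | "q = 0" | "q > 0" "p = 0" | "q > 0" "p > 0" using assms by linarith
  then show ?thesis
  proof cases
    case 4
    define a where "a = nat (p - 1)"
    define b where "b = nat (q - 1)"
    have "nat p = Suc a" "nat q = Suc b" using 4 by (auto simp: a_def b_def)
    then show ?thesis using 4
      by (simp add: binom2_def a_def[symmetric] b_def[symmetric] add.commute)
  qed (auto simp: binom2_def char2 binomial_eq_0 one_add_one[symmetric] simp del: one_add_one)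
qed

end

text \<open>\<open>S_r\<close>, \<open>S_t_even\<close> and \<open>S_t_odd\<close> are the motivic
  Cartan formula for a factor \<rho> or \<tau>. The last two assumptions are the Adem relations with
  first index 1; they reduce every relation with odd first index to one with even first
  index.\<close>

locale adem_ops = char2_ring ty for ty :: "'a::comm_ring_1 itself" +
  fixes t r :: 'a and S :: "int \<Rightarrow> 'a \<Rightarrow> 'a"
  assumes S_add: "S n (x + y) = S n x + S n y"
    and S_neg: "n < 0 \<Longrightarrow> S n x = 0"
    and S_0: "S 0 x = x"
    and S_r: "S n (r * x) = r * S n x"
    and S_t_even: "S (2 * m) (t * x) = t * S (2 * m) x + t * r * S (2 * m - 1) x"
    and S_t_odd: "S (2 * m + 1) (t * x) = t * S (2 * m + 1) x + r * S (2 * m) x + r\<^sup>2 * S (2 * m - 1) x"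
    and S_1_even: "S 1 (S (2 * m) x) = S (2 * m + 1) x"
    and S_1_1: "S 1 (S 1 x) = 0"
begin

abbreviation Ev where "Ev m \<equiv> S (2 * m)"
abbreviation Od where "Od m \<equiv> S (2 * m + 1)"

lemma S_zero: "S n 0 = 0"
  using S_r[of n 0] S_add[of n 0 0] by simp

lemma S_1_odd: "S 1 (S (2 * m + 1) x) = 0"
  by (simp add: S_1_even[symmetric] S_1_1)

lemma S_sum: "S n (sum f A) = (\<Sum>d\<in>A. S n (f d))"
  by (induction A rule: infinite_finite_induct) (simp_all add: S_zero S_add)

lemma S_r_left: "S n (r * x) = r * S n x" "S n (r\<^sup>2 * x) = r\<^sup>2 * S n x"
  by (simp_all add: S_r power2_eq_square mult.assoc)

lemma E_t: "Ev m (t * x) = t * Ev m x + t * r * Od (m - 1) x"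
  using S_t_even[of m x] by (simp add: algebra_simps)

lemma O_t: "Od m (t * x) = t * Od m x + r * Ev m x + r\<^sup>2 * Od (m - 1) x"
  using S_t_odd[of m x] by (simp add: algebra_simps)

lemma S_binom2: "S n (binom2 p q * x) = binom2 p q * S n x"
proof -
  have "S n (of_nat k * x) = of_nat k * S n x" for k
    by (induction k) (simp_all add: S_zero S_add distrib_right)
  then show ?thesis by (auto simp: binom2_def S_zero)
qed

lemma S_1_t: "S 1 (t * x) = t * S 1 x + r * x"
  using S_t_odd[of 0 x] by (simp add: S_0 S_neg)

text \<open>The Adem relations split by parity, with the binomial coefficients halved by Lucas' theorem. The
  indices are integers and the bound \<open>K\<close> is arbitrary, so that summations can be shifted without
  boundary terms.\<close>

definition ee :: "int \<Rightarrow> int \<Rightarrow> int \<Rightarrow> 'a \<Rightarrow> bool" where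
  "ee K i j v \<longleftrightarrow> Ev i (Ev j v) = (\<Sum>d\<in>{-1..K}.
     binom2 (j - 1 - d) (i - 2 * d) * Ev (i + j - d) (Ev d v)
     + t * (binom2 (j - 1 - d) (i - 2 * d - 1) * Od (i + j - d - 1) (Od d v)))"

definition eo :: "int \<Rightarrow> int \<Rightarrow> int \<Rightarrow> 'a \<Rightarrow> bool" where
  "eo K i j v \<longleftrightarrow> Ev i (Od j v) = (\<Sum>d\<in>{-1..K}.
     binom2 (j - d) (i - 2 * d) * Od (i + j - d) (Ev d v)
     + binom2 (j - 1 - d) (i - 2 * d - 1) * (Ev (i + j - d) (Od d v) + r * Od (i + j - d - 1) (Od d v)))"

definition oe :: "int \<Rightarrow> int \<Rightarrow> int \<Rightarrow> 'a \<Rightarrow> bool" where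
  "oe K i j v \<longleftrightarrow> Od i (Ev j v) = (\<Sum>d\<in>{-1..K}.
     binom2 (j - 1 - d) (i - 2 * d) * Od (i + j - d) (Ev d v)
     + r * (binom2 (j - 1 - d) (i - 2 * d - 1) * Od (i + j - d - 1) (Od d v)))"

definition oo :: "int \<Rightarrow> int \<Rightarrow> int \<Rightarrow> 'a \<Rightarrow> bool" where
  "oo K i j v \<longleftrightarrow> Od i (Od j v) = (\<Sum>d\<in>{-1..K}.
     binom2 (j - 1 - d) (i - 2 * d - 1) * Od (i + j - d) (Od d v))"

text \<open>Apply \<open>S 1\<close> to the even relation: it turns an outer \<open>Ev\<close> into
  \<open>Od\<close>, kills an outer \<open>Od\<close>, and on the summands with factor
  \<open>t\<close> leaves the \<rho> term of \<open>S_1_t\<close>. The next lemma is the same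
  argument for an odd second index.\<close>

lemma oe_if_ee: "ee K i j v \<Longrightarrow> oe K i j v"
  unfolding ee_def oe_def
proof -
  assume "Ev i (Ev j v) = (\<Sum>d\<in>{-1..K}.
     binom2 (j - 1 - d) (i - 2 * d) * Ev (i + j - d) (Ev d v)
     + t * (binom2 (j - 1 - d) (i - 2 * d - 1) * Od (i + j - d - 1) (Od d v)))"
  from arg_cong[OF this, of "S 1"] show "Od i (Ev j v) = (\<Sum>d\<in>{-1..K}.
     binom2 (j - 1 - d) (i - 2 * d) * Od (i + j - d) (Ev d v)
     + r * (binom2 (j - 1 - d) (i - 2 * d - 1) * Od (i + j - d - 1) (Od d v)))"
    by (simp only: S_sum S_1_even S_add S_1_t S_binom2 S_1_odd mult_zero_right add_0_left)
qed

lemma oo_if_eo: "eo K i j v \<Longrightarrow> oo K i j v"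
  unfolding eo_def oo_def
proof -
  assume "Ev i (Od j v) = (\<Sum>d\<in>{-1..K}.
     binom2 (j - d) (i - 2 * d) * Od (i + j - d) (Ev d v)
     + binom2 (j - 1 - d) (i - 2 * d - 1) * (Ev (i + j - d) (Od d v) + r * Od (i + j - d - 1) (Od d v)))"
  from arg_cong[OF this, of "S 1"] show "Od i (Od j v) = (\<Sum>d\<in>{-1..K}.
     binom2 (j - 1 - d) (i - 2 * d - 1) * Od (i + j - d) (Od d v))"
    by (simp only: S_sum S_1_even S_add S_r S_binom2 S_1_odd mult_zero_right add_0_left add_0_right)
qed

definition adem_at :: "'a \<Rightarrow> bool" where
  "adem_at v \<longleftrightarrow> (\<forall>K i j. 0 \<le> K \<and> i \<le> K \<longrightarrow>
     (i < 2 * j \<longrightarrow> ee K i j v) \<and> (i \<le> 2 * j \<longrightarrow> eo K i j v))"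

lemma sum_single_int:
  fixes f :: "int \<Rightarrow> 'a"
  assumes "d0 \<in> {-1..K}" "\<And>d. d \<in> {-1..K} \<Longrightarrow> d \<noteq> d0 \<Longrightarrow> f d = 0"
  shows "sum f {-1..K} = f d0"
  using assms by (subst sum.remove[of _ d0]) (auto intro: sum.neutral)

lemma sum_shift_int:
  fixes f :: "int \<Rightarrow> 'a"
  assumes "0 \<le> K" "f (-1) = 0" "f (K + 1) = 0"
  shows "sum f {-1..K} = (\<Sum>d\<in>{-1..K}. f (d + 1))"
proof -
  have "sum f {-1..K} = sum f {0..K + 1}"
  proof -
    have "{-1..K} = insert (-1) {0..K}" "{0..K+1} = insert (K+1) {0..K}" using assms(1) by auto
    then show ?thesis using assms by simp
  qed
  also have "\<dots> = (\<Sum>d\<in>{-1..K}. f (d + 1))"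
    by (rule sum.reindex_bij_witness[of _ "\<lambda>d. d + 1" "\<lambda>d. d - 1"]) auto
  finally show ?thesis .
qed

text \<open>The relation with first index \<open>4 * j + 1\<close> and second index
  \<open>2 * j + 1\<close> has right side 0: the lower entry of each binomial coefficient is
  negative or exceeds the upper one.\<close>

lemma oo_diag:
  assumes "adem_at v" "0 \<le> K" "2 * j \<le> K"
  shows "Od (2 * j) (Od j v) = 0"
proof (cases "j < 0")
  case True then show ?thesis by (simp add: S_neg S_zero)
next
  case False
  have "oo K (2 * j) j v"
    using assms by (intro oo_if_eo) (auto simp: adem_at_def)
  moreover have "binom2 (j - 1 - d) (2 * j - 2 * d - 1) = (0::'a)" for d
    by (cases "d < j") (auto simp: binom2_neg binom2_gt)
  ultimately show ?thesis by (simp add: oo_def)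
qed

text \<open>The induction step meets \<open>ee\<close> and \<open>eo\<close> slightly outside the range of the Adem relations. With the
  convention for \<open>binom2 (-1)\<close> they remain true there, as consequences of the others.\<close>

lemma ee_edge:
  assumes "0 \<le> K" "2 * j \<le> K"
  shows "ee K (2 * j) j v"
proof (cases "j < 0")
  case True
  have "binom2 (j - 1 - d) (2 * j - 2 * d) * Ev (2 * j + j - d) (Ev d v)
     + t * (binom2 (j - 1 - d) (2 * j - 2 * d - 1) * Od (2 * j + j - d - 1) (Od d v)) = 0" for d
    using True by (cases "d < 0") (auto simp: S_neg S_zero binom2_neg)
  then show ?thesis using True by (simp add: ee_def S_neg S_zero)
next
  case False
  have *: "binom2 (j - 1 - d) (2 * j - 2 * d) * Ev (2 * j + j - d) (Ev d v)
     + t * (binom2 (j - 1 - d) (2 * j - 2 * d - 1) * Od (2 * j + j - d - 1) (Od d v)) = 0"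
    if "d \<noteq> j" for d
    using that by (cases "d < j") (auto simp: binom2_neg binom2_gt)
  show ?thesis unfolding ee_def
    by (subst sum_single_int[of j]) (use False assms * in \<open>auto simp: binom2_0 binom2_neg\<close>)
qed

text \<open>Only \<open>d = j\<close> survives, with coefficient \<open>binom2 (-1) 0 = 1\<close>.
  It contributes the left side together with an \<rho>-multiple of the composite that
  \<open>oo_diag\<close> kills.\<close>

lemma eo_edge_1:
  assumes "adem_at v" "0 \<le> K" "2 * j + 1 \<le> K"
  shows "eo K (2 * j + 1) j v"
proof (cases "j < 0")
  case True
  have "binom2 (j - d) (2 * j + 1 - 2 * d) * Od (2 * j + 1 + j - d) (Ev d v)
     + binom2 (j - 1 - d) (2 * j + 1 - 2 * d - 1) * (Ev (2 * j + 1 + j - d) (Od d v)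
       + r * Od (2 * j + 1 + j - d - 1) (Od d v)) = 0" for d
    using True by (cases "d < 0") (auto simp: S_neg S_zero binom2_neg)
  then show ?thesis using True by (simp add: eo_def S_neg S_zero)
next
  case False
  have *: "binom2 (j - d) (2 * j + 1 - 2 * d) * Od (2 * j + 1 + j - d) (Ev d v)
     + binom2 (j - 1 - d) (2 * j + 1 - 2 * d - 1) * (Ev (2 * j + 1 + j - d) (Od d v)
       + r * Od (2 * j + 1 + j - d - 1) (Od d v)) = 0" if "d \<noteq> j" for d
    using that by (cases "d < j") (auto simp: binom2_neg binom2_gt)
  have "Od (2 * j) (Od j v) = 0" by (rule oo_diag[OF assms(1,2)]) (use assms in auto)
  then show ?thesis unfolding eo_def
    by (subst sum_single_int[of j])
       (use False assms * in \<open>auto simp: binom2_0 binom2_gt\<close>)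
qed

text \<open>Two summands survive, both through a negative row of \<open>binom2\<close>:
  \<open>d = j\<close> gives the left side plus \<open>r * Od (2 * j + 1) (Od j v)\<close>, and
  \<open>d = j + 1\<close> gives \<open>Od (2 * j + 1) (Ev (j + 1) v)\<close>. The extra terms are
  equal by a genuine Adem relation and cancel.\<close>

lemma eo_edge_2:
  assumes "adem_at v" "0 \<le> K" "2 * j + 2 \<le> K"
  shows "eo K (2 * j + 2) j v"
proof (cases "j < 0")
  case True
  have z: "binom2 (j - d) (2 * j + 2 - 2 * d) * Od (2 * j + 2 + j - d) (Ev d v)
     + binom2 (j - 1 - d) (2 * j + 2 - 2 * d - 1) * (Ev (2 * j + 2 + j - d) (Od d v)
       + r * Od (2 * j + 2 + j - d - 1) (Od d v)) = 0" for d
    using True by (cases "d < 0"; cases "j = -1 \<and> d = 0") (auto simp: S_neg S_zero binom2_neg)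
  show ?thesis unfolding eo_def z using True by (simp add: S_neg S_zero)
next
  case False
  have *: "binom2 (j - d) (2 * j + 1 - 2 * d) * Od (2 * j + 1 + (j + 1) - d) (Ev d v)
     + r * (binom2 (j - d) (2 * j + 1 - 2 * d - 1) * Od (2 * j + 1 + (j + 1) - d - 1) (Od d v)) = 0"
    if "d \<noteq> j" for d
    using that by (cases "d < j") (auto simp: binom2_neg binom2_gt)
  have "oe K (2 * j + 1) (j + 1) v"
    using assms by (intro oe_if_ee) (auto simp: adem_at_def)
  then have 1: "Od (2 * j + 1) (Ev (j + 1) v) = r * Od (2 * j + 1) (Od j v)"
    unfolding oe_def
    by (subst (asm) sum_single_int[of j]) (use False assms * in \<open>auto simp: binom2_0 binom2_gt\<close>)
  have **: "binom2 (j - d) (2 * j + 2 - 2 * d) * Od (2 * j + 2 + j - d) (Ev d v)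
     + binom2 (j - 1 - d) (2 * j + 2 - 2 * d - 1) * (Ev (2 * j + 2 + j - d) (Od d v)
       + r * Od (2 * j + 2 + j - d - 1) (Od d v))
     = (if d = j then Ev (2 * j + 2) (Od j v) + r * Od (2 * j + 1) (Od j v) else 0)
       + (if d = j + 1 then Od (2 * j + 1) (Ev (j + 1) v) else 0)" for d
  proof -
    consider "d < j" | "d = j" | "d = j + 1" | "d > j + 1" by linarith
    then show ?thesis
      by cases (auto simp: binom2_neg binom2_gt binom2_0 binom2_minus_1 algebra_simps)
  qed
  show ?thesis
    unfolding eo_def ** using False assms 1
    by (simp add: sum.distrib sum.delta add_self add.assoc)
qed

section \<open>The induction step along \<tau>\<close>

lemma EE_t: "Ev m (Ev n (t * v)) =
    t * Ev m (Ev n v) + t * (r * Od (m - 1) (Ev n v)) + t * (r * Ev m (Od (n - 1) v)) + t * (r\<^sup>2 * Od (m - 1) (Od (n - 1) v))"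
  by (simp only: E_t O_t S_add S_r mult.assoc) (simp add: algebra_simps power2_eq_square)

lemma OO_t: "Od m (Od n (t * v)) =
    t * Od m (Od n v) + r * Ev m (Od n v) + r\<^sup>2 * Od (m - 1) (Od n v) + r * Od m (Ev n v) + r\<^sup>2 * Od m (Od (n - 1) v)"
  by (simp only: E_t O_t S_add S_r_left mult.assoc)

lemma EO_t: "Ev m (Od n (t * v)) =
    t * Ev m (Od n v) + t * (r * Od (m - 1) (Od n v)) + r * Ev m (Ev n v) + r\<^sup>2 * Ev m (Od (n - 1) v)"
  by (simp only: E_t O_t S_add S_r_left mult.assoc)

lemma OE_t: "Od m (Ev n (t * v)) =
    t * Od m (Ev n v) + r * Ev m (Ev n v) + r\<^sup>2 * Od (m - 1) (Ev n v)
    + r * (t * Od m (Od (n - 1) v)) + r\<^sup>2 * Ev m (Od (n - 1) v) + r^3 * Od (m - 1) (Od (n - 1) v)"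
  by (simp only: E_t O_t S_add S_r_left mult.assoc) (simp add: algebra_simps power2_eq_square power3_eq_cube)

text \<open>The Cartan formula, used for both squares, expresses the left side at
  \<open>t * v\<close> through composites at \<open>v\<close> with indices \<open>(i, j)\<close>,
  \<open>(i - 1, j)\<close>, \<open>(i, j - 1)\<close> and \<open>(i - 1, j - 1)\<close>, one for
  each combination of parities. The relations for these rewrite it in the composites that appear on
  the right side.\<close>

lemma ee_step:
  assumes v: "adem_at v" and K: "0 \<le> K" "i \<le> K" and ij: "i < 2 * j"
  shows "ee K i j (t * v)"
proof -
  define n where "n = i + j"
  have 1: "ee K i j v" "oe K (i - 1) j v" "oo K (i - 1) (j - 1) v"
    using v K ij by (auto simp: adem_at_def intro!: oe_if_ee oo_if_eo)
  \<comment> \<open>For \<open>i = 2 * j - 1\<close> the pair \<open>(i, j - 1)\<close> lies one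
    step beyond the Adem range.\<close>
  have 2: "eo K i (j - 1) v"
  proof (cases "i = 2 * j - 1")
    case True
    then show ?thesis using eo_edge_1[OF v K(1), of "j - 1"] K by simp
  next
    case False
    then show ?thesis using v K ij by (auto simp: adem_at_def)
  qed
  \<comment> \<open>\<open>?H\<close> collects the terms in which the Cartan formula lowers the
    inner square to \<open>Od (d - 1)\<close>. Shifting \<open>d\<close> by one turns them into
    composites with inner square \<open>Od d\<close>, comparable with those in
    \<open>?A\<close>.\<close>
  let ?H = "\<lambda>d. t * (r * (binom2 (j - 1 - d) (i - 2 * d) * Ev (n - d) (Od (d - 1) v)))
     + t * (r\<^sup>2 * (binom2 (j - 1 - d) (i - 2 * d) * Od (n - d - 1) (Od (d - 1) v)))
     + t * (r\<^sup>2 * (binom2 (j - 1 - d) (i - 2 * d - 1) * Od (n - d - 1) (Od (d - 1) v)))"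
  let ?A = "\<lambda>d. binom2 (j - 1 - d) (i - 2 * d) * (t * Ev (n - d) (Ev d v) + t * (r * Od (n - d - 1) (Ev d v)))
     + t * (binom2 (j - 1 - d) (i - 2 * d - 1) *
        (t * Od (n - d - 1) (Od d v) + r * Ev (n - d - 1) (Od d v) + r\<^sup>2 * Od (n - d - 2) (Od d v)
         + r * Od (n - d - 1) (Ev d v)))"
  have "(\<Sum>d\<in>{-1..K}. binom2 (j - 1 - d) (i - 2 * d) * Ev (n - d) (Ev d (t * v))
     + t * (binom2 (j - 1 - d) (i - 2 * d - 1) * Od (n - d - 1) (Od d (t * v))))
     = (\<Sum>d\<in>{-1..K}. ?A d + ?H d)"
    unfolding EE_t OO_t by (rule sum.cong) (simp_all add: algebra_simps)
  also have "\<dots> = (\<Sum>d\<in>{-1..K}. ?A d + ?H (d + 1))"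
  proof -
    have "sum ?H {-1..K} = (\<Sum>d\<in>{-1..K}. ?H (d + 1))"
      by (rule sum_shift_int) (use K in \<open>simp_all add: S_neg S_zero binom2_neg\<close>)
    then show ?thesis unfolding sum.distrib[of ?A] by (rule arg_cong)
  qed
  also have "\<dots> = Ev i (Ev j (t * v))"
    unfolding EE_t 1[unfolded ee_def oe_def oo_def] 2[unfolded eo_def] sum_distrib_left sum.distrib[symmetric]
  proof (rule sum.cong, goal_cases)
    case (2 d)
    \<comment> \<open>The relations for \<open>j - 1\<close> have coefficients in row
      \<open>j - 2 - d\<close>; Pascal's rule brings the other coefficients into that row.\<close>
    have p1: "(binom2 (j - 1 - d) (i - 2 * d - 1) :: 'a)
        = binom2 (j - 2 - d) (i - 2 * d - 1) + binom2 (j - 2 - d) (i - 2 * d - 2)"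
    proof -
      have "0 \<le> j - 1 - d \<or> i - 2 * d - 1 < 0" using ij by linarith
      from binom2_pascal[OF this] show ?thesis by (simp add: algebra_simps)
    qed
    have p2: "(binom2 (j - 1 - d) (i - 2 * d - 2) :: 'a)
        = binom2 (j - 2 - d) (i - 2 * d - 2) + binom2 (j - 2 - d) (i - 2 * d - 3)"
    proof -
      have "0 \<le> j - 1 - d \<or> i - 2 * d - 2 < 0" using ij by linarith
      from binom2_pascal[OF this] show ?thesis by (simp add: algebra_simps)
    qed
    define B where "B = (binom2 (j - 1 - d) (i - 2 * d) :: 'a)"
    have e: "j - 1 - (d + 1) = j - 2 - d" "i - 2 * (d + 1) = i - 2 * d - 2" "i - 2 * d - 2 - 1 = i - 2 * d - 3"
      "n - (d + 1) = n - d - 1" "n - d - 1 - 1 = n - d - 2" "d + 1 - 1 = d" "i - 1 + j - d = n - d - 1"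
      "i + j - d = n - d" "i - 1 - 2 * d = i - 2 * d - 1" "i - 2 * d - 1 - 1 = i - 2 * d - 2"
      "i + (j - 1) - d = n - d - 1" "j - 1 - 1 - d = j - 2 - d" "i - 1 + (j - 1) - d = n - d - 2"
      by (simp_all add: n_def)
    show ?case unfolding e p1 p2 B_def[symmetric]
      by (simp add: algebra_simps add_self add_self_left power2_eq_square)
  qed simp
  finally show ?thesis by (simp add: ee_def n_def)
qed

text \<open>As in the even case, but the second index changes parity as well: the relations at
  \<open>v\<close> are \<open>eo\<close> and \<open>ee\<close> for \<open>(i, j)\<close>,
  \<open>oo\<close> for \<open>(i - 1, j)\<close> and \<open>eo\<close> for
  \<open>(i, j - 1)\<close>. Two of them leave the Adem range when \<open>i = 2 * j\<close>, and one
  when \<open>i = 2 * j - 1\<close>.\<close>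

lemma eo_step:
  assumes v: "adem_at v" and K: "0 \<le> K" "i \<le> K" and ij: "i \<le> 2 * j"
  shows "eo K i j (t * v)"
proof -
  define n where "n = i + j"
  have 1: "eo K i j v" "oo K (i - 1) j v"
    using v K ij by (auto simp: adem_at_def intro!: oe_if_ee oo_if_eo)
  have 2: "ee K i j v"
  proof (cases "i = 2 * j")
    case True
    then show ?thesis using ee_edge[OF K(1), of j] K by simp
  next
    case False
    then show ?thesis using v K ij by (auto simp: adem_at_def)
  qed
  have 3: "eo K i (j - 1) v"
  proof -
    have "i = 2 * j \<or> i = 2 * j - 1 \<or> i \<le> 2 * (j - 1)" using ij by presburger
    then consider "i = 2 * j" | "i = 2 * j - 1" | "i \<le> 2 * (j - 1)" by blast
    then show ?thesis
      using v K ij eo_edge_1[OF v K(1), of "j - 1"] eo_edge_2[OF v K(1), of "j - 1"]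
      by cases (auto simp: adem_at_def)
  qed
  let ?H = "\<lambda>d. binom2 (j - d) (i - 2 * d) * (r * (t * Od (n - d) (Od (d - 1) v))
       + r\<^sup>2 * Ev (n - d) (Od (d - 1) v) + r^3 * Od (n - d - 1) (Od (d - 1) v))
     + binom2 (j - 1 - d) (i - 2 * d - 1) * (r\<^sup>2 * Ev (n - d) (Od (d - 1) v) + r^3 * Od (n - d - 1) (Od (d - 1) v))"
  let ?A = "\<lambda>d. binom2 (j - d) (i - 2 * d) * (t * Od (n - d) (Ev d v) + r * Ev (n - d) (Ev d v)
       + r\<^sup>2 * Od (n - d - 1) (Ev d v))
     + binom2 (j - 1 - d) (i - 2 * d - 1) * (t * Ev (n - d) (Od d v) + t * (r * Od (n - d - 1) (Od d v))
       + r * Ev (n - d) (Ev d v)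
       + r * (t * Od (n - d - 1) (Od d v) + r * Ev (n - d - 1) (Od d v) + r\<^sup>2 * Od (n - d - 2) (Od d v)
         + r * Od (n - d - 1) (Ev d v)))"
  have "(\<Sum>d\<in>{-1..K}. binom2 (j - d) (i - 2 * d) * Od (n - d) (Ev d (t * v))
     + binom2 (j - 1 - d) (i - 2 * d - 1) * (Ev (n - d) (Od d (t * v)) + r * Od (n - d - 1) (Od d (t * v))))
     = (\<Sum>d\<in>{-1..K}. ?A d + ?H d)"
    unfolding OE_t EO_t OO_t by (rule sum.cong) (simp_all add: algebra_simps power2_eq_square power3_eq_cube)
  also have "\<dots> = (\<Sum>d\<in>{-1..K}. ?A d + ?H (d + 1))"
  proof -
    have "sum ?H {-1..K} = (\<Sum>d\<in>{-1..K}. ?H (d + 1))"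
      by (rule sum_shift_int) (use K in \<open>simp_all add: S_neg S_zero binom2_neg\<close>)
    then show ?thesis unfolding sum.distrib[of ?A] by (rule arg_cong)
  qed
  also have "\<dots> = Ev i (Od j (t * v))"
    unfolding EO_t 1[unfolded eo_def oo_def] 2[unfolded ee_def] 3[unfolded eo_def] sum_distrib_left sum.distrib[symmetric]
  proof (rule sum.cong, goal_cases)
    case (2 d)
    have p1: "(binom2 (j - 1 - d) (i - 2 * d - 1) :: 'a)
        = binom2 (j - 2 - d) (i - 2 * d - 1) + binom2 (j - 2 - d) (i - 2 * d - 2)"
    proof -
      have "0 \<le> j - 1 - d \<or> i - 2 * d - 1 < 0" using ij by linarith
      from binom2_pascal[OF this] show ?thesis by (simp add: algebra_simps)
    qed
    have p2: "(binom2 (j - 1 - d) (i - 2 * d - 2) :: 'a)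
        = binom2 (j - 2 - d) (i - 2 * d - 2) + binom2 (j - 2 - d) (i - 2 * d - 3)"
    proof -
      have "0 \<le> j - 1 - d \<or> i - 2 * d - 2 < 0" using ij by linarith
      from binom2_pascal[OF this] show ?thesis by (simp add: algebra_simps)
    qed
    have p3: "(binom2 (j - d) (i - 2 * d) :: 'a)
        = binom2 (j - 1 - d) (i - 2 * d) + (binom2 (j - 2 - d) (i - 2 * d - 1) + binom2 (j - 2 - d) (i - 2 * d - 2))"
    proof -
      have "0 \<le> j - d \<or> i - 2 * d < 0" using ij by linarith
      from binom2_pascal[OF this] show ?thesis unfolding p1[symmetric] by (simp add: algebra_simps)
    qed
    define B where "B = (binom2 (j - 1 - d) (i - 2 * d) :: 'a)"
    have e: "j - 1 - (d + 1) = j - 2 - d" "j - (d + 1) = j - 1 - d" "i - 2 * (d + 1) = i - 2 * d - 2" "i - 2 * d - 2 - 1 = i - 2 * d - 3"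
      "n - (d + 1) = n - d - 1" "n - d - 1 - 1 = n - d - 2" "d + 1 - 1 = d" "i - 1 + j - d = n - d - 1"
      "i + j - d = n - d" "i - 1 - 2 * d = i - 2 * d - 1" "i - 2 * d - 1 - 1 = i - 2 * d - 2"
      "i + (j - 1) - d = n - d - 1" "j - 1 - 1 - d = j - 2 - d" "i - 1 + (j - 1) - d = n - d - 2"
      by (simp_all add: n_def)
    show ?case unfolding e p1 p2 p3 B_def[symmetric]
      by (simp add: algebra_simps add_self add_self_left power2_eq_square power3_eq_cube)
  qed simp
  finally show ?thesis by (simp add: eo_def n_def)
qed

theorem adem_at_t: "adem_at v \<Longrightarrow> adem_at (t * v)"
  using ee_step eo_step by (auto simp: adem_at_def)

lemma adem_at_r: "adem_at v \<Longrightarrow> adem_at (r * v)"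
  by (auto simp: adem_at_def ee_def eo_def S_r sum_distrib_left algebra_simps intro!: sum.cong)

lemma adem_at_0: "adem_at 0"
  by (auto simp: adem_at_def ee_def eo_def S_zero)

lemma adem_at_add: "adem_at v \<Longrightarrow> adem_at w \<Longrightarrow> adem_at (v + w)"
  by (auto simp: adem_at_def ee_def eo_def S_add sum.distrib algebra_simps)

end

section \<open>Modules over the Steenrod algebra\<close>

lemma free_alg_add_self: "(p :: free_alg) + p = 0"
  by (rule poly_mapping_eqI) (simp add: lookup_add)

lemma abs_AR_eq_0_iff: "abs_AR p = 0 \<longleftrightarrow> p \<in> rel_ideal"
  by (simp add: zero_AR_def AR.abs_eq_iff rel_eq_def)

lemma abs_AR_relator: "r \<in> relators \<Longrightarrow> abs_AR r = 0"
  by (simp add: abs_AR_eq_0_iff rel_ideal.relator)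

lemma abs_AR_simps:
  "abs_AR (p + q) = abs_AR p + abs_AR q" "abs_AR (p - q) = abs_AR p - abs_AR q"
  "abs_AR (p * q) = abs_AR p * abs_AR q" "abs_AR 0 = 0" "abs_AR 1 = 1"
  "abs_AR fT = tau" "abs_AR fR = rho" "abs_AR (fS n) = Sq n"
  by (simp_all add: plus_AR.abs_eq minus_AR.abs_eq times_AR.abs_eq zero_AR_def one_AR_def
      tau_def rho_def Sq_def)

lemma abs_AR_sum: "abs_AR (sum f A) = (\<Sum>x\<in>A. abs_AR (f x))"
  by (induction A rule: infinite_finite_induct) (simp_all add: abs_AR_simps)

lemma abs_AR_power: "abs_AR (p ^ n) = abs_AR p ^ n"
  by (induction n) (simp_all add: abs_AR_simps)

lemma AR_cases [cases type: AR]: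
  obtains (abs_AR) p where "a = abs_AR p"
  using Quotient_abs_rep[OF Quotient_AR, of a] by metis

lemma AR_add_self: "(a :: AR) + a = 0"
  by (cases a) (simp add: abs_AR_simps(1)[symmetric] free_alg_add_self abs_AR_simps(4))

lemma AR_diff: "(a :: AR) - b = a + b"
  by (metis AR_add_self add_diff_cancel_right' add.assoc add.right_neutral)

section \<open>Actions of the free algebra and of its quotient\<close>

definition bit_scale :: "bit \<Rightarrow> 'v::ab_group_add \<Rightarrow> 'v" where
  "bit_scale b x = (if b = 1 then x else 0)"

locale letter_action =
  fixes L :: "letter \<Rightarrow> 'v::ab_group_add \<Rightarrow> 'v"
  assumes L_add: "L l (x + y) = L l x + L l y"
    and add_self: "(x :: 'v) + x = 0"
begin

definition word_act :: "word \<Rightarrow> 'v \<Rightarrow> 'v" where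
  "word_act w = foldr L (letters w)"

definition free_act :: "free_alg \<Rightarrow> 'v \<Rightarrow> 'v" where
  "free_act p v = (\<Sum>w\<in>Poly_Mapping.keys p. bit_scale (Poly_Mapping.lookup p w) (word_act w v))"

lemma word_act_add: "word_act w (x + y) = word_act w x + word_act w y"
proof -
  have "foldr L ls (x + y) = foldr L ls x + foldr L ls y" for ls
    by (induction ls) (simp_all add: L_add)
  then show ?thesis by (simp add: word_act_def)
qed

lemma word_act_0: "word_act w 0 = 0"
  using word_act_add[of w 0 0] by simp

lemma word_act_plus: "word_act (u + w) v = word_act u (word_act w v)"
  by (simp add: word_act_def plus_word_def)

lemma bit_scale_add: "bit_scale (b + c) (x :: 'v) = bit_scale b x + bit_scale c x"
  by (cases b; cases c) (simp_all add: bit_scale_def add_self)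

lemma bit_scale_0 [simp]: "bit_scale 0 x = 0"
  by (simp add: bit_scale_def)

lemma free_act_superset:
  assumes "finite A" "Poly_Mapping.keys p \<subseteq> A"
  shows "free_act p v = (\<Sum>w\<in>A. bit_scale (Poly_Mapping.lookup p w) (word_act w v))"
  unfolding free_act_def using assms
  by (intro sum.mono_neutral_left) (auto simp: Poly_Mapping.in_keys_iff bit_scale_def)

lemma free_act_add_left: "free_act (p + q) v = free_act p v + free_act q v"
proof -
  let ?A = "Poly_Mapping.keys p \<union> Poly_Mapping.keys q"
  have "free_act (p + q) v = (\<Sum>w\<in>?A. bit_scale (Poly_Mapping.lookup (p + q) w) (word_act w v))"
    by (rule free_act_superset) (use Poly_Mapping.keys_add[of p q] in auto)
  also have "\<dots> = free_act p v + free_act q v"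
    by (simp only: Poly_Mapping.lookup_add bit_scale_add sum.distrib free_act_superset[of ?A]
        finite_Un finite_keys Un_upper1 Un_upper2)
  finally show ?thesis .
qed

lemma free_act_0_left: "free_act 0 v = 0"
  by (simp add: free_act_def)

lemma free_act_sum_left: "free_act (sum f A) v = (\<Sum>x\<in>A. free_act (f x) v)"
  by (induction A rule: infinite_finite_induct) (simp_all add: free_act_0_left free_act_add_left)

lemma free_act_diff_left: "free_act (p - q) v = free_act p v - free_act q v"
  using free_act_add_left[of "p - q" q v] by (simp add: algebra_simps)

lemma free_act_add_right: "free_act p (x + y) = free_act p x + free_act p y"
proof -
  have "bit_scale b (x + y) = bit_scale b x + bit_scale b y" for b and x y :: 'v
    by (simp add: bit_scale_def)
  then show ?thesis by (simp add: free_act_def word_act_add sum.distrib)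
qed

lemma free_act_0_right: "free_act p 0 = 0"
  using free_act_add_right[of p 0 0] by simp

lemma free_act_sum_right: "free_act p (sum f A) = (\<Sum>x\<in>A. free_act p (f x))"
  by (induction A rule: infinite_finite_induct) (simp_all add: free_act_0_right free_act_add_right)

lemma free_act_single: "free_act (Poly_Mapping.single w b) v = bit_scale b (word_act w v)"
  by (cases "b = 0") (simp_all add: free_act_def)

lemma free_act_mult: "free_act (p * q) v = free_act p (free_act q v)"
proof -
  have *: "free_act (Poly_Mapping.single u b * Poly_Mapping.single w c) v =
      free_act (Poly_Mapping.single u b) (free_act (Poly_Mapping.single w c) v)" for u w b c
    by (cases b; cases c)
       (simp_all add: mult_single free_act_single bit_scale_def word_act_plus word_act_0 free_act_0_left free_act_0_right)
  have "p * q = (\<Sum>u\<in>Poly_Mapping.keys p. Poly_Mapping.single u (Poly_Mapping.lookup p u)) *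
                (\<Sum>w\<in>Poly_Mapping.keys q. Poly_Mapping.single w (Poly_Mapping.lookup q w))"
    using free_alg_decomp[of p] free_alg_decomp[of q] by metis
  then have "free_act (p * q) v =
      free_act (\<Sum>u\<in>Poly_Mapping.keys p. Poly_Mapping.single u (Poly_Mapping.lookup p u))
        (free_act (\<Sum>w\<in>Poly_Mapping.keys q. Poly_Mapping.single w (Poly_Mapping.lookup q w)) v)"
    by (simp add: sum_product free_act_sum_left free_act_sum_right *) (rule sum.swap)
  then show ?thesis by (simp only: free_alg_decomp[symmetric])
qed

lemma free_act_1: "free_act 1 v = v"
  by (simp add: free_act_single word_act_def zero_word_def bit_scale_def flip: single_one)

lemma free_act_gen: "free_act (gen l) v = L l v"
  by (simp add: gen_def free_act_single word_act_def bit_scale_def)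

lemma free_act_of_nat: "free_act (of_nat n) v = (if odd n then v else 0)"
  by (induction n) (simp_all add: free_act_0_left free_act_add_left free_act_1 add_self)

lemmas free_act_simps = free_act_add_left free_act_diff_left free_act_mult free_act_1 free_act_gen
  free_act_sum_left free_act_of_nat free_act_0_left

end

text \<open>The universal property of the presentation: additive maps for the letters that
  annihilate the relators give an action of \<open>AR\<close>. It serves twice, for the grading of
  \<open>AR\<close> and for the module structures.\<close>

locale AR_action = letter_action +
  assumes relators: "r \<in> relators \<Longrightarrow> free_act r v = 0"
begin

lemma free_act_rel_ideal: "p \<in> rel_ideal \<Longrightarrow> free_act p v = 0"
proof (induction arbitrary: v rule: rel_ideal.induct)
  case (relator r) then show ?case by (rule relators)
qed (simp_all add: free_act_simps free_act_0_right)

definition act :: "AR \<Rightarrow> 'a \<Rightarrow> 'a" where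
  "act a = free_act (rep_AR a)"

lemma act_abs_AR: "act (abs_AR p) v = free_act p v"
proof -
  have "rel_eq (rep_AR (abs_AR p)) p"
    by (simp add: AR.abs_eq_iff[symmetric] Quotient_abs_rep[OF Quotient_AR])
  then have "free_act (rep_AR (abs_AR p) - p) v = 0"
    unfolding rel_eq_def by (rule free_act_rel_ideal)
  then show ?thesis by (simp add: act_def free_act_diff_left)
qed

lemma act_add_left: "act (a + b) v = act a v + act b v"
  by (cases a; cases b) (simp add: act_abs_AR free_act_simps flip: abs_AR_simps)

lemma act_mult: "act (a * b) v = act a (act b v)"
  by (cases a; cases b) (simp add: act_abs_AR free_act_simps flip: abs_AR_simps)

lemma act_1: "act 1 v = v"
  by (simp add: act_abs_AR free_act_simps flip: abs_AR_simps)

lemma act_add_right: "act a (x + y) = act a x + act a y"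
  by (cases a) (simp add: act_abs_AR free_act_add_right)

lemma act_letter: "act (abs_AR (gen l)) v = L l v"
  by (simp add: act_abs_AR free_act_gen)

lemma act_gens: "act tau v = L Tau v" "act rho v = L Rho v" "act (Sq n) v = L (Square n) v"
  by (simp_all add: act_letter flip: abs_AR_simps)

lemma act_diff_left: "act (a - b) v = act a v - act b v"
  using act_add_left[of "a - b" b v] by (simp add: algebra_simps)

lemma act_homogeneous:
  fixes H :: "int \<times> int \<Rightarrow> 'a set"
  assumes 0: "\<And>d. 0 \<in> H d" and add: "\<And>d x y. x \<in> H d \<Longrightarrow> y \<in> H d \<Longrightarrow> x + y \<in> H d"
    and L: "\<And>l d x. x \<in> H d \<Longrightarrow> L l x \<in> H (letter_deg l + d)"
    and a: "a \<in> AR_deg d" and x: "x \<in> H e"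
  shows "act a x \<in> H (d + e)"
proof -
  obtain p where p: "a = abs_AR p" "\<forall>w\<in>Poly_Mapping.keys p. word_deg w = d"
    using a by (auto simp: AR_deg_def)
  have sum: "(\<And>w. w \<in> A \<Longrightarrow> f w \<in> H d) \<Longrightarrow> sum f A \<in> H d" for f d and A :: "word set"
    by (induction A rule: infinite_finite_induct) (auto simp: 0 add)
  have word: "word_act w x \<in> H (word_deg w + e)" for w
  proof -
    have "foldr L ls x \<in> H (sum_list (map letter_deg ls) + e)" for ls
      by (induction ls) (auto simp: x zero_prod_def[symmetric] add.assoc intro: L)
    then show ?thesis by (simp add: word_act_def word_deg_def)
  qed
  show ?thesis
    unfolding p act_abs_AR free_act_def bit_scale_def using p(2) word 0
    by (intro sum) force
qed

end

lemma AR_induct [case_names diff mult one tau rho Sq]: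
  assumes "\<And>a b. P a \<Longrightarrow> P b \<Longrightarrow> P (a - b)" "\<And>a b. P a \<Longrightarrow> P b \<Longrightarrow> P (a * b)"
    and "P 1" "P tau" "P rho" "\<And>n. P (Sq n)"
  shows "P a"
proof (cases a)
  case (abs_AR p)
  have add: "P x \<Longrightarrow> P y \<Longrightarrow> P (x + y)" for x y using assms(1)[of x y] by (simp add: AR_diff)
  have 0: "P 0" using assms(1)[OF assms(3) assms(3)] by simp
  have gen: "P (abs_AR (gen l))" for l by (cases l) (simp_all add: abs_AR_simps assms)
  have word: "P (abs_AR (Poly_Mapping.single (Word ls) 1))" for ls
  proof (induction ls)
    case Nil then show ?case using assms(3) by (simp add: abs_AR_simps flip: zero_word_def)
  next
    case (Cons l ls)
    have "Poly_Mapping.single (Word (l # ls)) (1::bit) = gen l * Poly_Mapping.single (Word ls) 1"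
      by (simp add: gen_def mult_single plus_word_def)
    then show ?case using assms(2)[OF gen Cons.IH] by (simp add: abs_AR_simps)
  qed
  have single: "P (abs_AR (Poly_Mapping.single w b))" for w b
    using word[of "letters w"] by (cases b) (simp_all add: abs_AR_simps 0)
  have "P (abs_AR (\<Sum>w\<in>A. Poly_Mapping.single w (Poly_Mapping.lookup p w)))" for A
    by (induction A rule: infinite_finite_induct) (simp_all add: abs_AR_simps 0 add single)
  then show ?thesis using abs_AR free_alg_decomp[of p] by metis
qed

section \<open>The grading\<close>

lemma word_deg_plus: "word_deg (u + w) = word_deg u + word_deg w"
  by (simp add: word_deg_def plus_word_def)

definition homogeneous :: "int \<times> int \<Rightarrow> free_alg \<Rightarrow> bool" where
  "homogeneous d p \<longleftrightarrow> (\<forall>w\<in>Poly_Mapping.keys p. word_deg w = d)"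

lemma homogeneous_0: "homogeneous d 0"
  by (simp add: homogeneous_def)

lemma homogeneous_add: "homogeneous d p \<Longrightarrow> homogeneous d q \<Longrightarrow> homogeneous d (p + q)"
  using Poly_Mapping.keys_add[of p q] by (auto simp: homogeneous_def)

lemma homogeneous_diff: "homogeneous d p \<Longrightarrow> homogeneous d q \<Longrightarrow> homogeneous d (p - q)"
  using keys_diff[of p q] by (auto simp: homogeneous_def)

lemma homogeneous_mult: "homogeneous d p \<Longrightarrow> homogeneous e q \<Longrightarrow> homogeneous (d + e) (p * q)"
  using keys_mult[of p q] by (fastforce simp: homogeneous_def word_deg_plus)

lemma homogeneous_sum: "(\<And>x. x \<in> A \<Longrightarrow> homogeneous d (f x)) \<Longrightarrow> homogeneous d (sum f A)"
  by (induction A rule: infinite_finite_induct) (auto simp: homogeneous_0 homogeneous_add)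

lemma homogeneous_1: "homogeneous 0 1"
  by (auto simp: homogeneous_def word_deg_def zero_word_def keys_one)

lemma homogeneous_of_nat: "homogeneous 0 (of_nat n)"
  by (induction n) (simp_all add: homogeneous_0 homogeneous_add homogeneous_1)

lemma homogeneous_gen: "homogeneous (letter_deg l) (gen l)"
  by (simp add: homogeneous_def gen_def word_deg_def)

lemma homogeneous_mult':
  "homogeneous d p \<Longrightarrow> homogeneous e q \<Longrightarrow> f = d + e \<Longrightarrow> homogeneous f (p * q)"
  by (simp add: homogeneous_mult)

lemma homogeneous_Tau_power: "homogeneous (0, int n) (fT ^ n)"
  by (induction n)
     (auto intro: homogeneous_mult' homogeneous_gen homogeneous_1 simp flip: zero_prod_def
       intro!: homogeneous_mult'[OF homogeneous_gen])

text \<open>The point is the weight, since \<open>n div 2\<close> is not additive. For even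
  \<open>a\<close> and \<open>b\<close> and odd \<open>c\<close> the two odd squares fall short by
  1, which \<tau> supplies. In the \<rho> terms degree and weight both fall short by 1, the bidegree
  of \<rho>.\<close>

lemma homogeneous_adem_rhs:
  assumes "0 < a" "a < 2 * b"
  shows "homogeneous (int (a + b), int (a div 2 + b div 2)) (adem_rhs a b)"
proof -
  let ?d = "(int (a + b), int (a div 2 + b div 2))"
  have mono: "homogeneous ?d (of_nat k * x * fS m * fS c)"
    if "homogeneous e x" "e = (int (a + b) - int m - int c, int (a div 2 + b div 2) - int (m div 2) - int (c div 2))"
    for k x m c e
    by (rule homogeneous_mult'[OF homogeneous_mult'[OF homogeneous_mult'[OF homogeneous_of_nat that(1) refl]
          homogeneous_gen refl] homogeneous_gen]) (simp add: that(2))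
  have mono1: "homogeneous ?d (of_nat k * fS m * fS c)"
    if "a + b = m + c \<and> a div 2 + b div 2 = m div 2 + c div 2" for k m c
  proof -
    have *: "int a + int b = int m + int c" "int (a div 2) + int (b div 2) = int (m div 2) + int (c div 2)"
      using that by presburger+
    show ?thesis using mono[OF homogeneous_1, of m c k] * by (simp add: zero_prod_def)
  qed
  have monoR: "homogeneous ?d (of_nat k * fR * fS m * fS c)"
    if "a + b = m + c + 1 \<and> a div 2 + b div 2 = m div 2 + c div 2 + 1" for k m c
  proof -
    have *: "int a + int b = int m + int c + 1"
      "int (a div 2) + int (b div 2) = int (m div 2) + int (c div 2) + 1"
      using that by presburger+
    show ?thesis by (rule mono[OF homogeneous_gen]) (use * in simp)
  qed
  have monoT: "homogeneous ?d (of_nat k * fT ^ l * fS m * fS c)"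
    if "a + b = m + c \<and> a div 2 + b div 2 = m div 2 + c div 2 + l" for k m c l
  proof -
    have *: "int a + int b = int m + int c"
      "int (a div 2) + int (b div 2) = int (m div 2) + int (c div 2) + int l"
      using that by presburger+
    show ?thesis by (rule mono[OF homogeneous_Tau_power]) (use * in simp)
  qed
  have diff: thesis if "c \<le> a div 2" "\<And>k. a + b = c + k \<Longrightarrow> a + b - c = k \<Longrightarrow> 0 < k \<Longrightarrow> thesis" for c thesis
  proof (rule that(2))
    show "a + b = c + (a + b - c)" "0 < a + b - c" using that(1) assms by linarith+
  qed simp
  have T: "a + b = a + b - c + c \<and> a div 2 + b div 2 = (a + b - c) div 2 + c div 2 + c mod 2"
    if ab: "even a" "even b" and c: "c \<le> a div 2" for c
  proof (rule diff[OF c])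
    fix k assume k: "a + b = c + k" "a + b - c = k"
    then have "even c = even k" using ab by (metis even_add)
    with k(1) ab show ?thesis unfolding k(2) by (cases "even c") (auto elim!: evenE oddE)
  qed
  have 1: "a + b = a + b - c + c \<and> a div 2 + b div 2 = (a + b - c) div 2 + c div 2"
    if c: "c \<le> a div 2" and ab: "even a \<and> odd b \<or> odd a \<and> even b \<and> even c \<or> odd a \<and> odd b \<and> odd c" for c
  proof (rule diff[OF c])
    fix k assume k: "a + b = c + k" "a + b - c = k"
    then have "even (a + b) = even (c + k)" by simp
    with k(1) ab show ?thesis unfolding k(2) by (cases "even c") (auto elim!: evenE oddE)
  qed
  have R: "a + b = a + b - Suc c + c + 1 \<and> a div 2 + b div 2 = (a + b - Suc c) div 2 + c div 2 + 1"
    if c: "c \<le> a div 2" "odd c" and ab: "even a \<and> odd b \<or> odd a \<and> even b" for c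
  proof (rule diff[OF c(1)])
    fix k assume k: "a + b = c + k" "a + b - c = k" "0 < k"
    then have "even (a + b) = even (c + k)" by simp
    then have "odd (k - 1)" using ab c k(3) by auto
    moreover have "a + b = c + (k - 1) + 1" using k by simp
    moreover have "a + b - Suc c = k - 1" using k by simp
    ultimately show ?thesis using ab c(2) by (auto elim!: evenE oddE)
  qed
  show ?thesis
  proof (cases "even a")
    case a: True
    show ?thesis
    proof (cases "even b")
      case True
      with a show ?thesis by (simp add: adem_rhs_def del: of_nat_add) (intro homogeneous_sum monoT T; simp)
    next
      case False
      with a show ?thesis
        by (simp add: adem_rhs_def del: of_nat_add) (intro homogeneous_add homogeneous_sum mono1 monoR 1 R; simp)
    qed
  next
    case a: False
    show ?thesis
    proof (cases "even b")
      case True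
      with a show ?thesis
        by (simp add: adem_rhs_def del: of_nat_add) (intro homogeneous_add homogeneous_sum mono1 monoR 1 R; simp)
    next
      case False
      with a show ?thesis
        by (simp add: adem_rhs_def del: of_nat_add) (intro homogeneous_sum mono1 1; simp)
    qed
  qed
qed

lemma homogeneous_relator: "r \<in> relators \<Longrightarrow> \<exists>d. homogeneous d r"
proof (induction rule: relators.induct)
  note m = homogeneous_mult'[OF homogeneous_gen homogeneous_gen]
  note m3 = homogeneous_mult'[OF homogeneous_mult'[OF homogeneous_gen homogeneous_gen refl] homogeneous_gen]
  { case Sq_zero
    show ?case using homogeneous_diff[OF homogeneous_gen[of "Square 0"]] homogeneous_1
      by (auto simp: zero_prod_def) }
  { case tau_rho
    show ?case by (intro exI[of _ "(1, 2)"] homogeneous_diff m) simp_all }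
  { case (Sq_rho n)
    show ?case by (intro exI[of _ "(int n + 1, int (n div 2) + 1)"] homogeneous_diff m) simp_all }
  { case Sq_one_tau
    show ?case
      by (intro exI[of _ "(1, 1)"] homogeneous_diff homogeneous_add m)
         (use homogeneous_gen[of Rho] in simp_all) }
  { case (Sq_even_tau k)
    show ?case
      by (intro exI[of _ "(2 * int k + 2, int k + 2)"] homogeneous_diff homogeneous_add m m3) simp_all }
  { case (Sq_odd_tau k)
    show ?case unfolding power2_eq_square
      by (intro exI[of _ "(2 * int k + 3, int k + 2)"] homogeneous_diff homogeneous_add m m3) simp_all }
  { case (adem a b)
    then show ?case
      by (intro exI[of _ "(int (a + b), int (a div 2 + b div 2))"] homogeneous_diff m homogeneous_adem_rhs) simp_all }
qed

text \<open>Letters act on the monoid ring of the bidegrees over \<open>AR\<close> by the letter in its own bidegree. Relators are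
  homogeneous, so \<open>AR\<close> acts, and the orbit of 1 splits an element into its homogeneous components.\<close>

definition gr_letter :: "letter \<Rightarrow> (int \<times> int \<Rightarrow>\<^sub>0 AR) \<Rightarrow> (int \<times> int \<Rightarrow>\<^sub>0 AR)" where
  "gr_letter l x = Poly_Mapping.single (letter_deg l) (abs_AR (gen l)) * x"

interpretation gr: letter_action gr_letter
proof
  show "x + x = 0" for x :: "int \<times> int \<Rightarrow>\<^sub>0 AR"
    by (rule poly_mapping_eqI) (simp add: lookup_add AR_add_self)
qed (simp add: gr_letter_def distrib_left)

lemma gr_word_act:
  "gr.word_act w x = Poly_Mapping.single (word_deg w) (abs_AR (Poly_Mapping.single w 1)) * x"
proof -
  have "foldr gr_letter ls x =
      Poly_Mapping.single (word_deg (Word ls)) (abs_AR (Poly_Mapping.single (Word ls) 1)) * x" for ls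
  proof (induction ls)
    case Nil
    show ?case by (simp add: word_deg_def abs_AR_simps zero_word_def[symmetric])
         (simp add: zero_word_def abs_AR_simps)
  next
    case (Cons l ls)
    have "Poly_Mapping.single (Word (l # ls)) (1::bit) = gen l * Poly_Mapping.single (Word ls) 1"
      by (simp add: gen_def mult_single plus_word_def)
    then show ?case
      by (simp only: foldr.simps o_apply Cons.IH)
         (simp add: gr_letter_def mult_single abs_AR_simps(3) word_deg_def flip: mult.assoc)
  qed
  then show ?thesis by (simp add: gr.word_act_def)
qed

lemma gr_free_act_homogeneous:
  assumes "homogeneous d p"
  shows "gr.free_act p x = Poly_Mapping.single d (abs_AR p) * x"
proof -
  have s: "Poly_Mapping.single d (sum f A) = (\<Sum>x\<in>A. Poly_Mapping.single d (f x))" for f :: "word \<Rightarrow> AR" and A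
    by (induction A rule: infinite_finite_induct) (simp_all add: single_add)
  have "gr.free_act p x = (\<Sum>w\<in>Poly_Mapping.keys p.
      Poly_Mapping.single d (abs_AR (Poly_Mapping.single w (Poly_Mapping.lookup p w))) * x)"
    unfolding gr.free_act_def
  proof (rule sum.cong)
    fix w assume w: "w \<in> Poly_Mapping.keys p"
    then have "Poly_Mapping.lookup p w = 1" by (simp add: in_keys_iff)
    then show "bit_scale (Poly_Mapping.lookup p w) (gr.word_act w x) =
      Poly_Mapping.single d (abs_AR (Poly_Mapping.single w (Poly_Mapping.lookup p w))) * x"
      using assms w by (simp add: bit_scale_def gr_word_act homogeneous_def)
  qed simp
  also have "\<dots> = Poly_Mapping.single d (abs_AR p) * x"
    by (simp only: s[symmetric] sum_distrib_right[symmetric] abs_AR_sum[symmetric] free_alg_decomp[symmetric])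
  finally show ?thesis .
qed

interpretation gr: AR_action gr_letter
proof
  fix r x assume "r \<in> relators"
  then show "gr.free_act r x = 0"
    using homogeneous_relator[of r] gr_free_act_homogeneous[of _ r x] by (auto simp: abs_AR_relator)
qed

definition component :: "int \<times> int \<Rightarrow> AR \<Rightarrow> AR" where
  "component d a = Poly_Mapping.lookup (gr.act a 1) d"

lemma component_add: "component d (a + b) = component d a + component d b"
  by (simp add: component_def gr.act_add_left lookup_add)

lemma component_0: "component d 0 = 0"
  using component_add[of d 0 0] by simp

lemma component_sum: "component d (sum f A) = (\<Sum>x\<in>A. component d (f x))"
  by (induction A rule: infinite_finite_induct) (simp_all add: component_0 component_add)

lemma AR_degE:
  assumes "a \<in> AR_deg d" obtains p where "a = abs_AR p" "homogeneous d p"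
  using assms by (auto simp: AR_deg_def homogeneous_def)

lemma AR_degI: "homogeneous d p \<Longrightarrow> abs_AR p \<in> AR_deg d"
  by (auto simp: AR_deg_def homogeneous_def)

text \<open>\<open>AR_deg\<close> is defined by homogeneous representatives, so it is not evident
  that different bidegrees meet only in 0. This is where that is obtained.\<close>

lemma component_AR_deg: "a \<in> AR_deg d \<Longrightarrow> component e a = (if e = d then a else 0)"
  by (erule AR_degE) (simp add: component_def gr.act_abs_AR gr_free_act_homogeneous lookup_single)

lemma AR_deg_0: "0 \<in> AR_deg d"
  using AR_degI[OF homogeneous_0] by (simp add: abs_AR_simps)

lemma AR_deg_diff: "a \<in> AR_deg d \<Longrightarrow> b \<in> AR_deg d \<Longrightarrow> a - b \<in> AR_deg d"
  by (elim AR_degE) (simp add: AR_degI homogeneous_diff flip: abs_AR_simps)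

lemma AR_deg_mult: "a \<in> AR_deg d \<Longrightarrow> b \<in> AR_deg e \<Longrightarrow> a * b \<in> AR_deg (d + e)"
  by (elim AR_degE) (simp add: AR_degI homogeneous_mult flip: abs_AR_simps)

lemma AR_deg_gens: "1 \<in> AR_deg 0" "tau \<in> AR_deg (0, 1)" "rho \<in> AR_deg (1, 1)"
  "Sq n \<in> AR_deg (int n, int (n div 2))"
  using AR_degI[OF homogeneous_1] AR_degI[OF homogeneous_gen, of Tau]
    AR_degI[OF homogeneous_gen, of Rho] AR_degI[OF homogeneous_gen, of "Square n"]
  by (simp_all add: abs_AR_simps)

section \<open>Free modules with operations\<close>

lemma bit_add_self: "(b :: bit) + b = 0"
  by (cases b) simp_all

lemma poly_add_self: "(\<And>a :: 'a::comm_ring_1. a + a = 0) \<Longrightarrow> (p :: 'a poly) + p = 0"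
  by (rule poly_eqI) (simp only: coeff_add coeff_0)

interpretation model: char2_ring "TYPE(bit poly poly poly)"
proof
  show "(1 :: bit poly poly poly) + 1 = 0"
    by (intro poly_add_self bit_add_self)
qed

text \<open>The free \<open>F\<^sub>2[\<tau>, \<rho>]\<close>-module on generators \<open>mz 0, mz 1, \<dots>\<close>, realised as the polynomial ring
  \<open>F\<^sub>2[\<rho>][\<tau>][z]\<close> with \<open>mz k = z\<^sup>k\<close>.\<close>

definition mt :: "bit poly poly poly" where "mt = [:[:0, 1:]:]"
definition mr :: "bit poly poly poly" where "mr = [:[:[:0, 1:]:]:]"
definition mz :: "nat \<Rightarrow> bit poly poly poly" where "mz k = monom 1 k"

lemma model_induct [case_names zero add gen tau rho]:
  assumes 0: "P 0" and add: "\<And>v w. P v \<Longrightarrow> P w \<Longrightarrow> P (v + w)"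
    and z: "\<And>k. P (mz k)" and t: "\<And>v. P v \<Longrightarrow> P (mt * v)" and r: "\<And>v. P v \<Longrightarrow> P (mr * v)"
  shows "P v"
proof -
  have c: "P (monom [:c:] k)" for c k
  proof (induction c)
    case (pCons b c)
    have "monom [:pCons b c:] k = monom [:[:b:]:] k + mr * monom [:c:] k"
      by (rule poly_eqI) (simp add: mr_def coeff_monom)
    moreover have "P (monom [:[:b:]:] k)"
      using z[of k] 0 by (cases b) (simp_all add: mz_def one_pCons)
    ultimately show ?case using pCons.IH add r by simp
  qed (simp add: 0)
  have m: "P (monom m k)" for m k
  proof (induction m)
    case (pCons c m)
    have "monom (pCons c m) k = monom [:c:] k + mt * monom m k"
      by (rule poly_eqI) (simp add: mt_def coeff_monom)
    then show ?case using pCons.IH add t c by simp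
  qed (simp add: 0)
  have "P (sum (\<lambda>k. monom (coeff v k) k) A)" for A
    by (induction A rule: infinite_finite_induct) (simp_all add: 0 add m)
  then show ?thesis by (metis poly_as_sum_of_monoms)
qed

text \<open>The motivic Cartan formula for a square on \<tau>\<open>x\<close>, with
  \<open>f i\<close> in the role of the value of the \<open>i\<close>-th square on
  \<open>x\<close>.\<close>

definition tau_twist :: "(int \<Rightarrow> bit poly poly poly) \<Rightarrow> int \<Rightarrow> bit poly poly poly" where
  "tau_twist f n = mt * f n + (if even n then mt * mr * f (n - 1) else mr * f (n - 1) + mr\<^sup>2 * f (n - 2))"

text \<open>\<open>twist m f n\<close> is \<open>Sq\<^sup>n (m x)\<close> when \<open>f i\<close> is \<open>Sq\<^sup>i x\<close>.\<close>

definition twist :: "bit poly poly \<Rightarrow> (int \<Rightarrow> bit poly poly poly) \<Rightarrow> int \<Rightarrow> bit poly poly poly" where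
  "twist m f = fold_coeffs (\<lambda>c g n. [:[:c:]:] * f n + tau_twist g n) m (\<lambda>_. 0)"

lemma tau_twist_0: "tau_twist (\<lambda>_. 0) n = 0"
  by (simp add: tau_twist_def)

lemma tau_twist_add: "tau_twist (\<lambda>n. f n + g n) n = tau_twist f n + tau_twist g n"
  by (simp add: tau_twist_def algebra_simps)

lemma tau_twist_mult: "tau_twist (\<lambda>n. a * f n) n = a * tau_twist f n"
  by (simp add: tau_twist_def algebra_simps)

lemma twist_0: "twist 0 f n = 0"
  by (simp add: twist_def)

lemma twist_pCons: "twist (pCons c m) f n = [:[:c:]:] * f n + tau_twist (twist m f) n"
proof (cases "c = 0 \<and> m = 0")
  case True
  have "twist 0 f = (\<lambda>_. 0)" by (simp add: fun_eq_iff twist_0)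
  then show ?thesis using True by (simp add: twist_0 tau_twist_0)
next
  case False
  then show ?thesis
    by (cases "m = 0") (auto simp: twist_def fold_coeffs_pCons_coeff_not_0_eq fold_coeffs_pCons_not_0_0_eq)
qed

lemma twist_add: "twist (m + m') f n = twist m f n + twist m' f n"
proof (induction m m' arbitrary: n rule: poly_induct2)
  case 0 then show ?case by (simp add: twist_0)
next
  case (pCons a p b q)
  have 1: "twist (p + q) f = (\<lambda>n. twist p f n + twist q f n)" by (rule ext) (rule pCons.IH)
  have 2: "[:[:a + b:]:] = [:[:a:]:] + [:[:b:]:]" by simp
  show ?case
    by (simp only: add_pCons[of a p b q] twist_pCons tau_twist_add distrib_right distrib_left 1 2 ac_simps)
qed

lemma twist_smult: "twist (smult c m) f n = [:[:c:]:] * twist m f n"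
proof (induction m arbitrary: n)
  case 0 then show ?case by (simp add: twist_0)
next
  case (pCons a m)
  have 1: "twist (smult c m) f = (\<lambda>n. [:[:c:]:] * twist m f n)" by (rule ext) (rule pCons.IH)
  have 2: "[:[:c * a:]:] = [:[:c:]:] * [:[:a:]:]" by simp
  show ?case
    by (simp only: smult_pCons twist_pCons tau_twist_mult distrib_left mult.assoc 1 2)
qed

lemma twist_tau: "twist (pCons 0 m) f n = tau_twist (twist m f) n"
  by (simp add: twist_pCons)

lemma twist_1: "twist 1 f n = f n"
proof -
  have 0: "twist 0 f = (\<lambda>_. 0)" by (simp add: fun_eq_iff twist_0)
  have 1: "[:[:1:]:] = (1 :: bit poly poly poly)" by (simp add: one_pCons)
  have "twist (pCons 1 0) f n = f n"
    by (simp only: twist_pCons 0 1 tau_twist_0 mult_1 add_0_right)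
  then show ?thesis by (simp add: one_pCons)
qed

text \<open>\<open>s k n\<close> is the prescribed value of the \<open>n\<close>-th square on
  \<open>mz k\<close>; each coefficient in \<open>\<tau>\<close> and \<open>\<rho>\<close> is then
  moved past the square by \<open>twist\<close>.\<close>

definition square_op :: "(nat \<Rightarrow> int \<Rightarrow> bit poly poly poly) \<Rightarrow> int \<Rightarrow> bit poly poly poly \<Rightarrow> bit poly poly poly" where
  "square_op s n v = (\<Sum>k\<le>degree v. twist (coeff v k) (s k) n)"

lemma square_op_superset:
  assumes "degree v \<le> N" shows "square_op s n v = (\<Sum>k\<le>N. twist (coeff v k) (s k) n)"
  unfolding square_op_def using assms
  by (intro sum.mono_neutral_left) (auto simp: coeff_eq_0 twist_0)

lemma square_op_add: "square_op s n (v + w) = square_op s n v + square_op s n w"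
proof -
  let ?N = "max (degree v) (degree w)"
  have "degree (v + w) \<le> ?N" by (rule degree_add_le_max)
  then show ?thesis
    by (simp add: square_op_superset[of _ ?N] twist_add sum.distrib)
qed

lemma square_op_mz: "square_op s n (mz k) = s k n"
proof -
  have "(\<Sum>i\<le>k. twist (coeff (mz k) i) (s i) n) = (\<Sum>i\<le>k. if i = k then s k n else 0)"
    by (rule sum.cong) (auto simp: mz_def coeff_monom twist_0 twist_1)
  then show ?thesis by (simp add: square_op_def mz_def degree_monom_eq)
qed

lemma square_op_mr: "square_op s n (mr * v) = mr * square_op s n v"
proof -
  have "mr * v = smult [:[:0, 1:]:] v" by (simp add: mr_def)
  then show ?thesis
    by (simp add: square_op_superset[of _ "degree v"] degree_smult_le sum_distrib_left)
      (simp add: mr_def twist_smult)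
qed

lemma square_op_mt: "square_op s n (mt * v) = tau_twist (\<lambda>n. square_op s n v) n"
proof -
  have *: "mt * v = smult [:0, 1:] v" by (simp add: mt_def)
  have "square_op s n (mt * v) = (\<Sum>k\<le>degree v. tau_twist (twist (coeff v k) (s k)) n)"
    by (simp add: * square_op_superset[of _ "degree v"] degree_smult_le twist_tau)
  also have "\<dots> = tau_twist (\<lambda>n. square_op s n v) n"
    by (simp add: tau_twist_def square_op_def sum.distrib sum_distrib_left)
  finally show ?thesis .
qed

lemma square_op_mt_even: "square_op s (2 * m) (mt * v) =
    mt * square_op s (2 * m) v + mt * mr * square_op s (2 * m - 1) v"
  by (simp add: square_op_mt tau_twist_def)

lemma square_op_mt_odd: "square_op s (2 * m + 1) (mt * v) =
    mt * square_op s (2 * m + 1) v + mr * square_op s (2 * m) v + mr\<^sup>2 * square_op s (2 * m - 1) v"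
  by (simp add: square_op_mt tau_twist_def add.assoc)

text \<open>Conditions on generators that give the assumptions of \<open>adem_ops\<close> on the
  whole module. The relations with first index 1 can be carried along \<tau> by direct computation,
  in contrast to the general ones.\<close>

locale square_table =
  fixes s :: "nat \<Rightarrow> int \<Rightarrow> bit poly poly poly"
  assumes s_neg: "n < 0 \<Longrightarrow> s k n = 0"
    and s_0: "s k 0 = mz k"
    and s_1_even: "square_op s 1 (s k (2 * m)) = s k (2 * m + 1)"
    and s_1_1: "square_op s 1 (s k 1) = 0"
begin

abbreviation "S \<equiv> square_op s"

lemma square_op_0_right: "S n 0 = 0"
  using square_op_mr[of s n 0] by (simp add: square_op_def twist_0)

lemma square_op_neg: "n < 0 \<Longrightarrow> S n v = 0"
proof (induction v arbitrary: n rule: model_induct)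
  case (tau v)
  then show ?case by (simp add: square_op_mt tau_twist_def)
qed (simp_all add: square_op_0_right square_op_add square_op_mz s_neg square_op_mr)

lemma square_op_0: "S 0 v = v"
proof (induction v rule: model_induct)
  case (tau v)
  then show ?case using square_op_mt_even[of s 0 v] by (simp add: square_op_neg)
qed (simp_all add: square_op_0_right square_op_add square_op_mz s_0 square_op_mr)

lemma square_op_1_mt: "S 1 (mt * v) = mt * S 1 v + mr * v"
  using square_op_mt_odd[of s 0 v] by (simp add: square_op_0 square_op_neg)

lemma square_op_1_1: "S 1 (S 1 v) = 0"
proof (induction v rule: model_induct)
  case (tau v)
  then show ?case by (simp add: square_op_1_mt square_op_add square_op_mr model.add_self)
qed (simp_all add: square_op_0_right square_op_add square_op_mz s_1_1 square_op_mr)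

lemma square_op_1_even: "S 1 (S (2 * m) v) = S (2 * m + 1) v"
proof (induction v arbitrary: m rule: model_induct)
  case (tau v)
  have odd: "S 1 (S (2 * m - 1) v) = 0"
    using tau[of "m - 1"] square_op_1_1[of "S (2 * (m - 1)) v"] by (simp add: algebra_simps)
  show ?case
    unfolding square_op_mt_even square_op_mt_odd
    by (simp add: square_op_add square_op_1_mt square_op_mr mult.assoc tau odd power2_eq_square)
qed (simp_all add: square_op_0_right square_op_add square_op_mz s_1_even square_op_mr)

sublocale ops: adem_ops "TYPE(bit poly poly poly)" mt mr S
  by standard
    (simp_all add: square_op_add square_op_neg square_op_0 square_op_mr square_op_mt_even
      square_op_mt_odd square_op_1_even square_op_1_1)

lemma adem_at_all: "(\<And>k. ops.adem_at (mz k)) \<Longrightarrow> ops.adem_at v"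
  by (induction v rule: model_induct)
     (simp_all add: ops.adem_at_0 ops.adem_at_add ops.adem_at_t ops.adem_at_r)

end

section \<open>From the split Adem relations to the presentation\<close>

text \<open>The last binary digit in Lucas' theorem for the prime 2. Two Pascal steps at once
  produce the middle term twice, so it drops out modulo 2; both claims are needed together for the
  induction.\<close>

lemma even_choose_double:
  "even ((2 * p) choose (2 * q)) = even (p choose q) \<and> even ((2 * p) choose (2 * q + 1))"
proof (induction p arbitrary: q)
  case 0 show ?case by (cases q) simp_all
next
  case (Suc p)
  show ?case
  proof (cases q)
    case 0
    then show ?thesis by simp
  next
    case (Suc q')
    have 1: "2 * Suc p choose (2 * Suc q') = (2 * p choose (2 * q')) + 2 * (2 * p choose (2 * q' + 1)) + (2 * p choose (2 * Suc q'))"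
      by simp
    have 2: "2 * Suc p choose (2 * Suc q' + 1) = (2 * p choose (2 * q' + 1)) + 2 * (2 * p choose (2 * Suc q')) + (2 * p choose (2 * Suc q' + 1))"
      by simp
    show ?thesis unfolding Suc 1 2 using Suc.IH[of q'] Suc.IH[of "Suc q'"] by simp
  qed
qed

lemma even_choose_odd_double:
  "even ((2 * p + 1) choose (2 * q)) = even (p choose q)"
  "even ((2 * p + 1) choose (2 * q + 1)) = even (p choose q)"
proof -
  show "even ((2 * p + 1) choose (2 * q)) = even (p choose q)"
    using even_choose_double[of p q] even_choose_double[of p "q - 1"] by (cases q) auto
  show "even ((2 * p + 1) choose (2 * q + 1)) = even (p choose q)"
    using even_choose_double[of p q] by auto
qed

text \<open>Translates the sum over natural \<open>c\<close> of the presentation into the sum over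
  integers \<open>d\<close> of the split relations, with \<open>c = 2 * d\<close> and
  \<open>c = 2 * d + 1\<close>. The vanishing hypotheses allow the padded range from -1.\<close>

lemma sum_even_odd_split:
  fixes g :: "nat \<Rightarrow> 'a::comm_monoid_add"
  assumes h: "\<And>d. 2 * d \<le> i \<Longrightarrow> g (2 * d) = h (int d)"
    and h': "\<And>d. 2 * d + 1 \<le> i \<Longrightarrow> g (2 * d + 1) = h' (int d)"
    and 0: "\<And>d. d < 0 \<or> 2 * d > int i \<Longrightarrow> h d = 0" "\<And>d. d < 0 \<or> 2 * d + 1 > int i \<Longrightarrow> h' d = 0"
  shows "(\<Sum>c\<le>i. g c) = (\<Sum>d\<in>{-1..int i}. h d + h' d)"
proof -
  have "{..i} = {c. c \<le> i \<and> even c} \<union> {c. c \<le> i \<and> odd c}" by auto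
  then have "(\<Sum>c\<le>i. g c) = (\<Sum>c | c \<le> i \<and> even c. g c) + (\<Sum>c | c \<le> i \<and> odd c. g c)"
    by (simp add: sum.union_disjoint[symmetric] disjoint_iff)
  also have "(\<Sum>c | c \<le> i \<and> even c. g c) = (\<Sum>d | 0 \<le> d \<and> 2 * d \<le> int i. h d)"
    by (rule sum.reindex_bij_witness[of _ "\<lambda>d. 2 * nat d" "\<lambda>c. int (c div 2)"])
       (auto simp: h zdiv_int elim!: evenE)
  also have "\<dots> = (\<Sum>d\<in>{-1..int i}. h d)"
    by (rule sum.mono_neutral_left) (auto intro: ccontr dest: 0(1)[OF disjI1[OF not_le[THEN iffD1]]] 0(1)[OF disjI2[OF not_le[THEN iffD1]]])
  also have "(\<Sum>c | c \<le> i \<and> odd c. g c) = (\<Sum>d | 0 \<le> d \<and> 2 * d + 1 \<le> int i. h' d)"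
    by (rule sum.reindex_bij_witness[of _ "\<lambda>d. 2 * nat d + 1" "\<lambda>c. int (c div 2)"])
       (auto simp: h'[simplified] zdiv_int elim!: oddE)
  also have "\<dots> = (\<Sum>d\<in>{-1..int i}. h' d)"
    by (rule sum.mono_neutral_left) (auto intro: ccontr dest: 0(2)[OF disjI1[OF not_le[THEN iffD1]]] 0(2)[OF disjI2[OF not_le[THEN iffD1]]])
  finally show ?thesis by (simp add: sum.distrib)
qed

lemma (in char2_ring) of_nat_eq_parity: "of_nat n = (if odd n then 1 else (0 :: 'a))"
  using char2 by (induction n) simp_all

lemma (in char2_ring) binom2_parity:
  assumes "even (m choose k) = even (nat p choose nat q)" "0 \<le> p" "0 \<le> q"
  shows "of_nat (m choose k) = (binom2 p q :: 'a)"
  using assms by (simp add: binom2_def of_nat_eq_parity)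

context square_table
begin

text \<open>Here and in the next three lemmas the parity split is undone. The row
  \<open>2 * j - 1 - c\<close> is odd for even \<open>c\<close> and even for odd \<open>c\<close>,
  so a different half of the Lucas congruence applies to each.\<close>

lemma adem_split_even_even:
  assumes "ops.adem_at v" "i < 2 * j"
  shows "S (2 * int i) (S (2 * int j) v) = (\<Sum>c\<le>i. of_nat ((2 * j - 1 - c) choose (2 * i - 2 * c))
     * mt ^ (c mod 2) * S (int (2 * i + 2 * j - c)) (S (int c) v))"
proof -
  have "ops.ee (int i) (int i) (int j) v" using assms by (auto simp: ops.adem_at_def)
  then show ?thesis unfolding ops.ee_def
  proof (elim trans, intro sum_even_odd_split[symmetric], goal_cases)
    case (1 d)
    have "of_nat ((2 * j - 1 - 2 * d) choose (2 * i - 2 * (2 * d)))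
        = (binom2 (int j - 1 - int d) (int i - 2 * int d) :: bit poly poly poly)"
    proof (rule model.binom2_parity)
      have "2 * j - 1 - 2 * d = 2 * (j - 1 - d) + 1" "2 * i - 2 * (2 * d) = 2 * (i - 2 * d)"
        "nat (int j - 1 - int d) = j - 1 - d" "nat (int i - 2 * int d) = i - 2 * d"
        using 1 assms(2) by auto
      then show "even ((2 * j - 1 - 2 * d) choose (2 * i - 2 * (2 * d)))
          = even (nat (int j - 1 - int d) choose nat (int i - 2 * int d))"
        by (simp only: even_choose_odd_double)
    qed (use 1 assms in auto)
    moreover have "int (2 * i + 2 * j - 2 * d) = 2 * (int i + int j - int d)" using 1 by simp
    ultimately show ?case by simp
  next
    case (2 d)
    have "of_nat ((2 * j - 1 - (2 * d + 1)) choose (2 * i - 2 * (2 * d + 1)))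
        = (binom2 (int j - 1 - int d) (int i - 2 * int d - 1) :: bit poly poly poly)"
    proof (rule model.binom2_parity)
      have "2 * j - 1 - (2 * d + 1) = 2 * (j - 1 - d)" "2 * i - 2 * (2 * d + 1) = 2 * (i - 2 * d - 1)"
        "nat (int j - 1 - int d) = j - 1 - d" "nat (int i - 2 * int d - 1) = i - 2 * d - 1"
        using 2 assms(2) by auto
      then show "even ((2 * j - 1 - (2 * d + 1)) choose (2 * i - 2 * (2 * d + 1)))
          = even (nat (int j - 1 - int d) choose nat (int i - 2 * int d - 1))"
        by (simp only: even_choose_double)
    qed (use 2 assms in auto)
    moreover have "int (2 * i + 2 * j - (2 * d + 1)) = 2 * (int i + int j - int d - 1) + 1" using 2 by simp
    moreover have "int (2 * d + 1) = 2 * int d + 1" by simp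
    moreover have "(2 * d + 1) mod 2 = 1" by simp
    ultimately show ?case by (simp only: power_one_right) (simp add: mult_ac)
  next
    case (3 d)
    then show ?case by (auto simp: square_op_neg square_op_0_right binom2_neg)
  next
    case (4 d)
    then show ?case by (auto simp: square_op_neg square_op_0_right binom2_neg)
  qed
qed

lemma adem_split_even_odd:
  assumes "ops.adem_at v" "i \<le> 2 * j"
  shows "S (2 * int i) (S (2 * int j + 1) v) = (\<Sum>c\<le>i. of_nat ((2 * j - c) choose (2 * i - 2 * c))
     * (S (int (2 * i + 2 * j + 1 - c)) (S (int c) v)
        + (if odd c then mr * S (int (2 * i + 2 * j - c)) (S (int c) v) else 0)))"
proof -
  have "ops.eo (int i) (int i) (int j) v" using assms by (auto simp: ops.adem_at_def)
  then show ?thesis unfolding ops.eo_def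
  proof (elim trans, intro sum_even_odd_split[symmetric], goal_cases)
    case (1 d)
    have "of_nat ((2 * j - 2 * d) choose (2 * i - 2 * (2 * d)))
        = (binom2 (int j - int d) (int i - 2 * int d) :: bit poly poly poly)"
    proof (rule model.binom2_parity)
      have "2 * j - 2 * d = 2 * (j - d)" "2 * i - 2 * (2 * d) = 2 * (i - 2 * d)"
        "nat (int j - int d) = j - d" "nat (int i - 2 * int d) = i - 2 * d"
        using 1 assms(2) by auto
      then show "even ((2 * j - 2 * d) choose (2 * i - 2 * (2 * d)))
          = even (nat (int j - int d) choose nat (int i - 2 * int d))"
        by (simp only: even_choose_double)
    qed (use 1 assms in auto)
    moreover have "int (2 * i + 2 * j + 1 - 2 * d) = 2 * (int i + int j - int d) + 1" using 1 by simp
    ultimately show ?case by simp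
  next
    case (2 d)
    have "of_nat ((2 * j - (2 * d + 1)) choose (2 * i - 2 * (2 * d + 1)))
        = (binom2 (int j - 1 - int d) (int i - 2 * int d - 1) :: bit poly poly poly)"
    proof (rule model.binom2_parity)
      have "2 * j - (2 * d + 1) = 2 * (j - 1 - d) + 1" "2 * i - 2 * (2 * d + 1) = 2 * (i - 2 * d - 1)"
        "nat (int j - 1 - int d) = j - 1 - d" "nat (int i - 2 * int d - 1) = i - 2 * d - 1"
        using 2 assms(2) by auto
      then show "even ((2 * j - (2 * d + 1)) choose (2 * i - 2 * (2 * d + 1)))
          = even (nat (int j - 1 - int d) choose nat (int i - 2 * int d - 1))"
        by (simp only: even_choose_odd_double)
    qed (use 2 assms in auto)
    moreover have "int (2 * i + 2 * j + 1 - (2 * d + 1)) = 2 * (int i + int j - int d)"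
      "int (2 * i + 2 * j - (2 * d + 1)) = 2 * (int i + int j - int d - 1) + 1" using 2 by simp_all
    moreover have "int (2 * d + 1) = 2 * int d + 1" by simp
    ultimately show ?case by (simp add: add.commute[of 1])
  next
    case (3 d)
    then show ?case by (auto simp: square_op_neg square_op_0_right binom2_neg)
  next
    case (4 d)
    then show ?case by (auto simp: square_op_neg square_op_0_right binom2_neg)
  qed
qed

lemma adem_split_odd_even:
  assumes "ops.adem_at v" "i < 2 * j"
  shows "S (2 * int i + 1) (S (2 * int j) v) = (\<Sum>c\<le>i. if even c
     then of_nat ((2 * j - 1 - c) choose (2 * i + 1 - 2 * c)) * S (int (2 * i + 1 + 2 * j - c)) (S (int c) v)
     else of_nat ((2 * j - 1 - c) choose (2 * i - 2 * c)) * (mr * S (int (2 * i + 2 * j - c)) (S (int c) v)))"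
proof -
  have "ops.oe (int i) (int i) (int j) v" using assms by (intro ops.oe_if_ee) (auto simp: ops.adem_at_def)
  then show ?thesis unfolding ops.oe_def
  proof (elim trans, intro sum_even_odd_split[symmetric], goal_cases)
    case (1 d)
    have "of_nat ((2 * j - 1 - 2 * d) choose (2 * i + 1 - 2 * (2 * d)))
        = (binom2 (int j - 1 - int d) (int i - 2 * int d) :: bit poly poly poly)"
    proof (rule model.binom2_parity)
      have "2 * j - 1 - 2 * d = 2 * (j - 1 - d) + 1" "2 * i + 1 - 2 * (2 * d) = 2 * (i - 2 * d) + 1"
        "nat (int j - 1 - int d) = j - 1 - d" "nat (int i - 2 * int d) = i - 2 * d"
        using 1 assms(2) by auto
      then show "even ((2 * j - 1 - 2 * d) choose (2 * i + 1 - 2 * (2 * d)))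
          = even (nat (int j - 1 - int d) choose nat (int i - 2 * int d))"
        by (simp only: even_choose_odd_double)
    qed (use 1 assms in auto)
    moreover have "int (2 * i + 1 + 2 * j - 2 * d) = 2 * (int i + int j - int d) + 1" using 1 by simp
    ultimately show ?case by simp
  next
    case (2 d)
    have "of_nat ((2 * j - 1 - (2 * d + 1)) choose (2 * i - 2 * (2 * d + 1)))
        = (binom2 (int j - 1 - int d) (int i - 2 * int d - 1) :: bit poly poly poly)"
    proof (rule model.binom2_parity)
      have "2 * j - 1 - (2 * d + 1) = 2 * (j - 1 - d)" "2 * i - 2 * (2 * d + 1) = 2 * (i - 2 * d - 1)"
        "nat (int j - 1 - int d) = j - 1 - d" "nat (int i - 2 * int d - 1) = i - 2 * d - 1"
        using 2 assms(2) by auto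
      then show "even ((2 * j - 1 - (2 * d + 1)) choose (2 * i - 2 * (2 * d + 1)))
          = even (nat (int j - 1 - int d) choose nat (int i - 2 * int d - 1))"
        by (simp only: even_choose_double)
    qed (use 2 assms in auto)
    moreover have "int (2 * i + 2 * j - (2 * d + 1)) = 2 * (int i + int j - int d - 1) + 1" using 2 by simp
    moreover have "int (2 * d + 1) = 2 * int d + 1" by simp
    ultimately show ?case by (simp add: mult_ac add.commute[of 1])
  next
    case (3 d)
    then show ?case by (auto simp: square_op_neg square_op_0_right binom2_neg)
  next
    case (4 d)
    then show ?case by (auto simp: square_op_neg square_op_0_right binom2_neg)
  qed
qed

lemma adem_split_odd_odd:
  assumes "ops.adem_at v" "i \<le> 2 * j"
  shows "S (2 * int i + 1) (S (2 * int j + 1) v) = (\<Sum>c\<le>i. if odd c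
     then of_nat ((2 * j - c) choose (2 * i + 1 - 2 * c)) * S (int (2 * i + 2 * j + 2 - c)) (S (int c) v)
     else 0)"
proof -
  have "ops.oo (int i) (int i) (int j) v" using assms by (intro ops.oo_if_eo) (auto simp: ops.adem_at_def)
  then show ?thesis unfolding ops.oo_def
    apply (elim trans)
    apply (subst sum_even_odd_split[where h = "\<lambda>_. 0" and h' = "\<lambda>d. binom2 (int j - 1 - d) (int i - 2 * d - 1)
          * S (2 * (int i + int j - d) + 1) (S (2 * d + 1) v)"])
  proof (goal_cases)
    case (2 d)
    have "of_nat ((2 * j - (2 * d + 1)) choose (2 * i + 1 - 2 * (2 * d + 1)))
        = (binom2 (int j - 1 - int d) (int i - 2 * int d - 1) :: bit poly poly poly)"
    proof (rule model.binom2_parity)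
      have "2 * j - (2 * d + 1) = 2 * (j - 1 - d) + 1" "2 * i + 1 - 2 * (2 * d + 1) = 2 * (i - 2 * d - 1) + 1"
        "nat (int j - 1 - int d) = j - 1 - d" "nat (int i - 2 * int d - 1) = i - 2 * d - 1"
        using 2 assms(2) by auto
      then show "even ((2 * j - (2 * d + 1)) choose (2 * i + 1 - 2 * (2 * d + 1)))
          = even (nat (int j - 1 - int d) choose nat (int i - 2 * int d - 1))"
        by (simp only: even_choose_odd_double)
    qed (use 2 assms in auto)
    moreover have "int (2 * i + 2 * j + 2 - (2 * d + 1)) = 2 * (int i + int j - int d) + 1" using 2 by simp
    moreover have "int (2 * d + 1) = 2 * int d + 1" by simp
    ultimately show ?case by (simp add: add.commute[of 1])
  qed (auto simp: square_op_neg square_op_0_right binom2_neg)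
qed

end

primrec model_letter :: "(int \<Rightarrow> bit poly poly poly \<Rightarrow> bit poly poly poly) \<Rightarrow> letter
    \<Rightarrow> bit poly poly poly \<Rightarrow> bit poly poly poly" where
  "model_letter S Tau = (*) mt"
| "model_letter S Rho = (*) mr"
| "model_letter S (Square n) = S (int n)"

locale steenrod_table = square_table +
  assumes adem_at_mz: "ops.adem_at (mz k)"
begin

lemma adem_at: "ops.adem_at v"
  by (rule adem_at_all) (rule adem_at_mz)

interpretation L: letter_action "model_letter S"
proof
  show "model_letter S l (x + y) = model_letter S l x + model_letter S l y" for l x y
    by (cases l) (simp_all add: distrib_left square_op_add)
qed (rule model.add_self)

lemma L_of_nat: "L.free_act (of_nat n) v = of_nat n * v"
  by (simp add: L.free_act_of_nat model.of_nat_eq_parity)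

lemma L_power: "L.free_act (fT ^ n) v = mt ^ n * v"
  by (induction n) (simp_all add: L.free_act_simps mult.assoc)

lemma L_adem:
  assumes "0 < a" "a < 2 * b"
  shows "L.free_act (adem_rhs a b) v = S (int a) (S (int b) v)"
proof -
  note simps = L.free_act_add_left L.free_act_mult L.free_act_gen L.free_act_sum_left L_of_nat L_power
    model_letter.simps
  define i j where "i = a div 2" and "j = b div 2"
  have filter: "(\<Sum>c\<in>{c. c \<le> i \<and> P c}. f c) = (\<Sum>c\<le>i. if P c then f c else 0)"
    for P and f :: "nat \<Rightarrow> bit poly poly poly"
  proof -
    have "{c. c \<le> i \<and> P c} = {c \<in> {..i}. P c}" by auto
    then show ?thesis by (simp only: sum.inter_filter finite_atMost)
  qed
  consider "a = 2 * i" "b = 2 * j" | "a = 2 * i" "b = 2 * j + 1" | "a = 2 * i + 1" "b = 2 * j"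
    | "a = 2 * i + 1" "b = 2 * j + 1"
    unfolding i_def j_def by (metis odd_two_times_div_two_succ dvd_mult_div_cancel)
  then show ?thesis
  proof cases
    case 1
    then have "S (int a) (S (int b) v) = S (2 * int i) (S (2 * int j) v)" by simp
    also note adem_split_even_even[OF adem_at, of i j]
    finally show ?thesis using assms 1
      by (simp add: adem_rhs_def simps mult.assoc)
  next
    case 2
    then have "S (int a) (S (int b) v) = S (2 * int i) (S (2 * int j + 1) v)" by (simp add: add.commute)
    also note adem_split_even_odd[OF adem_at, of i j]
    finally show ?thesis using assms 2
      by (simp add: adem_rhs_def simps filter flip: sum.distrib)
         (auto intro!: sum.cong simp: algebra_simps)
  next
    case 3
    then have "S (int a) (S (int b) v) = S (2 * int i + 1) (S (2 * int j) v)" by (simp add: add.commute)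
    also note adem_split_odd_even[OF adem_at, of i j]
    finally show ?thesis using assms 3
      by (simp add: adem_rhs_def simps filter flip: sum.distrib)
         (auto intro!: sum.cong simp: algebra_simps)
  next
    case 4
    then have "S (int a) (S (int b) v) = S (2 * int i + 1) (S (2 * int j + 1) v)" by (simp add: add.commute)
    also note adem_split_odd_odd[OF adem_at, of i j]
    finally show ?thesis using assms 4
      by (simp add: adem_rhs_def simps filter flip: sum.distrib)
         (auto intro!: sum.cong simp: algebra_simps)
  qed
qed

lemma AR_action: "AR_action (model_letter S)"
proof
  fix r v assume "r \<in> relators"
  then show "L.free_act r v = 0"
  proof cases
    case (Sq_even_tau k)
    have "int (2 * k + 2) = 2 * (int k + 1)" "int (2 * k + 1) = 2 * (int k + 1) - 1" by simp_all
    then show ?thesis unfolding Sq_even_tau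
      by (simp only: L.free_act_simps model_letter.simps square_op_mt_even) (simp add: mult_ac)
  next
    case (Sq_odd_tau k)
    have "int (2 * k + 3) = 2 * (int k + 1) + 1" "int (2 * k + 2) = 2 * (int k + 1)"
      "int (2 * k + 1) = 2 * (int k + 1) - 1" by simp_all
    then show ?thesis unfolding Sq_odd_tau
      by (simp only: L.free_act_simps model_letter.simps square_op_mt_odd power2_eq_square) (simp add: mult_ac)
  next
    case (adem a b)
    then show ?thesis by (simp add: L.free_act_simps L_adem)
  qed (simp_all add: L.free_act_simps square_op_0 square_op_mr square_op_1_mt mult_ac)
qed

sublocale AR_action "model_letter S" by (rule AR_action)

end

section \<open>A graded criterion for the Adem relations\<close>

text \<open>The default \<open>(0, 0)\<close> for the generators from \<open>mz 8\<close> on is a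
  placeholder that respects the bound 4; those generators will be sent to 0 in
  \<open>A1\<close>.\<close>

definition mz_deg :: "nat \<Rightarrow> int \<times> int" where
  "mz_deg k = (if k < 8 then [(0, 0), (1, 0), (2, 1), (3, 1), (3, 1), (4, 1), (5, 2), (6, 2)] ! k else (0, 0))"

lemma mz_deg_simps: "mz_deg 0 = (0, 0)" "mz_deg (Suc 0) = (1, 0)" "mz_deg 1 = (1, 0)" "mz_deg 2 = (2, 1)"
  "mz_deg 3 = (3, 1)" "mz_deg 4 = (3, 1)" "mz_deg 5 = (4, 1)" "mz_deg 6 = (5, 2)" "mz_deg 7 = (6, 2)"
  by (simp_all add: mz_deg_def)

lemma less_8_cases:
  assumes "(k::nat) < 8"
  obtains "k = 0" | "k = 1" | "k = 2" | "k = 3" | "k = 4" | "k = 5" | "k = 6" | "k = 7"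
proof -
  have "k = 0 \<or> k = 1 \<or> k = 2 \<or> k = 3 \<or> k = 4 \<or> k = 5 \<or> k = 6 \<or> k = 7" using assms by linarith
  then show ?thesis using that by blast
qed

lemma mz_deg_bounds: "0 \<le> fst (mz_deg k) - snd (mz_deg k)" "fst (mz_deg k) - snd (mz_deg k) \<le> 4"
proof -
  have "0 \<le> fst (mz_deg k) - snd (mz_deg k) \<and> fst (mz_deg k) - snd (mz_deg k) \<le> 4"
  proof (cases "k < 8")
    case True then show ?thesis by (elim less_8_cases) (simp_all add: mz_deg_simps)
  qed (simp add: mz_deg_def)
  then show "0 \<le> fst (mz_deg k) - snd (mz_deg k)" "fst (mz_deg k) - snd (mz_deg k) \<le> 4" by auto
qed

inductive model_hom :: "int \<times> int \<Rightarrow> bit poly poly poly \<Rightarrow> bool" where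
  zero: "model_hom d 0"
| add: "model_hom d v \<Longrightarrow> model_hom d w \<Longrightarrow> model_hom d (v + w)"
| gen: "model_hom (mz_deg k) (mz k)"
| tau: "model_hom d v \<Longrightarrow> model_hom (d + (0, 1)) (mt * v)"
| rho: "model_hom d v \<Longrightarrow> model_hom (d + (1, 1)) (mr * v)"

text \<open>The degree minus the weight is at most 4 on the generators; \<open>\<rho>\<close> preserves it, and \<open>\<tau>\<close> decreases it.\<close>

lemma model_hom_eq_0: "model_hom d v \<Longrightarrow> fst d - snd d > 4 \<Longrightarrow> v = 0"
proof (induction rule: model_hom.induct)
  case (gen k) then show ?case using mz_deg_bounds[of k] by simp
qed simp_all

lemma model_hom_tau: "model_hom e v \<Longrightarrow> d = e + (0, 1) \<Longrightarrow> model_hom d (mt * v)"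
  by (simp only: model_hom.tau)

lemma model_hom_rho: "model_hom e v \<Longrightarrow> d = e + (1, 1) \<Longrightarrow> model_hom d (mr * v)"
  by (simp only: model_hom.rho)

lemma model_hom_rho2: "model_hom e v \<Longrightarrow> d = e + (2, 2) \<Longrightarrow> model_hom d (mr\<^sup>2 * v)"
  unfolding power2_eq_square mult.assoc by (rule model_hom_rho[OF model_hom_rho[OF _ refl]]) (simp_all add: prod_eq_iff)

lemma model_hom_gen: "d = mz_deg k \<Longrightarrow> model_hom d (mz k)"
  by (simp only: model_hom.gen)

locale graded_table = square_table +
  assumes s_hom: "model_hom (mz_deg k + (n, n div 2)) (s k n)"
begin

lemma model_hom_square_op: "model_hom d v \<Longrightarrow> model_hom (d + (n, n div 2)) (S n v)"
proof (induction arbitrary: n rule: model_hom.induct)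
  case (zero d) show ?case by (simp add: square_op_0_right model_hom.zero)
next
  case (add d v w) then show ?case by (simp add: square_op_add model_hom.add)
next
  case (gen k) then show ?case by (simp add: square_op_mz s_hom)
next
  case (tau d v)
  have arith: "(2 * m - 1) div 2 = m - 1" "(2 * m + 1) div 2 = m" for m :: int by presburger+
  show ?case
  proof (cases "even n")
    case True
    then obtain m where m: "n = 2 * m" by (elim evenE)
    show ?thesis unfolding m square_op_mt_even mult.assoc
      by (intro model_hom.add model_hom_tau[OF tau.IH[of "2 * m"]]
          model_hom_tau[OF model_hom_rho[OF tau.IH[of "2 * m - 1"] refl]]) (simp_all add: prod_eq_iff arith)
  next
    case False
    then obtain m where m: "n = 2 * m + 1" by (elim oddE)
    show ?thesis unfolding m square_op_mt_odd
      by (intro model_hom.add model_hom_tau[OF tau.IH[of "2 * m + 1"]]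
          model_hom_rho[OF tau.IH[of "2 * m"]] model_hom_rho2[OF tau.IH[of "2 * m - 1"]])
        (simp_all add: prod_eq_iff arith)
  qed
next
  case (rho d v)
  show ?case unfolding square_op_mr by (rule model_hom_rho[OF rho.IH[of n]]) (simp add: prod_eq_iff)
qed

text \<open>A generator has degree minus weight at least 0, and the \<open>n\<close>-th square
  raises it by \<open>n - n div 2 = (n + 1) div 2\<close>; the composite thus passes the bound
  4.\<close>

lemma square_op_square_op_mz_eq_0:
  assumes "(m + 1) div 2 + (n + 1) div 2 > 4"
  shows "S m (S n (mz k)) = 0"
  by (rule model_hom_eq_0[OF model_hom_square_op[OF model_hom_square_op[OF model_hom.gen]]])
     (use assms mz_deg_bounds(1)[of k] in simp, presburger)

lemma sum_0_1:
  fixes f :: "int \<Rightarrow> bit poly poly poly"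
  assumes "1 \<le> K" "\<And>d. d < 0 \<or> 1 < d \<Longrightarrow> f d = 0"
  shows "sum f {-1..K} = f 0 + f 1"
proof -
  have "sum f {-1..K} = sum f {0, 1}"
    by (rule sum.mono_neutral_right) (use assms in \<open>auto simp: not_le[symmetric]\<close>)
  then show ?thesis by simp
qed

text \<open>For \<open>i < 0\<close> every term vanishes, and for \<open>i = 0\<close> only
  \<open>d = 0\<close> remains, with coefficient \<open>binom2 _ 0 = 1\<close> and an identity
  square inside. The same holds for \<open>eo\<close> below.\<close>

lemma ee_nonpos: assumes "i \<le> 0" "0 \<le> K" shows "ops.ee K i j v"
proof -
  have *: "binom2 (j - 1 - d) (i - 2 * d) * S (2 * (i + j - d)) (S (2 * d) v)
     + mt * (binom2 (j - 1 - d) (i - 2 * d - 1) * S (2 * (i + j - d - 1) + 1) (S (2 * d + 1) v)) = 0"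
    if "d \<noteq> 0 \<or> i < 0" for d
    using that assms by (cases "d < 0") (auto simp: binom2_neg square_op_neg square_op_0_right)
  show ?thesis
  proof (cases "i < 0")
    case True
    then show ?thesis unfolding ops.ee_def using * by (simp add: square_op_neg)
  next
    case False
    then have "i = 0" using assms by simp
    then show ?thesis unfolding ops.ee_def
      by (subst ops.sum_single_int[of 0]) (use * assms in \<open>auto simp: binom2_0 binom2_neg square_op_0\<close>)
  qed
qed

lemma eo_nonpos: assumes "i \<le> 0" "0 \<le> K" shows "ops.eo K i j v"
proof -
  have *: "binom2 (j - d) (i - 2 * d) * S (2 * (i + j - d) + 1) (S (2 * d) v)
     + binom2 (j - 1 - d) (i - 2 * d - 1) * (S (2 * (i + j - d)) (S (2 * d + 1) v)
       + mr * S (2 * (i + j - d - 1) + 1) (S (2 * d + 1) v)) = 0"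
    if "d \<noteq> 0 \<or> i < 0" for d
    using that assms by (cases "d < 0") (auto simp: binom2_neg square_op_neg square_op_0_right)
  show ?thesis
  proof (cases "i < 0")
    case True
    then show ?thesis unfolding ops.eo_def using * by (simp add: square_op_neg)
  next
    case False
    then have "i = 0" using assms by simp
    then show ?thesis unfolding ops.eo_def
      by (subst ops.sum_single_int[of 0]) (use * assms in \<open>auto simp: binom2_0 binom2_neg square_op_0\<close>)
  qed
qed

text \<open>All other relations on a generator have degree minus weight greater than 4.\<close>

lemma adem_at_mzI:
  assumes ee11: "S 2 (S 2 (mz k)) = mt * S 3 (S 1 (mz k))"
    and ee12: "S 2 (S 4 (mz k)) = S 6 (mz k) + mt * S 5 (S 1 (mz k))"
    and ee13: "S 2 (S 6 (mz k)) = mt * S 7 (S 1 (mz k))"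
    and ee22: "S 4 (S 4 (mz k)) = mt * S 7 (S 1 (mz k)) + S 6 (S 2 (mz k))"
    and eo11: "S 2 (S 3 (mz k)) = S 5 (mz k) + S 4 (S 1 (mz k)) + mr * S 3 (S 1 (mz k))"
    and eo21: "S 4 (S 3 (mz k)) = S 5 (S 2 (mz k))"
    and eo12: "S 2 (S 5 (mz k)) = S 6 (S 1 (mz k)) + mr * S 5 (S 1 (mz k))"
  shows "ops.adem_at (mz k)"
  unfolding ops.adem_at_def
proof (intro allI impI conjI)
  fix K i j :: int
  assume K: "0 \<le> K \<and> i \<le> K"
  have ij: "i \<in> {1, 2, 3}" "j \<in> {1, 2, 3}" if "\<not> i \<le> 0" "0 < j" "i + j \<le> 4"
    using that by auto
  note eval = square_op_0 binom2_neg binom2_0 binom2_gt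
  have b: "binom2 1 1 = (1 :: bit poly poly poly)" "binom2 2 1 = (0 :: bit poly poly poly)"
    by (simp_all add: binom2_def model.char2[simplified])
  {
    assume less: "i < 2 * j"
    show "ops.ee K i j (mz k)"
    proof -
      consider "i \<le> 0" | "i + j > 4" | "\<not> i \<le> 0" "i + j \<le> 4" by linarith
      then show ?thesis
      proof cases
        case 1 then show ?thesis using K by (simp add: ee_nonpos)
      next
        case 2
        then have "(2 * i + 1) div 2 + (2 * j + 1) div 2 > 4"
          "(2 * (i + j - d) + 1) div 2 + (2 * d + 1) div 2 > 4"
          "(2 * (i + j - d - 1) + 1 + 1) div 2 + (2 * d + 1 + 1) div 2 > 4" for d
          by presburger+
        then show ?thesis
          by (simp add: ops.ee_def square_op_square_op_mz_eq_0 del: mult_minus_right)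
      next
        case 3
        have "(i = 1 \<and> j = 1) \<or> (i = 1 \<and> j = 2) \<or> (i = 1 \<and> j = 3) \<or> (i = 2 \<and> j = 2)"
          using ij 3 less by auto
        moreover have "1 \<le> K" using 3 K by simp
        ultimately show ?thesis unfolding ops.ee_def
          by (subst sum_0_1)
            (use ee11 ee12 ee13 ee22 in \<open>auto simp: eval b square_op_neg square_op_0_right\<close>)
      qed
    qed
  }
  {
    assume less: "i \<le> 2 * j"
    show "ops.eo K i j (mz k)"
    proof -
      \<comment> \<open>The square of index \<open>2 * m + 1\<close> raises degree minus weight by
        \<open>m + 1\<close>, so with an odd second index the bound is already passed at
        \<open>i + j = 4\<close>.\<close>
      consider "i \<le> 0" | "i + j > 3" | "\<not> i \<le> 0" "i + j \<le> 3" by linarith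
      then show ?thesis
      proof cases
        case 1 then show ?thesis using K by (simp add: eo_nonpos)
      next
        case 2
        then have "(2 * i + 1) div 2 + (2 * j + 1 + 1) div 2 > 4"
          "(2 * (i + j - d) + 1 + 1) div 2 + (2 * d + 1) div 2 > 4"
          "(2 * (i + j - d) + 1) div 2 + (2 * d + 1 + 1) div 2 > 4"
          "(2 * (i + j - d - 1) + 1 + 1) div 2 + (2 * d + 1 + 1) div 2 > 4" for d
          by presburger+
        then show ?thesis
          by (simp add: ops.eo_def square_op_square_op_mz_eq_0)
      next
        case 3
        have "(i = 1 \<and> j = 1) \<or> (i = 2 \<and> j = 1) \<or> (i = 1 \<and> j = 2)"
          using ij 3 less by auto
        moreover have "1 \<le> K" using 3 K by simp
        ultimately show ?thesis unfolding ops.eo_def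
          by (subst sum_0_1)
            (use eo11 eo21 eo12 in \<open>auto simp: eval b square_op_neg square_op_0_right\<close>)
      qed
    qed
  }
qed

end

section \<open>The seven-parameter family\<close>

definition mbit :: "bit \<Rightarrow> bit poly poly poly" where "mbit b = [:[:[:b:]:]:]"

lemma mbit_0: "mbit 0 = 0" and mbit_1: "mbit 1 = 1"
  by (simp_all add: mbit_def one_pCons)

lemma mbit_idem: "mbit b * mbit b = mbit b" "mbit b * (mbit b * x) = mbit b * x"
  by (cases b; simp add: mbit_0 mbit_1)+

lemma square_op_mbit: "square_op s n (mbit b * x) = mbit b * square_op s n x"
  by (cases b) (simp_all add: mbit_0 mbit_1, simp add: square_op_def twist_0)

lemma square_op_zero: "square_op s n 0 = 0"
  by (simp add: square_op_def twist_0)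

lemma model_hom_mbit: "model_hom d x \<Longrightarrow> model_hom d (mbit b * x)"
  by (cases b) (simp_all add: mbit_0 mbit_1 model_hom.zero)

text \<open>\<open>mz 0, \<dots>, mz 7\<close> stand for \<open>x00, x10, x21, x31, y31, y41, y52, y62\<close>, and row \<open>k\<close> lists \<open>Sq\<^sup>0, Sq\<^sup>1, \<dots>\<close>
  on \<open>mz k\<close>. The entries not among the prescribed ones are forced by
  \<open>Sq\<^sup>6 = Sq\<^sup>2 Sq\<^sup>4 + \<tau> Sq\<^sup>5 Sq\<^sup>1\<close> and \<open>Sq\<^bsup>2m+1\<^esup> = Sq\<^sup>1 Sq\<^bsup>2m\<^esup>\<close>. The generators from \<open>mz 8\<close> on carry the trivial action.\<close>

definition sq_row :: "param \<Rightarrow> nat \<Rightarrow> bit poly poly poly list" where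
  "sq_row v k = (case v of (\<alpha>03, \<beta>03, \<beta>14, \<beta>06, \<beta>25, \<beta>26, \<gamma>36) \<Rightarrow>
    if k = 0 then
      [mz 0, mz 1, mz 2, mz 3,
       mbit \<beta>03 * (mr * mz 4) + (1 + mbit \<beta>03 + mbit \<beta>14) * (mt * mz 5) + mbit \<alpha>03 * (mr * mz 3),
       (1 + mbit \<beta>14) * (mr * mz 5),
       (mbit \<beta>03 + mbit \<beta>14) * (mt * mz 7) + mbit \<alpha>03 * (mr * mz 6),
       (mbit \<beta>03 + mbit \<beta>14 + mbit \<alpha>03) * (mr * mz 7),
       mbit \<beta>06 * (mr\<^sup>2 * mz 7)]
    else if k = 1 then [mz 1, 0, mz 4, mz 5, mz 6 + mbit \<beta>14 * (mr * mz 5), mz 7, mbit \<beta>14 * (mr * mz 7)]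
    else if k = 2 then
      [mz 2, mz 3, mt * mz 5, mr * mz 5,
       mbit \<beta>26 * (mt * mz 7) + mbit \<beta>25 * (mr * mz 6)
         + (mbit \<beta>03 * mbit \<gamma>36 + mbit \<alpha>03 * (mbit \<beta>25 + mbit \<beta>26)) * (mr\<^sup>2 * mz 5),
       (mbit \<beta>25 + mbit \<beta>26) * (mr * mz 7),
       (mbit \<beta>03 * mbit \<gamma>36 + mbit \<alpha>03 * (mbit \<beta>25 + mbit \<beta>26)) * (mr\<^sup>2 * mz 7)]
    else if k = 3 then [mz 3, 0, mz 6, mz 7, (mbit \<beta>25 + mbit \<beta>26) * (mr * mz 7)]
    else if k = 4 then [mz 4, mz 5, 0, 0, mbit \<gamma>36 * (mr * mz 7)]
    else if k = 5 then [mz 5, 0, mz 7]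
    else if k = 6 then [mz 6, mz 7]
    else [mz k])"

definition sq_table :: "param \<Rightarrow> nat \<Rightarrow> int \<Rightarrow> bit poly poly poly" where
  "sq_table v k n = (if 0 \<le> n \<and> nat n < length (sq_row v k) then sq_row v k ! nat n else 0)"

lemmas square_op_simps = square_op_zero square_op_add square_op_mbit square_op_mr square_op_mt
  tau_twist_def square_op_mz power2_eq_square mult.assoc distrib_right distrib_left

lemma sq_row_length: "length (sq_row v k) \<le> 9" "sq_row v k ! 0 = mz k" "0 < length (sq_row v k)"
  by (cases v; simp add: sq_row_def)+

lemma sq_table_0: "sq_table v k 0 = mz k"
  using sq_row_length(2,3)[of v k] by (simp add: sq_table_def)

lemma sq_table_gt_8: "8 < n \<Longrightarrow> sq_table v k n = 0"
  using sq_row_length(1)[of v k] by (auto simp: sq_table_def)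

lemma sq_table_ge_7: "7 \<le> k \<Longrightarrow> n \<noteq> 0 \<Longrightarrow> sq_table v k n = 0"
  by (cases v) (auto simp: sq_table_def sq_row_def)

lemma model_cancel:
  fixes x y :: "bit poly poly poly"
  shows "x + x = 0" "x + (x + y) = y" "2 * x = 0"
  using model.add_self[of x] model.add_self_left[of x y] by simp_all

lemma square_table_sq_table: "square_table (sq_table v)"
proof
  fix k :: nat and n m :: int
  show "n < 0 \<Longrightarrow> sq_table v k n = 0" by (simp add: sq_table_def)
  show "sq_table v k 0 = mz k" by (rule sq_table_0)
  obtain \<alpha>03 \<beta>03 \<beta>14 \<beta>06 \<beta>25 \<beta>26 \<gamma>36 where v: "v = (\<alpha>03, \<beta>03, \<beta>14, \<beta>06, \<beta>25, \<beta>26, \<gamma>36)"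
    by (cases v)
  have small: "(m = 0 \<or> m = 1 \<or> m = 2 \<or> m = 3 \<or> m = 4) \<or> m < 0 \<or> 8 < 2 * m"
    by presburger
  have large: "square_op (sq_table v) 1 (sq_table v k (2 * m)) = sq_table v k (2 * m + 1)"
    if "m < 0 \<or> 8 < 2 * m"
    using that by (auto simp: sq_table_gt_8 square_op_zero) (simp_all add: sq_table_def square_op_zero)
  show "square_op (sq_table v) 1 (sq_table v k (2 * m)) = sq_table v k (2 * m + 1)"
  proof (cases "k < 8")
    case True
    show ?thesis
    proof (cases "m < 0 \<or> 8 < 2 * m")
      case False
      then have "m = 0 \<or> m = 1 \<or> m = 2 \<or> m = 3 \<or> m = 4" using small by blast
      with True show ?thesis
        by (elim less_8_cases disjE)
          (simp_all add: sq_table_def v sq_row_def square_op_simps model_cancel)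
    qed (rule large)
  next
    case False
    then show ?thesis
      by (cases "m = 0") (simp_all add: sq_table_ge_7 square_op_zero square_op_mz sq_table_0)
  qed
  show "square_op (sq_table v) 1 (sq_table v k 1) = 0"
  proof (cases "k < 8")
    case True
    then show ?thesis
      by (elim less_8_cases) (simp_all add: sq_table_def v sq_row_def square_op_simps)
  qed (simp add: sq_table_ge_7 square_op_zero)
qed

lemma sq_table_hom: "model_hom (mz_deg k + (n, n div 2)) (sq_table v k n)"
proof -
  obtain \<alpha>03 \<beta>03 \<beta>14 \<beta>06 \<beta>25 \<beta>26 \<gamma>36 where v: "v = (\<alpha>03, \<beta>03, \<beta>14, \<beta>06, \<beta>25, \<beta>26, \<gamma>36)"
    by (cases v)
  have small: "(n = 0 \<or> n = 1 \<or> n = 2 \<or> n = 3 \<or> n = 4 \<or> n = 5 \<or> n = 6 \<or> n = 7 \<or> n = 8) \<or> n < 0 \<or> 8 < n"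
    by presburger
  have t: "model_hom d (mt * mz k)" if "d = mz_deg k + (0, 1)" for d k
    by (rule model_hom_tau[OF model_hom.gen that])
  have r: "model_hom d (mr * mz k)" if "d = mz_deg k + (1, 1)" for d k
    by (rule model_hom_rho[OF model_hom.gen that])
  have r2: "model_hom d (mr * (mr * mz k))" if "d = mz_deg k + (2, 2)" for d k
    using model_hom_rho2[OF model_hom.gen that] by (simp add: power2_eq_square mult.assoc)
  show ?thesis
  proof (cases "k < 8")
    case True
    then show ?thesis using small
      by (elim less_8_cases disjE)
        (auto simp add: sq_table_def v sq_row_def power2_eq_square mult.assoc distrib_right mz_deg_simps
          model_hom.zero intro!: model_hom.add model_hom_mbit t r r2 model_hom_gen)
  next
    case False
    then show ?thesis
      by (cases "n = 0") (auto simp: sq_table_0 sq_table_ge_7 model_hom.zero intro: model_hom_gen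
          simp flip: zero_prod_def)
  qed
qed

interpretation sq: graded_table "sq_table v" for v
  by (intro graded_table.intro square_table_sq_table graded_table_axioms.intro sq_table_hom)

text \<open>The one place where the parameters interact is the relation for
  \<open>Sq 4 * Sq 4\<close> on \<open>mz 0\<close>: the left side is \<open>\<beta>03 * \<gamma>36
  + \<alpha>03 * (\<beta>25 + \<beta>26)\<close> times \<open>mr\<^sup>2 * mz 7\<close>, and the
  right side is the sixth square of \<open>mz 2\<close>, whose coefficient is chosen
  accordingly.\<close>

lemma sq_table_adem: "sq.ops.adem_at v (mz k)"
proof -
  obtain \<alpha>03 \<beta>03 \<beta>14 \<beta>06 \<beta>25 \<beta>26 \<gamma>36 where v: "v = (\<alpha>03, \<beta>03, \<beta>14, \<beta>06, \<beta>25, \<beta>26, \<gamma>36)"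
    by (cases v)
  show ?thesis
  proof (cases "k < 8")
    case True
    then show ?thesis
      by (elim less_8_cases)
        (rule sq.adem_at_mzI;
         simp add: square_op_mz sq_table_def v sq_row_def square_op_simps model_cancel mbit_idem;
         simp add: model_cancel mbit_idem ac_simps)+
  next
    case False
    then show ?thesis
      by (intro sq.adem_at_mzI) (simp_all add: square_op_mz sq_table_ge_7 square_op_zero)
  qed
qed

interpretation sq: steenrod_table "sq_table v" for v
  by (intro steenrod_table.intro square_table_sq_table steenrod_table_axioms.intro sq_table_adem)

section \<open>Relations in the Steenrod algebra\<close>

lemma AR_relations:
  "Sq 0 = 1" "tau * rho = rho * tau" "Sq n * rho = rho * Sq n" "Sq 1 * tau = tau * Sq 1 + rho"
  "Sq (2 * k + 2) * tau = tau * Sq (2 * k + 2) + tau * rho * Sq (2 * k + 1)"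
  "Sq (2 * k + 3) * tau = tau * Sq (2 * k + 3) + rho * Sq (2 * k + 2) + rho\<^sup>2 * Sq (2 * k + 1)"
  using relators.intros(1-6)[THEN abs_AR_relator]
  by (simp_all only: abs_AR_simps abs_AR_power right_minus_eq)

lemma Sq_rho_mult: "Sq n * (rho * x) = rho * (Sq n * x)"
  by (metis AR_relations(3) mult.assoc)

lemma Sq_1_tau_mult: "Sq 1 * (tau * x) = tau * (Sq 1 * x) + rho * x"
  using arg_cong[OF AR_relations(4), of "\<lambda>a. a * x"]
  by (simp only: distrib_right mult.assoc)

lemma Sq_2_tau_mult: "Sq 2 * (tau * x) = tau * (Sq 2 * x) + tau * (rho * (Sq 1 * x))"
  using arg_cong[OF AR_relations(5)[of 0, unfolded mult_0_right add_0_left], of "\<lambda>a. a * x"]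
  by (simp only: distrib_right mult.assoc)

lemma AR_adem: "0 < a \<Longrightarrow> a < 2 * b \<Longrightarrow> Sq a * Sq b = abs_AR (adem_rhs a b)"
  using relators.adem[THEN abs_AR_relator] by (simp add: abs_AR_simps)

lemma abs_AR_of_nat: "abs_AR (of_nat n) = of_nat n"
  by (induction n) (simp_all add: abs_AR_simps)

lemma abs_AR_numeral: "abs_AR (numeral n) = numeral n"
  using abs_AR_of_nat[of "numeral n"] by simp

lemma AR_add_cancel: "(a :: AR) + (a + b) = b" "2 * a = 0" "(2 :: AR) = 0" "(3 :: AR) = 1" "(5 :: AR) = 1"
proof -
  show 2: "(2 :: AR) = 0" using AR_add_self[of 1] by simp
  have "(3 :: AR) = 2 + 1" "(5 :: AR) = 2 + 2 + 1" by simp_all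
  then show "(3 :: AR) = 1" "(5 :: AR) = 1" unfolding 2 by simp_all
  show "2 * a = 0" by (simp add: 2)
  show "a + (a + b) = b" by (simp only: AR_add_self add_0_left flip: add.assoc)
qed

lemma adem_index_sets:
  "{..Suc 0} = {0, Suc 0}" "{..2::nat} = {0, 1, 2}"
  "{c. c = 0 \<and> odd c} = {}" "{c. c = 0 \<and> even c} = {0}"
  "{c. c \<le> Suc 0 \<and> odd c} = {1}" "{c::nat. c \<le> 2 \<and> odd c} = {1}"
  by (auto simp: numeral_2_eq_2 le_Suc_eq)

lemma choose_small: "3 choose 2 = (3::nat)" "2 choose 2 = (1::nat)" "5 choose (Suc 0) = (5::nat)"
  "Suc 0 choose 2 = 0" "2 choose 4 = (0::nat)" "3 choose 4 = (0::nat)"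
  by (simp_all add: numeral_eq_Suc)

lemma Sq_3_Suc: "Sq (Suc (Suc (Suc 0))) = Sq 3"
  by (simp add: numeral_3_eq_3)

text \<open>These instances express the squares up to \<open>Sq 7\<close> through
  \<open>Sq 1\<close>, \<open>Sq 2\<close> and \<open>Sq 4\<close>. The ones for
  \<open>Sq 2 * Sq 3\<close> and \<open>Sq 4 * Sq 4\<close> supply the constraints on
  \<open>Sq 4\<close> in the classification.\<close>

lemma adem_small:
  "Sq 1 * Sq 1 = 0" "Sq 1 * Sq 2 = Sq 3" "Sq 1 * Sq 4 = Sq 5" "Sq 1 * Sq 6 = Sq 7"
  "Sq 2 * Sq 2 = tau * Sq 3 * Sq 1"
  "Sq 2 * Sq 3 = Sq 5 + Sq 4 * Sq 1 + rho * Sq 3 * Sq 1"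
  "Sq 2 * Sq 4 = Sq 6 + tau * Sq 5 * Sq 1"
  "Sq 4 * Sq 4 = tau * Sq 7 * Sq 1 + Sq 6 * Sq 2"
  by (simp_all add: AR_adem adem_rhs_def adem_index_sets abs_AR_simps abs_AR_numeral abs_AR_power
      abs_AR_sum AR_relations(1) choose_small AR_add_cancel Sq_3_Suc)

section \<open>Coordinates on \<open>A1\<close>\<close>

lemma bit_AR_simps: "bit_AR 0 = 0" "bit_AR 1 = 1"
  by (simp_all add: bit_AR_def)

lemma bit_AR_add: "bit_AR (a + b) = bit_AR a + bit_AR b"
  by (cases a; cases b) (simp_all add: bit_AR_simps AR_add_cancel)

lemma bit_AR_mult: "bit_AR (a * b) = bit_AR a * bit_AR b"
  by (cases a; cases b) (simp_all add: bit_AR_simps)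

lemma bit_AR_commute: "bit_AR b * x = x * bit_AR b"
  by (cases b) (simp_all add: bit_AR_simps)

section \<open>The coefficient ring inside \<open>AR\<close>\<close>

definition rho_poly :: "bit poly \<Rightarrow> AR" where
  "rho_poly c = (\<Sum>j\<le>degree c. bit_AR (coeff c j) * rho ^ j)"

lemma rho_poly_superset:
  assumes "degree c \<le> N" shows "rho_poly c = (\<Sum>j\<le>N. bit_AR (coeff c j) * rho ^ j)"
  unfolding rho_poly_def using assms
  by (intro sum.mono_neutral_left) (auto simp: coeff_eq_0 bit_AR_simps simp del: bit_not_zero_iff)

lemma rho_poly_pCons: "rho_poly (pCons b c) = bit_AR b + rho * rho_poly c"
proof -
  have "rho * (bit_AR x * y) = bit_AR x * (rho * y)" for x y
    by (cases x) (simp_all add: bit_AR_simps)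
  then show ?thesis
    by (subst rho_poly_superset[OF degree_pCons_le])
       (simp only: sum.atMost_Suc_shift coeff_pCons_0 coeff_pCons_Suc
        power_0 mult_1_right power_Suc rho_poly_def sum_distrib_left)
qed

lemma rho_poly_0: "rho_poly 0 = 0"
  by (simp add: rho_poly_def bit_AR_simps)

lemma rho_poly_add: "rho_poly (c + c') = rho_poly c + rho_poly c'"
  by (induction c c' rule: poly_induct2)
     (simp_all add: rho_poly_0 rho_poly_pCons bit_AR_add algebra_simps del: add_bit_eq_xor)

lemma M2_unit_superset:
  assumes "degree m \<le> N" shows "M2_unit m = (\<Sum>i\<le>N. tau ^ i * rho_poly (coeff m i))"
proof -
  have "M2_unit m = (\<Sum>i\<le>degree m. tau ^ i * rho_poly (coeff m i))"
  proof -
    have "bit_AR b * x * y = x * (bit_AR b * y)" for b x y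
      by (cases b) (simp_all add: bit_AR_simps)
    then show ?thesis by (simp add: M2_unit_def rho_poly_def sum_distrib_left)
  qed
  also have "\<dots> = (\<Sum>i\<le>N. tau ^ i * rho_poly (coeff m i))"
    using assms by (intro sum.mono_neutral_left) (auto simp: coeff_eq_0 rho_poly_0)
  finally show ?thesis .
qed

lemma M2_unit_0: "M2_unit 0 = 0"
  by (simp add: M2_unit_def bit_AR_simps)

text \<open>The Horner recursion, which removes the degree bounds of the double sum and makes
  induction on polynomials available.\<close>

lemma M2_unit_pCons: "M2_unit (pCons c m) = rho_poly c + tau * M2_unit m"
  by (subst M2_unit_superset[OF degree_pCons_le])
     (simp only: M2_unit_superset[OF order_refl] sum.atMost_Suc_shift
      coeff_pCons_0 coeff_pCons_Suc power_0 mult_1_left power_Suc sum_distrib_left mult.assoc)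

lemma M2_unit_add: "M2_unit (m + m') = M2_unit m + M2_unit m'"
  by (induction m m' rule: poly_induct2)
     (simp_all add: M2_unit_0 M2_unit_pCons rho_poly_add algebra_simps)

lemma M2_unit_1: "M2_unit 1 = 1"
  by (simp add: one_pCons M2_unit_pCons M2_unit_0 rho_poly_pCons rho_poly_0 bit_AR_simps)

lemma M2_unit_rho: "M2_unit (smult [:0, 1:] m) = rho * M2_unit m"
proof (induction m)
  case 0 then show ?case by (simp add: M2_unit_0)
next
  case (pCons c m)
  have "tau * (rho * x) = rho * (tau * x)" for x
    by (simp only: AR_relations(2) flip: mult.assoc)
  then show ?case using pCons.IH
    by (simp add: M2_unit_pCons rho_poly_pCons bit_AR_simps distrib_left)
qed

lemma M2_unit_monom: "M2_unit (monom (monom b j) i) = bit_AR b * tau ^ i * rho ^ j"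
proof (induction i)
  case 0
  have "rho_poly (monom b j) = bit_AR b * rho ^ j"
  proof (induction j)
    case (Suc j)
    then show ?case using bit_AR_commute[of b rho]
      by (simp add: monom_Suc rho_poly_pCons bit_AR_simps flip: mult.assoc)
  qed (simp add: monom_0 rho_poly_pCons rho_poly_0)
  then show ?case by (simp add: monom_0 M2_unit_pCons M2_unit_0)
next
  case (Suc i)
  then show ?case using bit_AR_commute[of b tau]
    by (simp add: monom_Suc M2_unit_pCons rho_poly_0 flip: mult.assoc)
qed

lemma A1_0: "0 \<in> A1" using A1.diff[OF A1.one A1.one] by simp

lemma A1_add: "a \<in> A1 \<Longrightarrow> b \<in> A1 \<Longrightarrow> a + b \<in> A1"
  using A1.diff[of a b] by (simp add: AR_diff)

lemma A1_sum: "(\<And>x. x \<in> X \<Longrightarrow> f x \<in> A1) \<Longrightarrow> sum f X \<in> A1"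
  by (induction X rule: infinite_finite_induct) (auto simp: A1_0 A1_add)

lemma A1_bit_AR: "bit_AR b \<in> A1"
  by (cases b) (simp_all add: bit_AR_simps A1_0 A1.one)

lemma A1_rho_poly: "rho_poly c \<in> A1"
  by (induction c) (simp_all add: rho_poly_0 rho_poly_pCons A1_0 A1_add A1_bit_AR A1.mult A1.rho)

lemma A1_M2_unit: "M2_unit m \<in> A1"
  by (induction m) (simp_all add: M2_unit_0 M2_unit_pCons A1_0 A1_add A1_rho_poly A1.mult A1.tau)

lemma A1_Sq3: "Sq 3 \<in> A1"
  unfolding adem_small(2)[symmetric] by (intro A1.mult A1.Sq1 A1.Sq2)

lemma model_coeff_mt: "coeff (mt * v) k = pCons 0 (coeff v k)"
  by (simp add: mt_def)

lemma model_coeff_mr: "coeff (mr * v) k = smult [:0, 1:] (coeff v k)"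
  by (simp add: mr_def)

lemma model_coeff_mz: "coeff (mz n) k = (if k = n then 1 else 0)"
  by (auto simp: mz_def coeff_monom)

text \<open>The bidegree determines \<open>j\<close> by the degree and then \<open>i\<close> by the
  weight. Hence a homogeneous element has at most one monomial in \<tau> and \<rho> at each
  generator, that is, one bit of freedom.\<close>

lemma model_hom_coeff:
  "model_hom d v \<Longrightarrow> coeff (coeff (coeff v k) i) j \<noteq> 0 \<Longrightarrow> d = mz_deg k + (int j, int i + int j)"
proof (induction arbitrary: k i j rule: model_hom.induct)
  case (add d v w)
  then have "coeff (coeff (coeff v k) i) j \<noteq> 0 \<or> coeff (coeff (coeff w k) i) j \<noteq> 0" by auto
  then show ?case using add.IH by blast
next
  case (gen n)
  then show ?case
    by (cases "k = n"; cases i; cases j) (auto simp: model_coeff_mz one_pCons zero_prod_def[symmetric])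
next
  case (tau d v)
  then show ?case
    by (cases i) (auto simp: model_coeff_mt algebra_simps dest!: tau.IH simp del: bit_not_zero_iff)
next
  case (rho d v)
  then show ?case
    by (cases j) (auto simp: model_coeff_mr algebra_simps dest!: rho.IH simp del: bit_not_zero_iff)
qed simp

text \<open>A list rather than a family indexed by bidegree: repeated bidegrees are harmless, so the
  induction never has to merge components.\<close>

lemma model_hom_sum:
  "\<exists>ws. v = sum_list ws \<and> (\<forall>w\<in>set ws. \<exists>d. model_hom d w)"
proof (induction v rule: model_induct)
  case zero
  show ?case by (rule exI[of _ "[]"]) simp
next
  case (add v w)
  then obtain ws us where "v = sum_list ws" "\<forall>w\<in>set ws. \<exists>d. model_hom d w"
    "w = sum_list us" "\<forall>w\<in>set us. \<exists>d. model_hom d w" by blast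
  then show ?case by (intro exI[of _ "ws @ us"]) auto
next
  case (gen k)
  have "\<forall>w\<in>set [mz k]. \<exists>d. model_hom d w" using model_hom.gen[of k] by (simp del: split_paired_Ex) blast
  then show ?case by (intro exI[of _ "[mz k]"]) simp
next
  case (tau v)
  then obtain ws where "v = sum_list ws" "\<forall>w\<in>set ws. \<exists>d. model_hom d w" by blast
  then show ?case
    using model_hom.tau
    by (intro exI[of _ "map ((*) mt) ws"]) (fastforce simp: sum_list_const_mult simp del: split_paired_Ex)
next
  case (rho v)
  then obtain ws where "v = sum_list ws" "\<forall>w\<in>set ws. \<exists>d. model_hom d w" by blast
  then show ?case
    using model_hom.rho
    by (intro exI[of _ "map ((*) mr) ws"]) (fastforce simp: sum_list_const_mult simp del: split_paired_Ex)
qed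

section \<open>Coordinates with respect to the given basis\<close>

context A1_basis
begin

abbreviation "bs \<equiv> [x00, x10, x21, x31, y31, y41, y52, y62]"

text \<open>The generators from \<open>mz 8\<close> on are sent to 0. So \<open>Phi\<close> is onto
  \<open>A1\<close> but not injective, and an operation descends along it only if it preserves the
  span of these generators.\<close>

definition Phi :: "bit poly poly poly \<Rightarrow> AR" where
  "Phi v = (\<Sum>k<8. M2_unit (coeff v k) * bs ! k)"

lemma Phi_0: "Phi 0 = 0"
  by (simp add: Phi_def M2_unit_0)

lemma Phi_add: "Phi (v + w) = Phi v + Phi w"
  by (simp add: Phi_def M2_unit_add distrib_right sum.distrib)

lemma Phi_diff: "Phi (v - w) = Phi v - Phi w"
  using Phi_add[of "v - w" w] by (simp add: algebra_simps)

lemma Phi_mt: "Phi (mt * v) = tau * Phi v"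
  by (simp add: Phi_def model_coeff_mt M2_unit_pCons rho_poly_0 sum_distrib_left mult.assoc)

lemma Phi_mr: "Phi (mr * v) = rho * Phi v"
  by (simp add: Phi_def model_coeff_mr M2_unit_rho sum_distrib_left mult.assoc)

lemma Phi_mz: "Phi (mz k) = (if k < 8 then bs ! k else 0)"
proof -
  have "Phi (mz k) = (\<Sum>i<8. if i = k then bs ! i else 0)"
    unfolding Phi_def model_coeff_mz by (intro sum.cong) (auto simp: M2_unit_0 M2_unit_1)
  then show ?thesis by simp
qed

lemma Phi_mz_simps: "Phi (mz 0) = x00" "Phi (mz (Suc 0)) = x10" "Phi (mz 1) = x10" "Phi (mz 2) = x21" "Phi (mz 3) = x31"
  "Phi (mz 4) = y31" "Phi (mz 5) = y41" "Phi (mz 6) = y52" "Phi (mz 7) = y62" "8 \<le> k \<Longrightarrow> Phi (mz k) = 0"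
  by (simp_all add: Phi_mz)

lemma Phi_mbit: "Phi (mbit b * v) = bit_AR b * Phi v"
  by (cases b) (simp_all add: mbit_0 mbit_1 bit_AR_simps Phi_0)

lemma basis_A1: "k < 8 \<Longrightarrow> bs ! k \<in> A1"
  using basis nth_mem[of k bs] by (auto simp: M2_basis_of_A1_def simp del: nth_mem)

lemma Phi_in_A1: "Phi v \<in> A1"
  unfolding Phi_def by (intro A1_sum A1.mult A1_M2_unit basis_A1) simp

lemma Phi_surj:
  assumes "x \<in> A1" obtains v where "x = Phi v"
proof -
  have len: "length bs = 8" by simp
  obtain ms :: "M2 list" where ms: "length ms = 8" "x = (\<Sum>i<8. M2_unit (ms ! i) * bs ! i)"
    using basis assms unfolding M2_basis_of_A1_def len by blast
  have "x = Phi (Poly ms)"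
    unfolding ms(2) Phi_def by (rule sum.cong) (simp_all add: coeff_Poly_eq nth_default_nth ms(1))
  then show ?thesis by (rule that)
qed

lemma Phi_inj:
  assumes "Phi v = Phi w" "k < 8" shows "coeff v k = coeff w k"
proof -
  have len: "length bs = 8" by simp
  have "\<exists>!ms :: M2 list. length ms = 8 \<and> Phi v = (\<Sum>i<8. M2_unit (ms ! i) * bs ! i)"
    using basis Phi_in_A1[of v] unfolding M2_basis_of_A1_def len by blast
  moreover have "Phi u = (\<Sum>i<8. M2_unit (map (coeff u) [0..<8] ! i) * bs ! i)" for u
    unfolding Phi_def by (rule sum.cong) simp_all
  moreover have "length (map (coeff u) [0..<8]) = 8" for u :: "bit poly poly poly" by simp
  ultimately have "map (coeff v) [0..<8] = map (coeff w) [0..<8]"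
    using assms(1) by metis
  then show ?thesis using assms(2) by simp
qed

lemma Phi_eq_0_iff: "Phi v = 0 \<longleftrightarrow> (\<forall>k<8. coeff v k = 0)"
proof
  assume "Phi v = 0"
  then have "Phi v = Phi 0" by (simp add: Phi_0)
  then show "\<forall>k<8. coeff v k = 0" using Phi_inj by fastforce
qed (simp add: Phi_def M2_unit_0)

lemma A1_induct [consumes 1, case_names zero add gen tau rho]:
  assumes "x \<in> A1" and 0: "P 0"
    and add: "\<And>x y. x \<in> A1 \<Longrightarrow> y \<in> A1 \<Longrightarrow> P x \<Longrightarrow> P y \<Longrightarrow> P (x + y)"
    and gen: "\<And>k. k < 8 \<Longrightarrow> P (bs ! k)"
    and tau: "\<And>x. x \<in> A1 \<Longrightarrow> P x \<Longrightarrow> P (tau * x)"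
    and rho: "\<And>x. x \<in> A1 \<Longrightarrow> P x \<Longrightarrow> P (rho * x)"
  shows "P x"
proof -
  have "P (Phi v)" for v
  proof (induction v rule: model_induct)
    case (gen k) then show ?case unfolding Phi_mz by (simp add: 0 assms(4))
  qed (simp_all only: Phi_0 Phi_add Phi_mt Phi_mr 0 add tau rho Phi_in_A1)
  then show ?thesis using Phi_surj[OF assms(1)] by metis
qed

lemma basis_deg: "k < 8 \<Longrightarrow> bs ! k \<in> AR_deg (mz_deg k)"
  using bidegrees by (elim less_8_cases) (simp_all add: mz_deg_simps)

lemma A1_deg_basis: "k < 8 \<Longrightarrow> bs ! k \<in> A1_deg (mz_deg k)"
  by (simp only: A1_deg_def Int_iff basis_A1 basis_deg)

lemma Phi_hom: "model_hom d v \<Longrightarrow> Phi v \<in> A1_deg d"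
proof (induction rule: model_hom.induct)
  case (zero d) show ?case by (simp add: Phi_0 A1_deg_def A1_0 AR_deg_0)
next
  case (add d v w)
  then show ?case using AR_deg_diff[of "Phi v" d "Phi w"]
    by (simp add: Phi_add A1_deg_def A1_add AR_diff)
next
  case (gen k)
  then show ?case
    using A1_deg_basis[of k] unfolding Phi_mz by (auto simp: A1_deg_def A1_0 AR_deg_0)
next
  case (tau d v)
  then show ?case using AR_deg_mult[OF AR_deg_gens(2), of "Phi v" d]
    by (simp add: Phi_mt A1_deg_def A1.mult A1.tau add.commute)
next
  case (rho d v)
  then show ?case using AR_deg_mult[OF AR_deg_gens(3), of "Phi v" d]
    by (simp add: Phi_mr A1_deg_def A1.mult A1.rho add.commute)
qed

text \<open>\<open>A1\<close> is spanned by products of homogeneous coefficients with homogeneous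
  basis elements, so it contains the components of its elements, and each component has a
  homogeneous coordinate vector.\<close>

lemma component_Phi: "\<exists>w. model_hom d w \<and> Phi w = component d (Phi v)"
proof -
  obtain ws where v: "v = sum_list ws" and ws: "\<forall>w\<in>set ws. \<exists>d. model_hom d w"
    using model_hom_sum by blast
  show ?thesis unfolding v using ws
  proof (induction ws)
    case Nil
    show ?case by (rule exI[of _ 0]) (simp add: model_hom.zero Phi_0 component_0)
  next
    case (Cons u us)
    then obtain e w where e: "model_hom e u" and w: "model_hom d w" "Phi w = component d (Phi (sum_list us))"
      by auto
    have "Phi u \<in> AR_deg e" using Phi_hom[OF e] by (simp add: A1_deg_def)
    from component_AR_deg[OF this] show ?case
      by (intro exI[of _ "(if d = e then u else 0) + w"])
        (use e w in \<open>auto simp: Phi_add component_add Phi_0 intro!: model_hom.add\<close>)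
  qed
qed

lemma A1_degE:
  assumes "x \<in> A1_deg d" obtains v where "model_hom d v" "x = Phi v"
proof -
  have "x \<in> A1" "component d x = x" using assms component_AR_deg[of x d d] by (simp_all add: A1_deg_def)
  obtain v where v: "x = Phi v" using Phi_surj[OF \<open>x \<in> A1\<close>] .
  obtain w where "model_hom d w" "Phi w = component d (Phi v)" using component_Phi by blast
  then show ?thesis using that[of w] v \<open>component d x = x\<close> by simp
qed

lemma component_in_A1_deg: "x \<in> A1 \<Longrightarrow> component d x \<in> A1_deg d"
proof -
  assume "x \<in> A1"
  then obtain v where v: "x = Phi v" by (rule Phi_surj)
  obtain w where "model_hom d w" "Phi w = component d (Phi v)" using component_Phi by blast
  then show ?thesis using Phi_hom[of d w] v by simp
qed

lemma A1_component_sum: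
  assumes "x \<in> A1"
  shows "finite {d. component d x \<noteq> 0} \<and> x = (\<Sum>d | component d x \<noteq> 0. component d x)"
proof -
  \<comment> \<open>\<open>F\<close> may be larger than the support, so that it can simply grow by
    one bidegree with each summand; sums may cancel and shrink the support.\<close>
  have "\<exists>F. finite F \<and> (\<forall>d. d \<notin> F \<longrightarrow> component d x = 0) \<and> x = (\<Sum>d\<in>F. component d x)"
  proof -
    obtain v where x: "x = Phi v" using Phi_surj assms by blast
    obtain ws where v: "v = sum_list ws" and ws: "\<forall>w\<in>set ws. \<exists>d. model_hom d w"
      using model_hom_sum by blast
    show ?thesis unfolding x v using ws
    proof (induction ws)
      case Nil then show ?case by (intro exI[of _ "{}"]) (simp add: Phi_0 component_0)
    next
      case (Cons u us)
      then obtain e F where e: "model_hom e u"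
        and F: "finite F" "\<forall>d. d \<notin> F \<longrightarrow> component d (Phi (sum_list us)) = 0"
          "Phi (sum_list us) = (\<Sum>d\<in>F. component d (Phi (sum_list us)))"
        by auto
      have u: "Phi u \<in> AR_deg e" using Phi_hom[OF e] by (simp add: A1_deg_def)
      let ?F = "insert e F"
      have "Phi (sum_list us) = (\<Sum>d\<in>?F. component d (Phi (sum_list us)))"
        by (subst F(3), rule sum.mono_neutral_left) (use F(1,2) in auto)
      moreover have "Phi u = (\<Sum>d\<in>?F. component d (Phi u))"
        using F(1) by (simp add: component_AR_deg[OF u] sum.delta)
      ultimately have "Phi (sum_list (u # us)) = (\<Sum>d\<in>?F. component d (Phi (sum_list (u # us))))"
        by (simp only: sum_list.Cons Phi_add component_add sum.distrib)
      moreover have "\<forall>d. d \<notin> ?F \<longrightarrow> component d (Phi (sum_list (u # us))) = 0"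
        using F(2) by (simp add: Phi_add component_add component_AR_deg[OF u] del: split_paired_All)
      ultimately show ?case using F(1) by (intro exI[of _ ?F] conjI) simp_all
    qed
  qed
  then obtain F where F: "finite F" "\<forall>d. d \<notin> F \<longrightarrow> component d x = 0" "x = (\<Sum>d\<in>F. component d x)" by blast
  then have sub: "{d. component d x \<noteq> 0} \<subseteq> F" by auto
  show ?thesis
  proof
    show "finite {d. component d x \<noteq> 0}" using sub F(1) finite_subset by blast
    show "x = (\<Sum>d | component d x \<noteq> 0. component d x)"
      by (subst F(3), rule sum.mono_neutral_right) (use F sub in auto)
  qed
qed

lemma A1_direct_sum:
  assumes "x \<in> A1"
  shows "\<exists>!c. finite {d. c d \<noteq> 0} \<and> (\<forall>d. c d \<in> A1_deg d) \<and> x = (\<Sum>d\<in>{d. c d \<noteq> 0}. c d)"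
proof (rule ex1I[of _ "\<lambda>d. component d x"])
  show "finite {d. component d x \<noteq> 0} \<and> (\<forall>d. component d x \<in> A1_deg d)
      \<and> x = (\<Sum>d\<in>{d. component d x \<noteq> 0}. component d x)"
    using A1_component_sum[OF assms] component_in_A1_deg[OF assms] by blast
next
  fix c assume c: "finite {d. c d \<noteq> 0} \<and> (\<forall>d. c d \<in> A1_deg d) \<and> x = (\<Sum>d\<in>{d. c d \<noteq> 0}. c d)"
  show "c = (\<lambda>d. component d x)"
  proof
    fix e
    have "component e x = (\<Sum>d\<in>{d. c d \<noteq> 0}. component e (c d))"
      using c component_sum by metis
    also have "\<dots> = (\<Sum>d\<in>{d. c d \<noteq> 0}. if e = d then c d else 0)"
    proof (rule sum.cong[OF refl])
      fix d show "component e (c d) = (if e = d then c d else 0)"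
        using c component_AR_deg[of "c d" d e] by (simp add: A1_deg_def del: split_paired_All)
    qed
    also have "\<dots> = c e" using c by (simp add: sum.delta)
    finally show "c e = component e x" ..
  qed
qed

text \<open>Since the exponents at each basis element are forced by the bidegree, one bit per basis
  element describes \<open>x\<close>; a negative exponent means that the basis element does not
  occur.\<close>

lemma A1_deg_coords:
  assumes "x \<in> A1_deg (s, w)"
  shows "\<exists>\<beta> :: nat \<Rightarrow> bit. x = (\<Sum>k<8. let j = s - fst (mz_deg k); i = w - snd (mz_deg k) - j in
    if 0 \<le> i \<and> 0 \<le> j then bit_AR (\<beta> k) * tau ^ nat i * rho ^ nat j * bs ! k else 0)"
proof -
  obtain v where v: "model_hom (s, w) v" "x = Phi v" using A1_degE[OF assms] by blast
  define J where "J k = s - fst (mz_deg k)" for k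
  define I where "I k = w - snd (mz_deg k) - J k" for k
  have idx: "J k = int j \<and> I k = int i" if "coeff (coeff (coeff v k) i) j \<noteq> 0" for k i j
    using model_hom_coeff[OF v(1) that] by (auto simp: I_def J_def prod_eq_iff)
  define \<beta> where "\<beta> k = coeff (coeff (coeff v k) (nat (I k))) (nat (J k))" for k
  have "M2_unit (coeff v k) = (if 0 \<le> I k \<and> 0 \<le> J k then bit_AR (\<beta> k) * tau ^ nat (I k) * rho ^ nat (J k) else 0)" for k
  proof (cases "0 \<le> I k \<and> 0 \<le> J k")
    case True
    have "coeff v k = monom (monom (\<beta> k) (nat (J k))) (nat (I k))"
      by (intro poly_eqI) (use idx[of k] in \<open>force simp: coeff_monom \<beta>_def\<close>)
    then show ?thesis using True by (simp add: M2_unit_monom)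
  next
    case False
    then have "coeff v k = 0" by (intro poly_eqI) (use idx[of k] in force)
    then show ?thesis using False by (simp only: M2_unit_0 if_False)
  qed
  then have "x = (\<Sum>k<8. let j = J k; i = I k in
    if 0 \<le> i \<and> 0 \<le> j then bit_AR (\<beta> k) * tau ^ nat i * rho ^ nat j * bs ! k else 0)"
    unfolding v(2) Phi_def Let_def by (intro sum.cong) auto
  then show ?thesis unfolding J_def I_def Let_def by (intro exI[of _ \<beta>]) simp
qed

lemma A1_deg_eq_0: "x \<in> A1_deg d \<Longrightarrow> fst d - snd d > 4 \<Longrightarrow> x = 0"
  by (erule A1_degE) (use model_hom_eq_0 Phi_0 in blast)

section \<open>The module structures of the family\<close>

text \<open>The kernel is spanned by the generators from \<open>mz 8\<close> on, where positive
  squares vanish, and the Cartan formula preserves it under \<tau> and \<rho>. This makes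
  \<open>family_act\<close> independent of the chosen preimage.\<close>

lemma Phi_model_act_kernel: "Phi v = 0 \<Longrightarrow> Phi (sq.act p a v) = 0"
proof (induction a arbitrary: v rule: AR_induct)
  case (Sq n)
  have twist: "Phi (twist m f i) = 0" if "\<And>i. Phi (f i) = 0" for m f i
  proof (induction m arbitrary: i)
    case (pCons c m)
    have "Phi ([:[:c:]:] * f i) = 0" using that[of i] unfolding Phi_eq_0_iff by simp
    then show ?case using pCons.IH
      by (simp add: twist_pCons tau_twist_def Phi_add Phi_mt Phi_mr mult.assoc power2_eq_square)
  qed (simp add: twist_0 Phi_0)
  have "Phi (twist (coeff v k) (sq_table p k) i) = 0" for k i
  proof (cases "k < 8")
    case True
    then show ?thesis using Sq by (simp add: Phi_eq_0_iff twist_0)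
  next
    case False
    then have "Phi (sq_table p k i) = 0" for i
      by (cases "i = 0") (simp_all add: sq_table_0 sq_table_ge_7 Phi_mz_simps Phi_0)
    then show ?thesis by (rule twist)
  qed
  moreover have "Phi (sum f X) = (\<Sum>k\<in>X. Phi (f k))" for f and X :: "nat set"
    by (induction X rule: infinite_finite_induct) (simp_all add: Phi_0 Phi_add)
  ultimately show ?case by (simp add: sq.act_gens square_op_def[of _ _ v])
qed (simp_all add: sq.act_diff_left sq.act_mult sq.act_1 Phi_diff sq.act_gens Phi_mt Phi_mr)

definition family_act :: "param \<Rightarrow> AR \<Rightarrow> AR \<Rightarrow> AR" where
  "family_act p a x = Phi (sq.act p a (SOME v. x = Phi v))"

lemma family_act_Phi: "family_act p a (Phi v) = Phi (sq.act p a v)"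
proof -
  let ?w = "SOME w. Phi v = Phi w"
  have "Phi v = Phi ?w" by (rule someI[of _ v]) simp
  then have "Phi (sq.act p a (?w - v)) = 0" by (intro Phi_model_act_kernel) (simp add: Phi_diff)
  moreover have "sq.act p a ?w = sq.act p a v + sq.act p a (?w - v)"
    by (simp flip: sq.act_add_right)
  ultimately show ?thesis by (simp add: family_act_def Phi_add)
qed

text \<open>\<open>A1_basis\<close> prescribes \<open>Sq 1\<close> and \<open>Sq 2\<close> on part
  of the basis. These four elements are values of \<open>Sq 1\<close>, hence are killed by
  it.\<close>

lemma Sq_1_basis: "Sq 1 * x10 = 0" "Sq 1 * x31 = 0" "Sq 1 * y41 = 0" "Sq 1 * y62 = 0"
proof -
  have "Sq 1 * (Sq 1 * x) = 0" for x
    by (simp only: mult.assoc[symmetric] adem_small(1) mult_zero_left)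
  from this[of x00] this[of x21] this[of y31] this[of y52]
  show "Sq 1 * x10 = 0" "Sq 1 * x31 = 0" "Sq 1 * y41 = 0" "Sq 1 * y62 = 0" by (simp_all only: Sq1)
qed

text \<open>The three elements are \<open>Sq 2\<close> of \<open>x10\<close>, \<open>x31\<close> and
  \<open>y41\<close>, on which \<open>Sq 1\<close> vanishes; so
  \<open>Sq 2 * Sq 2 = tau * Sq 3 * Sq 1\<close> gives 0.\<close>

lemma Sq_2_basis: "Sq 2 * y31 = 0" "Sq 2 * y52 = 0" "Sq 2 * y62 = 0"
proof -
  have "Sq 2 * (Sq 2 * x) = 0" if "Sq 1 * x = 0" for x
    using arg_cong[OF adem_small(5), of "\<lambda>a. a * x"] that by (simp add: mult.assoc)
  from this[OF Sq_1_basis(1)] this[OF Sq_1_basis(2)] this[OF Sq_1_basis(3)]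
  show "Sq 2 * y31 = 0" "Sq 2 * y52 = 0" "Sq 2 * y62 = 0" by (simp_all only: Sq2)
qed

lemma basis_table_1: "k < 8 \<Longrightarrow> Phi (sq_table p k 1) = Sq 1 * bs ! k"
  using Sq1 Sq_1_basis
  by (cases p) (elim less_8_cases; simp add: sq_table_def sq_row_def Phi_mz_simps Phi_0)

lemma basis_table_2: "k < 8 \<Longrightarrow> Phi (sq_table p k 2) = Sq 2 * bs ! k"
  using Sq2 Sq_2_basis
  by (cases p) (elim less_8_cases; simp add: sq_table_def sq_row_def Phi_mz_simps Phi_0 Phi_mt)

lemma Phi_square_1: "Phi (square_op (sq_table p) 1 v) = Sq 1 * Phi v"
proof (induction v rule: model_induct)
  case (gen k)
  show ?case
  proof (cases "k < 8")
    case True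
    then show ?thesis by (simp only: square_op_mz basis_table_1 Phi_mz if_True)
  qed (simp add: square_op_mz sq_table_ge_7 Phi_0 Phi_mz)
next
  case (tau v)
  then show ?case by (simp only: sq.square_op_1_mt Phi_add Phi_mt Phi_mr Sq_1_tau_mult)
next
  case (rho v)
  then show ?case by (simp only: square_op_mr Phi_mr Sq_rho_mult)
qed (simp_all add: square_op_zero square_op_add Phi_0 Phi_add distrib_left)

lemma Phi_square_2: "Phi (square_op (sq_table p) 2 v) = Sq 2 * Phi v"
proof (induction v rule: model_induct)
  case (gen k)
  show ?case
  proof (cases "k < 8")
    case True
    then show ?thesis by (simp only: square_op_mz basis_table_2 Phi_mz if_True)
  qed (simp add: square_op_mz sq_table_ge_7 Phi_0 Phi_mz)
next
  case (tau v)
  have "square_op (sq_table p) 2 (mt * v)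
      = mt * square_op (sq_table p) 2 v + mt * (mr * square_op (sq_table p) 1 v)"
    using square_op_mt_even[of "sq_table p" 1 v] by (simp add: mult.assoc)
  then show ?case using tau by (simp only: Phi_add Phi_mt Phi_mr Phi_square_1 Sq_2_tau_mult)
next
  case (rho v)
  then show ?case by (simp only: square_op_mr Phi_mr Sq_rho_mult)
qed (simp_all add: square_op_zero square_op_add Phi_0 Phi_add distrib_left)

text \<open>It suffices to compare on the generators of \<open>A1\<close>. For \<open>Sq 1\<close>
  and \<open>Sq 2\<close> both sides obey the same commutation rules with \<tau> and \<rho>, so
  their values on the basis decide.\<close>

lemma family_act_A1: "a \<in> A1 \<Longrightarrow> Phi (sq.act p a v) = a * Phi v"
proof (induction a arbitrary: v rule: A1.induct)
  case Sq1
  then show ?case using Phi_square_1 by (simp add: sq.act_gens)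
next
  case Sq2
  then show ?case using Phi_square_2 by (simp add: sq.act_gens)
qed (simp_all add: sq.act_gens Phi_mt Phi_mr sq.act_1 sq.act_diff_left sq.act_mult Phi_diff
    left_diff_distrib mult.assoc)

lemma add_subgroup_A1: "add_subgroup A1"
  by (simp add: add_subgroup_def A1_0 A1.diff)

lemma add_subgroup_A1_deg: "add_subgroup (A1_deg d)"
  by (simp add: add_subgroup_def A1_deg_def A1_0 A1.diff AR_deg_0 AR_deg_diff)

lemma model_act_hom: "a \<in> AR_deg d \<Longrightarrow> model_hom e v \<Longrightarrow> model_hom (d + e) (sq.act p a v)"
proof -
  assume a: "a \<in> AR_deg d" "model_hom e v"
  have "sq.act p a v \<in> {v. model_hom (d + e) v}"
  proof (rule sq.act_homogeneous[OF _ _ _ a(1)])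
    fix l d x assume x: "x \<in> {v. model_hom d v}"
    show "model_letter (square_op (sq_table p)) l x \<in> {v. model_hom (letter_deg l + d) v}"
      using x model_hom.tau[of d x] model_hom.rho[of d x] sq.model_hom_square_op[of d x]
      by (cases l) (auto simp: add.commute[of d] zdiv_int)
  qed (use a in \<open>auto intro: model_hom.zero model_hom.add\<close>)
  then show ?thesis by simp
qed

theorem family_act_structure: "family_act p \<in> A1_structures"
proof -
  have "bigraded_module UNIV A1 A1_deg (family_act p)"
  proof
    show "add_subgroup A1" by (rule add_subgroup_A1)
    fix a b :: AR and x y
    assume x: "x \<in> A1"
    then obtain v where v: "x = Phi v" using Phi_surj by blast
    show "family_act p a x \<in> A1" by (simp add: v family_act_Phi Phi_in_A1)
    show "family_act p (a + b) x = family_act p a x + family_act p b x"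
      by (simp add: v family_act_Phi sq.act_add_left Phi_add)
    show "family_act p (a * b) x = family_act p a (family_act p b x)"
      by (simp add: v family_act_Phi sq.act_mult)
    show "family_act p 1 x = x"
      by (simp add: v family_act_Phi sq.act_1)
    show "\<exists>!c. finite {d. c d \<noteq> 0} \<and> (\<forall>d. c d \<in> A1_deg d) \<and> x = (\<Sum>d\<in>{d. c d \<noteq> 0}. c d)"
      by (rule A1_direct_sum[OF x])
    assume "y \<in> A1"
    then obtain w where w: "y = Phi w" using Phi_surj by blast
    show "family_act p a (x + y) = family_act p a x + family_act p a y"
      unfolding v w Phi_add[symmetric] family_act_Phi by (simp add: sq.act_add_right Phi_add)
  next
    fix d show "add_subgroup (A1_deg d)" by (rule add_subgroup_A1_deg)
    show "A1_deg d \<subseteq> A1" by (simp add: A1_deg_def)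
  next
    fix a d x e assume a: "a \<in> UNIV \<inter> AR_deg d" and x: "x \<in> A1_deg e"
    obtain v where "model_hom e v" "x = Phi v" using A1_degE[OF x] .
    then show "family_act p a x \<in> A1_deg (d + e)"
      using a by (simp add: family_act_Phi Phi_hom model_act_hom)
  qed
  moreover have "family_act p a x = a * x" if a: "a \<in> A1" and x: "x \<in> A1" for a x
  proof -
    obtain v where "x = Phi v" using Phi_surj[OF x] .
    then show ?thesis by (simp add: family_act_A1[OF a] family_act_Phi)
  qed
  ultimately show ?thesis by (simp add: A1_structures_def)
qed

lemma family_act_basis: "k < 8 \<Longrightarrow> family_act p (Sq n) (bs ! k) = Phi (sq_table p k (int n))"
  using family_act_Phi[of p "Sq n" "mz k"] by (simp add: Phi_mz sq.act_gens square_op_mz)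

theorem family_act_formulas: "Sq_formulas x00 x10 x21 x31 y31 y41 y52 y62 p (family_act p)"
proof -
  obtain \<alpha>03 \<beta>03 \<beta>14 \<beta>06 \<beta>25 \<beta>26 \<gamma>36 where p: "p = (\<alpha>03, \<beta>03, \<beta>14, \<beta>06, \<beta>25, \<beta>26, \<gamma>36)"
    by (cases p)
  show ?thesis
    using family_act_basis[of 0 p 4] family_act_basis[of 1 p 4] family_act_basis[of 2 p 4]
      family_act_basis[of 3 p 4] family_act_basis[of 4 p 4] family_act_basis[of 0 p 8]
    by (simp add: p Sq_formulas_def j24_def sq_table_def sq_row_def distrib_right Phi_add Phi_mbit Phi_mt Phi_mr
        Phi_mz_simps bit_AR_add bit_AR_mult bit_AR_simps power2_eq_square mult.assoc distrib_left
        del: add_bit_eq_xor mult_bit_eq_and)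
qed

end

section \<open>Isomorphisms\<close>

lemma add_subgroup_add: "add_subgroup X \<Longrightarrow> x \<in> X \<Longrightarrow> y \<in> X \<Longrightarrow> x + y \<in> X"
  unfolding add_subgroup_def by (metis diff_0 diff_minus_eq_add)

lemma bigraded_isomorphic_refl: "bigraded_isomorphic R M G act M G act"
  unfolding bigraded_isomorphic_def by (rule exI[of _ id]) simp

lemma bigraded_isomorphic_sym:
  assumes "bigraded_module R M G act" "bigraded_isomorphic R M G act N H act'"
  shows "bigraded_isomorphic R N H act' M G act"
proof -
  interpret bigraded_module R M G act by fact
  obtain f where f: "bij_betw f M N" "\<forall>x\<in>M. \<forall>y\<in>M. f (x + y) = f x + f y"
    "\<forall>a\<in>R. \<forall>x\<in>M. f (act a x) = act' a (f x)" "\<forall>d. f ` G d = H d"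
    using assms(2) unfolding bigraded_isomorphic_def by blast
  define g where "g = inv_into M f"
  have gf: "g (f x) = x" if "x \<in> M" for x
    unfolding g_def using f(1) that by (simp add: bij_betw_inv_into_left)
  have N: "\<exists>x'\<in>M. x = f x'" if "x \<in> N" for x
    using f(1) that by (auto simp: bij_betw_def)
  have "bij_betw g N M" unfolding g_def using f(1) by (rule bij_betw_inv_into)
  moreover have "\<forall>x\<in>N. \<forall>y\<in>N. g (x + y) = g x + g y"
  proof (intro ballI)
    fix x y assume "x \<in> N" "y \<in> N"
    then obtain x' y' where "x' \<in> M" "y' \<in> M" "x = f x'" "y = f y'" using N by blast
    then show "g (x + y) = g x + g y"
      using f(2) gf[of "x' + y'"] gf[of x'] gf[of y'] add_subgroup_add[OF subgroup] by simp
  qed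
  moreover have "\<forall>a\<in>R. \<forall>x\<in>N. g (act' a x) = act a (g x)"
  proof (intro ballI)
    fix a x assume "a \<in> R" "x \<in> N"
    then obtain x' where x': "x' \<in> M" "x = f x'" using N by blast
    then have "act' a x = f (act a x')" using f(3) \<open>a \<in> R\<close> by simp
    then show "g (act' a x) = act a (g x)"
      using x' gf act_closed[OF \<open>a \<in> R\<close>] by simp
  qed
  moreover have "\<forall>d. g ` H d = G d"
  proof
    fix d
    have "g ` H d = (\<lambda>x. g (f x)) ` G d" using f(4) by (metis image_image)
    also have "\<dots> = G d" using G_subset[of d] gf by force
    finally show "g ` H d = G d" .
  qed
  ultimately show ?thesis unfolding bigraded_isomorphic_def by blast
qed

lemma bigraded_isomorphic_trans:
  assumes "bigraded_isomorphic R M G act N H act'" "bigraded_isomorphic R N H act' P K act''"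
  shows "bigraded_isomorphic R M G act P K act''"
proof -
  obtain f where f: "bij_betw f M N" "\<forall>x\<in>M. \<forall>y\<in>M. f (x + y) = f x + f y"
    "\<forall>a\<in>R. \<forall>x\<in>M. f (act a x) = act' a (f x)" "\<forall>d. f ` G d = H d"
    using assms(1) unfolding bigraded_isomorphic_def by blast
  obtain g where g: "bij_betw g N P" "\<forall>x\<in>N. \<forall>y\<in>N. g (x + y) = g x + g y"
    "\<forall>a\<in>R. \<forall>x\<in>N. g (act' a x) = act'' a (g x)" "\<forall>d. g ` H d = K d"
    using assms(2) unfolding bigraded_isomorphic_def by blast
  have fN: "f x \<in> N" if "x \<in> M" for x using f(1) that by (auto simp: bij_betw_def)
  show ?thesis unfolding bigraded_isomorphic_def
  proof (intro exI[of _ "g \<circ> f"] conjI)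
    show "bij_betw (g \<circ> f) M P" using f(1) g(1) by (rule bij_betw_trans)
    show "\<forall>d. (g \<circ> f) ` G d = K d"
      by (simp only: image_comp[symmetric] f(4)[rule_format] g(4)[rule_format] simp_thms)
  qed (use f(2,3) g(2,3) fN in auto)
qed

lemma equiv_A1_structure_iso: "equiv A1_structures A1_structure_iso"
proof (rule equivI)
  show "A1_structure_iso \<subseteq> A1_structures \<times> A1_structures"
    by (auto simp: A1_structure_iso_def)
  show "refl_on A1_structures A1_structure_iso"
    by (auto simp: refl_on_def A1_structure_iso_def bigraded_isomorphic_refl)
  show "sym A1_structure_iso"
    by (rule symI) (auto simp: A1_structure_iso_def A1_structures_def intro: bigraded_isomorphic_sym)
  show "trans A1_structure_iso"
    by (rule transI) (auto simp: A1_structure_iso_def intro: bigraded_isomorphic_trans)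
qed

lemma sum_lessThan_8: "(\<Sum>k<(8::nat). f k) = f 0 + f 1 + f 2 + f 3 + f 4 + f 5 + f 6 + f 7"
  by (simp add: eval_nat_numeral)

section \<open>Classification\<close>

locale A1_structure = A1_basis +
  fixes act :: "AR \<Rightarrow> AR \<Rightarrow> AR"
  assumes in_structures: "act \<in> A1_structures"
begin

sublocale bigraded_module UNIV A1 A1_deg act
  using in_structures by (simp add: A1_structures_def)

lemma act_A1: "a \<in> A1 \<Longrightarrow> x \<in> A1 \<Longrightarrow> act a x = a * x"
  using in_structures by (simp add: A1_structures_def)

lemma act_add: "x \<in> A1 \<Longrightarrow> y \<in> A1 \<Longrightarrow> act a (x + y) = act a x + act a y"
  using act_add_right[of a x y] by simp

lemma act_add_l: "x \<in> A1 \<Longrightarrow> act (a + b) x = act a x + act b x"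
  using act_add_left[of a b x] by simp

lemma act_times: "x \<in> A1 \<Longrightarrow> act (a * b) x = act a (act b x)"
  using act_mult[of a b x] by simp

lemma act_in: "x \<in> A1 \<Longrightarrow> act a x \<in> A1"
  using act_closed[of a x] by simp

lemma act_0: "act a 0 = 0"
  using act_add[OF A1_0 A1_0, of a] by simp

lemma act_A1_times: "a \<in> A1 \<Longrightarrow> x \<in> A1 \<Longrightarrow> act (a * b) x = a * act b x"
  by (simp add: act_times act_A1 act_in)

lemma act_times_A1: "b \<in> A1 \<Longrightarrow> x \<in> A1 \<Longrightarrow> act a (b * x) = act (a * b) x"
  by (simp add: act_times act_A1)

lemma act_bit: "x \<in> A1 \<Longrightarrow> act a (bit_AR b * x) = bit_AR b * act a x"
  by (cases b) (simp_all add: bit_AR_simps act_0)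

lemma act_Sq_rho: "x \<in> A1 \<Longrightarrow> act (Sq n) (rho * x) = rho * act (Sq n) x"
  by (simp add: act_times_A1 A1.rho AR_relations(3) act_A1_times)

lemma act_Sq_1_tau: "x \<in> A1 \<Longrightarrow> act (Sq 1) (tau * x) = tau * act (Sq 1) x + rho * x"
  by (simp only: act_times_A1 A1.tau AR_relations(4) act_add_l act_A1_times) (simp add: act_A1 A1.rho)

lemma act_Sq_even_tau: "x \<in> A1 \<Longrightarrow> act (Sq (2 * k + 2)) (tau * x)
    = tau * act (Sq (2 * k + 2)) x + tau * (rho * act (Sq (2 * k + 1)) x)"
  by (simp only: act_times_A1 A1.tau AR_relations(5) act_add_l mult.assoc act_A1_times A1.rho)

lemma act_Sq_odd_tau: "x \<in> A1 \<Longrightarrow> act (Sq (2 * k + 3)) (tau * x)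
    = tau * act (Sq (2 * k + 3)) x + rho * act (Sq (2 * k + 2)) x + rho * (rho * act (Sq (2 * k + 1)) x)"
  by (simp only: act_times_A1 A1.tau AR_relations(6) act_add_l mult.assoc act_A1_times A1.rho power2_eq_square)

lemma act_Sq_basis_deg: "k < 8 \<Longrightarrow> act (Sq n) (bs ! k) \<in> A1_deg ((int n, int (n div 2)) + mz_deg k)"
  by (rule act_deg) (simp_all only: AR_deg_gens A1_deg_basis Int_iff UNIV_I simp_thms)

lemma act_Sq_basis_eq_0:
  assumes "k < 8" "int n - int (n div 2) + (fst (mz_deg k) - snd (mz_deg k)) > 4"
  shows "act (Sq n) (bs ! k) = 0"
  by (rule A1_deg_eq_0[OF act_Sq_basis_deg[OF assms(1)]]) (use assms(2) in simp)

text \<open>The relation for \<open>Sq 2 * Sq 4\<close> solved for \<open>Sq 6\<close>, with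
  \<open>Sq 5\<close> replaced by \<open>Sq 1 * Sq 4\<close>: in every structure \<open>Sq 6\<close>
  is determined by \<open>Sq 4\<close>.\<close>

lemma Sq_6: "Sq 6 = Sq 2 * Sq 4 + tau * (Sq 1 * (Sq 4 * Sq 1))"
  using adem_small(7) by (simp add: AR_add_cancel adem_small(3)[symmetric] mult.assoc add.assoc AR_add_self)

end

context A1_basis
begin

text \<open>By the bound on degree minus weight, \<open>Sq 4\<close> vanishes on \<open>y41\<close>,
  \<open>y52\<close> and \<open>y62\<close>, and \<open>Sq 8\<close> on every basis element except
  possibly \<open>x00\<close>; the listed hypotheses cover what remains.\<close>

lemma A1_structure_unique:
  assumes "A1_structure x00 x10 x21 x31 y31 y41 y52 y62 act"
    and "A1_structure x00 x10 x21 x31 y31 y41 y52 y62 act'"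
    and Sq4: "\<And>k. k < 5 \<Longrightarrow> act (Sq 4) (bs ! k) = act' (Sq 4) (bs ! k)"
    and Sq8: "act (Sq 8) x00 = act' (Sq 8) x00"
    and "x \<in> A1"
  shows "act a x = act' a x"
proof -
  interpret m: A1_structure x00 x10 x21 x31 y31 y41 y52 y62 act by fact
  interpret m': A1_structure x00 x10 x21 x31 y31 y41 y52 y62 act' by fact
  define agree where "agree n \<longleftrightarrow> (\<forall>x\<in>A1. act (Sq n) x = act' (Sq n) x)" for n
  have A1: "agree n" if "Sq n \<in> A1" for n
    using that by (simp add: agree_def m.act_A1 m'.act_A1)
  \<comment> \<open>Moving \<tau> past \<open>Sq n\<close> brings in only \<open>Sq (n - 1)\<close>
    and \<open>Sq (n - 2)\<close>, so agreement on the basis spreads to \<open>A1\<close> by strong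
    induction on \<open>n\<close>.\<close>
  have step: "agree n"
    if b: "\<And>k. k < 8 \<Longrightarrow> act (Sq n) (bs ! k) = act' (Sq n) (bs ! k)"
      and prev: "\<And>m. m < n \<Longrightarrow> agree m" for n
    unfolding agree_def
  proof
    fix x assume "x \<in> A1"
    then show "act (Sq n) x = act' (Sq n) x"
    proof (induction x rule: A1_induct)
      case (tau x)
      consider "n = 0" | "n = 1" | k where "n = 2 * k + 2" | k where "n = 2 * k + 3"
      proof -
        have "n = 0 \<or> n = 1 \<or> (\<exists>k. n = 2 * k + 2) \<or> (\<exists>k. n = 2 * k + 3)" by presburger
        then show ?thesis using that by blast
      qed
      then show ?case
      proof cases
        case 1
        then show ?thesis using A1[of 0] tau(1)
          by (simp add: agree_def AR_relations(1) A1.one A1.mult A1.tau)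
      next
        case 2
        then show ?thesis using tau by (simp only: m.act_Sq_1_tau m'.act_Sq_1_tau)
      next
        case (3 k)
        then have "agree (2 * k + 1)" using prev by simp
        then show ?thesis using tau 3
          by (simp only: m.act_Sq_even_tau m'.act_Sq_even_tau agree_def)
      next
        case (4 k)
        then have "agree (2 * k + 1)" "agree (2 * k + 2)" using prev by simp_all
        then show ?thesis using tau 4
          by (simp only: m.act_Sq_odd_tau m'.act_Sq_odd_tau agree_def)
      qed
    qed (simp_all only: m.act_0 m'.act_0 m.act_add m'.act_add m.act_Sq_rho m'.act_Sq_rho b)
  qed
  have small: "n = 0 \<or> n = 1 \<or> n = 2 \<or> n = 3 \<or> n = 4 \<or> n = 5 \<or> n = 6 \<or> n = 7 \<or> n = 8 \<or> 8 < n" for n :: nat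
    by linarith
  have 0: "agree 0" by (rule A1) (simp add: AR_relations(1) A1.one)
  have 1: "agree 1" "agree 2" "agree 3" by (intro A1 A1.Sq1 A1.Sq2 A1_Sq3)+
  have 4: "agree 4"
  proof (rule step)
    fix k :: nat assume "k < 8"
    then show "act (Sq 4) (bs ! k) = act' (Sq 4) (bs ! k)"
    proof (cases "k < 5")
      case False
      then have "k = 5 \<or> k = 6 \<or> k = 7" using \<open>k < 8\<close> by linarith
      then have "int 4 - int (4 div 2) + (fst (mz_deg k) - snd (mz_deg k)) > 4"
        by (elim disjE) (simp_all add: mz_deg_simps)
      then show ?thesis
        using m.act_Sq_basis_eq_0[OF \<open>k < 8\<close>, of 4] m'.act_Sq_basis_eq_0[OF \<open>k < 8\<close>, of 4] by (simp only:)
    qed (rule Sq4)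
  next
    fix m :: nat assume "m < 4"
    then have "m = 0 \<or> m = 1 \<or> m = 2 \<or> m = 3" by linarith
    then show "agree m" using 0 1 by blast
  qed
  have Sq_1: "agree n" if "agree m" "Sq 1 * Sq m = Sq n" for m n
    unfolding agree_def that(2)[symmetric]
  proof
    fix x assume x: "x \<in> A1"
    then have "act (Sq m) x = act' (Sq m) x" using that(1) by (simp add: agree_def)
    then show "act (Sq 1 * Sq m) x = act' (Sq 1 * Sq m) x"
      by (simp only: m.act_A1_times m'.act_A1_times A1.Sq1 x)
  qed
  have 5: "agree 5" using 4 adem_small(3) by (rule Sq_1)
  have 6: "agree 6"
    unfolding agree_def m.Sq_6
  proof
    fix x assume x: "x \<in> A1"
    have eq: "act (Sq 4) x = act' (Sq 4) x" "act (Sq 4) (Sq 1 * x) = act' (Sq 4) (Sq 1 * x)"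
      using 4 x A1.mult[OF A1.Sq1 x] by (simp_all only: agree_def)
    show "act (Sq 2 * Sq 4 + tau * (Sq 1 * (Sq 4 * Sq 1))) x = act' (Sq 2 * Sq 4 + tau * (Sq 1 * (Sq 4 * Sq 1))) x"
      by (simp only: m.act_add_l m'.act_add_l m.act_A1_times m'.act_A1_times A1.Sq1 A1.Sq2 A1.tau x
          m.act_times_A1[symmetric] m'.act_times_A1[symmetric] eq)
  qed
  have 7: "agree 7" using 6 adem_small(4) by (rule Sq_1)
  have large: "agree n" if "8 \<le> n" "\<And>m. m < n \<Longrightarrow> agree m" for n
  proof (rule step)
    fix k :: nat assume k: "k < 8"
    show "act (Sq n) (bs ! k) = act' (Sq n) (bs ! k)"
    proof (cases "n = 8 \<and> k = 0")
      case True
      then show ?thesis using Sq8 by simp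
    next
      case False
      have *: "int n - int (n div 2) + (fst (mz_deg k) - snd (mz_deg k)) > 4"
      proof (cases "n = 8")
        case True
        with False k show ?thesis by (elim less_8_cases) (simp_all add: mz_deg_simps)
      next
        case False
        then have "int n - int (n div 2) > 4" using that(1) by presburger
        then show ?thesis using mz_deg_bounds(1)[of k] by linarith
      qed
      show ?thesis
        using m.act_Sq_basis_eq_0[OF k *] m'.act_Sq_basis_eq_0[OF k *] by (simp only:)
    qed
  qed (rule that(2))
  have all: "agree n" for n :: nat
  proof (induction n rule: less_induct)
    case (less n)
    then show ?case using small[of n] 0 1 4 5 6 7 large[of n] by (elim disjE) simp_all
  qed
  have "\<forall>x\<in>A1. act a x = act' a x"
  proof (induction a rule: AR_induct)
    case (diff a b)
    then show ?case by (simp add: AR_diff m.act_add_l m'.act_add_l)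
  next
    case (mult a b)
    then show ?case by (simp add: m.act_times m'.act_times m'.act_in)
  next
    case (Sq n)
    then show ?case using all[of n] by (simp add: agree_def)
  qed (simp_all add: m.act_A1 m'.act_A1 A1.one A1.tau A1.rho)
  then show ?thesis using \<open>x \<in> A1\<close> by blast
qed

text \<open>Allows coefficients to be compared in the relation for \<open>Sq 4 * Sq 4\<close>, both
  sides of which are multiples of this one element.\<close>

lemma rho_rho_y62_inj:
  assumes "bit_AR p * (rho * (rho * y62)) = bit_AR q * (rho * (rho * y62))"
  shows "p = q"
proof -
  have "Phi (mbit p * (mr * (mr * mz 7))) = Phi (mbit q * (mr * (mr * mz 7)))"
    using assms by (simp add: Phi_mbit Phi_mr Phi_mz_simps)
  from Phi_inj[OF this, of 7] have "coeff (mbit p * (mr * (mr * mz 7))) 7 = coeff (mbit q * (mr * (mr * mz 7))) 7"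
    by simp
  then have "coeff (coeff (coeff (mbit p * (mr * (mr * mz 7))) 7) 0) 2
      = coeff (coeff (coeff (mbit q * (mr * (mr * mz 7))) 7) 0) 2" by simp
  then show ?thesis
    by (cases p; cases q; simp add: mbit_def mr_def mz_def coeff_monom numeral_2_eq_2)
qed

end

context A1_structure
begin

lemma basis_in_A1: "x00 \<in> A1" "x10 \<in> A1" "x21 \<in> A1" "x31 \<in> A1" "y31 \<in> A1" "y41 \<in> A1" "y52 \<in> A1" "y62 \<in> A1"
  using basis by (auto simp: M2_basis_of_A1_def)

lemma act_Sq_coords:
  assumes "k < 8"
  shows "\<exists>\<beta> :: nat \<Rightarrow> bit. act (Sq n) (bs ! k) =
    (\<Sum>l<8. let j = int n + fst (mz_deg k) - fst (mz_deg l); i = int (n div 2) + snd (mz_deg k) - snd (mz_deg l) - j in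
      if 0 \<le> i \<and> 0 \<le> j then bit_AR (\<beta> l) * tau ^ nat i * rho ^ nat j * bs ! l else 0)"
proof -
  have deg: "(int n, int (n div 2)) + mz_deg k = (int n + fst (mz_deg k), int (n div 2) + snd (mz_deg k))"
    by (simp add: prod_eq_iff)
  show ?thesis by (rule A1_deg_coords[OF act_Sq_basis_deg[OF assms, of n, unfolded deg]])
qed

lemmas coords_simps = sum_lessThan_8 Let_def mz_deg_simps power2_eq_square mult.assoc

theorem structure_formulas: "\<exists>v. Sq_formulas x00 x10 x21 x31 y31 y41 y52 y62 v act"
proof -
  obtain b :: "nat \<Rightarrow> bit" where x00: "act (Sq 4) x00 = bit_AR (b 3) * (rho * x31) + bit_AR (b 4) * (rho * y31) + bit_AR (b 5) * (tau * y41)"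
    using act_Sq_coords[of 0 4] by (auto simp: coords_simps)
  obtain d :: "nat \<Rightarrow> bit" where x21: "act (Sq 4) x21 = bit_AR (d 5) * (rho * (rho * y41)) + bit_AR (d 6) * (rho * y52) + bit_AR (d 7) * (tau * y62)"
    using act_Sq_coords[of 2 4] by (auto simp: coords_simps)
  obtain e :: "nat \<Rightarrow> bit" where y31: "act (Sq 4) y31 = bit_AR (e 7) * (rho * y62)"
    using act_Sq_coords[of 4 4] by (auto simp: coords_simps)
  obtain h :: "nat \<Rightarrow> bit" where Sq8: "act (Sq 8) x00 = bit_AR (h 7) * (rho * (rho * y62))"
    using act_Sq_coords[of 0 8] by (auto simp: coords_simps)
  note A1s = basis_in_A1 A1.mult A1.tau A1.rho A1_bit_AR A1_add A1.Sq1 A1.Sq2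
  have Sq_1_rho: "Sq 1 * (rho * x) = rho * (Sq 1 * x)" and Sq_2_rho: "Sq 2 * (rho * x) = rho * (Sq 2 * x)" for x
    by (rule Sq_rho_mult)+
  have Sq_bit: "Sq n * (bit_AR c * x) = bit_AR c * (Sq n * x)" for n c x
    by (cases c) (simp_all add: bit_AR_simps)
  have rho_bit: "rho * (bit_AR c * x) = bit_AR c * (rho * x)" for c x
    by (cases c) (simp_all add: bit_AR_simps)
  note eval = distrib_left Sq_1_rho Sq_2_rho Sq_bit Sq_1_tau_mult Sq_2_tau_mult Sq1 Sq2 Sq_1_basis Sq_2_basis
  \<comment> \<open>The relation for \<open>Sq 2 * Sq 3\<close>, solved for
    \<open>Sq 4 * Sq 1\<close>, gives \<open>Sq 4\<close> on the image of
    \<open>Sq 1\<close>.\<close>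
  have Sq41: "act (Sq 4) (Sq 1 * x) = Sq 2 * (Sq 1 * (Sq 2 * x)) + Sq 1 * act (Sq 4) x + rho * (Sq 1 * (Sq 2 * (Sq 1 * x)))"
    if x: "x \<in> A1" for x
  proof -
    have "Sq 4 * Sq 1 = Sq 2 * (Sq 1 * Sq 2) + Sq 1 * Sq 4 + rho * (Sq 1 * (Sq 2 * Sq 1))"
      using adem_small(6) unfolding adem_small(2,3)[symmetric]
      by (simp add: mult.assoc AR_add_cancel AR_add_self add.assoc)
        (simp add: AR_add_cancel AR_add_self ac_simps)
    then have "act (Sq 4) (Sq 1 * x) = act (Sq 2 * (Sq 1 * Sq 2) + Sq 1 * Sq 4 + rho * (Sq 1 * (Sq 2 * Sq 1))) x"
      using x by (simp only: act_times_A1 A1.Sq1)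
    also have "\<dots> = Sq 2 * (Sq 1 * (Sq 2 * x)) + Sq 1 * act (Sq 4) x + rho * (Sq 1 * (Sq 2 * (Sq 1 * x)))"
      using x by (simp only: act_add_l act_A1_times A1s act_A1 mult.assoc)
    finally show ?thesis .
  qed
  \<comment> \<open>The coefficient \<open>b 4 + b 5 + 1\<close> becomes \<open>\<beta>14\<close>.
    The 1 in it comes from \<open>rho * (Sq 1 * (Sq 2 * (Sq 1 * x00)))\<close>, which is
    \<open>rho * y41\<close>.\<close>
  have x10: "act (Sq 4) x10 = y52 + bit_AR (b 4 + b 5 + 1) * (rho * y41)"
    using Sq41[OF basis_in_A1(1)] unfolding x00
    by (simp only: eval mult_zero_right add_0_right add_0_left bit_AR_add bit_AR_simps distrib_right mult_1_left)
      (simp add: ac_simps)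
  \<comment> \<open>The first and last terms of \<open>Sq41\<close> are both
    \<open>rho * y62\<close> here and cancel, so no 1 appears.\<close>
  have x31: "act (Sq 4) x31 = bit_AR (d 6 + d 7) * (rho * y62)"
    using Sq41[OF basis_in_A1(3)] unfolding x21
    by (simp only: eval mult_zero_right add_0_right add_0_left bit_AR_add bit_AR_simps distrib_right)
      (simp add: ac_simps AR_add_cancel AR_add_self)
  have j: "d 5 = b 4 * e 7 + b 3 * (d 6 + d 7)"
  proof -
    have y41: "act (Sq 4) y41 = 0"
      using act_Sq_basis_eq_0[of 5 4] by (simp add: mz_deg_simps)
    have "act (Sq 3) y41 = 0"
      using act_A1[OF A1_Sq3 basis_in_A1(6)] unfolding adem_small(2)[symmetric] mult.assoc eval by simp
    \<comment> \<open>The summand \<open>tau * y41\<close> of \<open>Sq 4\<close> on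
      \<open>x00\<close> contributes nothing: \<open>Sq 4\<close> on \<open>y41\<close> vanishes by
      degree, and \<open>Sq 3\<close> on \<open>y41\<close> is
      \<open>Sq 1 * y62 = 0\<close>.\<close>
    then have ty41: "act (Sq 4) (tau * y41) = 0"
      using act_Sq_even_tau[OF basis_in_A1(6), of 1] y41 by (simp add: numeral_eq_Suc)
    have L: "act (Sq 4 * Sq 4) x00 = bit_AR (b 4 * e 7 + b 3 * (d 6 + d 7)) * (rho * (rho * y62))"
    proof -
      have "act (Sq 4 * Sq 4) x00 = bit_AR (b 3) * (rho * act (Sq 4) x31) + bit_AR (b 4) * (rho * act (Sq 4) y31)"
        by (simp only: act_times A1s x00 act_add act_bit act_Sq_rho ty41) simp
      then show ?thesis unfolding x31 y31
        by (simp only: bit_AR_add bit_AR_mult distrib_right distrib_left mult.assoc rho_bit ac_simps)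
    qed
    have x21_6: "act (Sq 6) x21 = bit_AR (d 5) * (rho * (rho * y62))"
    proof -
      have "act (Sq 6) x21 = Sq 2 * act (Sq 4) x21 + tau * (Sq 1 * act (Sq 4) x31)"
        unfolding Sq_6 by (simp only: act_add_l act_A1_times A1s) (simp only: act_times A1s act_A1 Sq1)
      then show ?thesis unfolding x21 x31
        by (simp only: eval mult_zero_right add_0_right add_0_left)
    qed
    have x10_7: "act (Sq 7) x10 = 0"
      using act_Sq_basis_eq_0[of 1 7] by (simp add: mz_deg_simps)
    have "act (Sq 4 * Sq 4) x00 = bit_AR (d 5) * (rho * (rho * y62))"
      unfolding adem_small(8) mult.assoc
      by (simp only: act_add_l act_A1_times A1s) (simp only: act_times A1s act_A1 Sq1 Sq2 x10_7 x21_6 mult_zero_right add_0_left)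
    with L show ?thesis using rho_rho_y62_inj by metis
  qed
  \<comment> \<open>With \<open>\<beta>03 = b 4\<close> and
    \<open>\<beta>14 = b 4 + b 5 + 1\<close>, the prescribed coefficient
    \<open>1 + \<beta>03 + \<beta>14\<close> is \<open>b 5\<close> again.\<close>
  have b5: "1 + b 4 + (b 4 + b 5 + 1) = b 5" by (cases "b 4"; cases "b 5") simp_all
  show ?thesis
  proof (intro exI[of _ "(b 3, b 4, b 4 + b 5 + 1, h 7, d 6, d 7, e 7)"])
    show "Sq_formulas x00 x10 x21 x31 y31 y41 y52 y62 (b 3, b 4, b 4 + b 5 + 1, h 7, d 6, d 7, e 7) act"
      unfolding Sq_formulas_def j24_def prod.case b5 j[symmetric] x00 x10 x21 x31 y31 Sq8 power2_eq_square mult.assoc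
      by (simp only: ac_simps simp_thms)
  qed
qed

end

section \<open>Transport of structure\<close>

context A1_basis
begin

text \<open>The bijection \<open>\<lambda>a. act a g\<close> is additive and compatible with left
  multiplication, so the structure can be pulled back along it; only the matching of the gradings
  needs an argument.\<close>

lemma A1_free_transport:
  fixes M :: "'m::ab_group_add set"
  assumes module: "bigraded_module UNIV M G act" and free: "A1_free_rank_one M G act"
  shows "\<exists>act'\<in>A1_structures. bigraded_isomorphic UNIV M G act A1 A1_deg act'"
proof -
  interpret bigraded_module UNIV M G act by fact
  obtain g where g: "g \<in> G (0, 0)" and bij: "bij_betw (\<lambda>a. act a g) A1 M"
    using free by (auto simp: A1_free_rank_one_def)
  define f where "f a = act a g" for a
  define h where "h = inv_into A1 f"
  have bij: "bij_betw f A1 M" using bij by (simp add: f_def[abs_def])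
  have gM: "g \<in> M" using g G_subset by blast
  have fM: "f a \<in> M" for a using act_closed[of a g] gM by (simp add: f_def)
  have f_add: "f (a + b) = f a + f b" for a b using act_add_left[of a b g] gM by (simp add: f_def)
  have f_0: "f 0 = 0" using f_add[of 0 0] by simp
  have f_sum: "f (sum k X) = (\<Sum>x\<in>X. f (k x))" for k and X :: "(int \<times> int) set"
    by (induction X rule: infinite_finite_induct) (simp_all add: f_0 f_add)
  have f_mult: "f (a * b) = act a (f b)" for a b using act_mult[of a b g] gM by (simp add: f_def)
  have f_inj: "a = b" if "f a = f b" "a \<in> A1" "b \<in> A1" for a b
    using that bij by (auto simp: bij_betw_def dest: inj_onD)
  have hf: "h (f a) = a" if "a \<in> A1" for a
    unfolding h_def using bij that by (simp add: bij_betw_inv_into_left)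
  have fh: "f (h x) = x" if "x \<in> M" for x
    unfolding h_def using bij that by (simp add: bij_betw_inv_into_right)
  have hA1: "h x \<in> A1" if "x \<in> M" for x
    unfolding h_def using bij_betwE[OF bij_betw_inv_into[OF bij]] that by blast
  have h_add: "h (x + y) = h x + h y" if "x \<in> M" "y \<in> M" for x y
    using hf[OF A1_add[OF hA1[OF that(1)] hA1[OF that(2)]]] that by (simp add: f_add fh)
  have f_deg: "f a \<in> G d" if "a \<in> A1_deg d" for a d
    using act_deg[of a d g "(0, 0)"] that g by (simp add: A1_deg_def f_def zero_prod_def[symmetric])
  \<comment> \<open>The element \<open>f a\<close> has two homogeneous decompositions in
    \<open>M\<close>, one concentrated in \<open>d\<close> and one consisting of the images of the
    components of \<open>a\<close>. They coincide by uniqueness, and injectivity of \<open>f\<close>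
    puts \<open>a\<close> in bidegree \<open>d\<close>.\<close>
  have deg_f: "a \<in> A1_deg d" if a: "a \<in> A1" "f a \<in> G d" for a d
  proof -
    let ?P = "\<lambda>c. finite {e. c e \<noteq> 0} \<and> (\<forall>e. c e \<in> G e) \<and> f a = (\<Sum>e\<in>{e. c e \<noteq> 0}. c e)"
    let ?c = "\<lambda>e. if e = d then f a else 0"
    have G0: "0 \<in> G e" for e using G_subgroup[of e] by (simp add: add_subgroup_def)
    have c: "?P ?c"
    proof (cases "f a = 0")
      case False
      then have "{e. ?c e \<noteq> 0} = {d}" by auto
      then show ?thesis using a(2) G0 by simp
    qed (use G0 in simp)
    have supp: "{e. f (component e a) \<noteq> 0} = {e. component e a \<noteq> 0}"
    proof -
      have "f (component e a) = 0 \<longleftrightarrow> component e a = 0" for e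
        using f_inj[of "component e a" 0] component_in_A1_deg[OF a(1), of e] f_0 A1_0
        by (auto simp: A1_deg_def)
      then show ?thesis by simp
    qed
    have P: "?P (\<lambda>e. f (component e a))"
      unfolding supp f_sum[symmetric] using A1_component_sum[OF a(1)] f_deg component_in_A1_deg[OF a(1)]
      by simp
    have "?c = (\<lambda>e. f (component e a))"
    proof (rule ex1E[OF direct_sum[OF fM[of a]]])
      fix c0 assume "\<forall>c. ?P c \<longrightarrow> c = c0"
      from this[THEN spec, THEN mp, OF c] this[THEN spec, THEN mp, OF P] show ?thesis by (simp only:)
    qed
    from fun_cong[OF this, of d] have "f (component d a) = f a" by simp
    then have "component d a = a"
      using f_inj a(1) component_in_A1_deg[OF a(1), of d] by (simp add: A1_deg_def)
    then show ?thesis using component_in_A1_deg[OF a(1), of d] by simp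
  qed
  have h_deg: "h x \<in> A1_deg d" if "x \<in> G d" for x d
    using that G_subset[of d] by (intro deg_f) (auto simp: hA1 fh subset_iff)
  define act' where "act' a x = h (act a (f x))" for a x
  have f_act': "f (act' a x) = act a (f x)" for a x
    unfolding act'_def by (rule fh) (use act_closed[of a "f x"] fM in simp)
  have act'_A1: "act' a x \<in> A1" for a x
    unfolding act'_def by (rule hA1) (use act_closed[of a "f x"] fM in simp)
  have "bigraded_module UNIV A1 A1_deg act'"
  proof
    show "add_subgroup A1" by (rule add_subgroup_A1)
    fix a b :: AR and x y
    assume x: "x \<in> A1"
    show "act' a x \<in> A1" by (rule act'_A1)
    show "act' (a + b) x = act' a x + act' b x"
      by (rule f_inj) (simp_all add: f_add f_act' act'_A1 A1_add act_add_left fM)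
    show "act' (a * b) x = act' a (act' b x)"
      by (rule f_inj) (simp_all add: f_act' act'_A1 act_mult fM)
    show "act' 1 x = x"
      by (rule f_inj) (simp_all add: f_act' act'_A1 act_one fM x)
    show "\<exists>!c. finite {d. c d \<noteq> 0} \<and> (\<forall>d. c d \<in> A1_deg d) \<and> x = (\<Sum>d\<in>{d. c d \<noteq> 0}. c d)"
      by (rule A1_direct_sum[OF x])
    assume y: "y \<in> A1"
    show "act' a (x + y) = act' a x + act' a y"
      by (rule f_inj) (simp_all add: f_add f_act' act'_A1 A1_add act_add_right fM)
  next
    fix d show "add_subgroup (A1_deg d)" by (rule add_subgroup_A1_deg)
    show "A1_deg d \<subseteq> A1" by (simp add: A1_deg_def)
  next
    fix a d x e assume a: "a \<in> UNIV \<inter> AR_deg d" and x: "x \<in> A1_deg e"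
    then have "act a (f x) \<in> G (d + e)" using act_deg f_deg by blast
    then show "act' a x \<in> A1_deg (d + e)" unfolding act'_def by (rule h_deg)
  qed
  moreover have "act' a x = a * x" if "a \<in> A1" "x \<in> A1" for a x
    by (rule f_inj) (simp_all add: f_act' f_mult act'_A1 A1.mult that)
  ultimately have "act' \<in> A1_structures" by (simp add: A1_structures_def)
  moreover have "bigraded_isomorphic UNIV M G act A1 A1_deg act'"
    unfolding bigraded_isomorphic_def
  proof (intro exI[of _ h] conjI ballI allI)
    show "bij_betw h M A1" unfolding h_def using bij by (rule bij_betw_inv_into)
    show "h ` G d = A1_deg d" for d
    proof
      show "h ` G d \<subseteq> A1_deg d" using h_deg by blast
      show "A1_deg d \<subseteq> h ` G d"
      proof
        fix a assume a: "a \<in> A1_deg d"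
        then have "a = h (f a)" using hf by (simp add: A1_deg_def)
        then show "a \<in> h ` G d" using f_deg[OF a] by blast
      qed
    qed
  qed (simp_all add: h_add act'_def fh)
  ultimately show ?thesis by blast
qed

text \<open>Two such structures agree at all arguments in \<open>A1\<close>, so the identity is an
  isomorphism. As functions they may differ outside \<open>A1\<close>, where values are
  irrelevant.\<close>

lemma formulas_unique:
  assumes "act \<in> A1_structures" "act' \<in> A1_structures"
    and "Sq_formulas x00 x10 x21 x31 y31 y41 y52 y62 v act"
    and "Sq_formulas x00 x10 x21 x31 y31 y41 y52 y62 v act'"
  shows "(act, act') \<in> A1_structure_iso"
proof -
  have s: "A1_structure x00 x10 x21 x31 y31 y41 y52 y62 act"
    "A1_structure x00 x10 x21 x31 y31 y41 y52 y62 act'"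
    using assms(1,2) A1_basis_axioms by (simp_all add: A1_structure_def A1_structure_axioms_def)
  have f: "act (Sq 4) x00 = act' (Sq 4) x00" "act (Sq 4) x10 = act' (Sq 4) x10"
    "act (Sq 4) x21 = act' (Sq 4) x21" "act (Sq 4) x31 = act' (Sq 4) x31"
    "act (Sq 4) y31 = act' (Sq 4) y31" "act (Sq 8) x00 = act' (Sq 8) x00"
    using assms(3,4) by (cases v; simp_all only: Sq_formulas_def prod.case)+
  have "act (Sq 4) (bs ! k) = act' (Sq 4) (bs ! k)" if "k < 5" for k
  proof -
    have "k = 0 \<or> k = 1 \<or> k = 2 \<or> k = 3 \<or> k = 4" using that by linarith
    then show ?thesis using f by (elim disjE) simp_all
  qed
  then have "act a x = act' a x" if "x \<in> A1" for a x
    using A1_structure_unique[OF s _ f(6) that] by blast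
  then have "bigraded_isomorphic UNIV A1 A1_deg act A1 A1_deg act'"
    unfolding bigraded_isomorphic_def by (intro exI[of _ id]) auto
  then show ?thesis using assms(1,2) by (simp add: A1_structure_iso_def)
qed

end

theorem theorem1p6:
  fixes x00 x10 x21 x31 y31 y41 y52 y62 :: AR
  assumes "A1_basis x00 x10 x21 x31 y31 y41 y52 y62"
  shows "(\<forall>v :: param. \<exists>!C. C \<in> A1_structures // A1_structure_iso
            \<and> (\<exists>act\<in>C. Sq_formulas x00 x10 x21 x31 y31 y41 y52 y62 v act))
       \<and> (\<forall>(M :: 'm::ab_group_add set) G act.
            bigraded_module UNIV M G act \<and> A1_free_rank_one M G act \<longrightarrow>
            (\<exists>v. \<exists>act'\<in>A1_structures.
               Sq_formulas x00 x10 x21 x31 y31 y41 y52 y62 v act'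
               \<and> bigraded_isomorphic UNIV M G act A1 A1_deg act'))"
proof -
  interpret A1_basis x00 x10 x21 x31 y31 y41 y52 y62 by fact
  note equiv = equiv_A1_structure_iso
  have "\<exists>!C. C \<in> A1_structures // A1_structure_iso
      \<and> (\<exists>act\<in>C. Sq_formulas x00 x10 x21 x31 y31 y41 y52 y62 v act)" for v
  proof (rule ex1I[of _ "A1_structure_iso `` {family_act v}"])
    show "A1_structure_iso `` {family_act v} \<in> A1_structures // A1_structure_iso
      \<and> (\<exists>act\<in>A1_structure_iso `` {family_act v}. Sq_formulas x00 x10 x21 x31 y31 y41 y52 y62 v act)"
      using family_act_structure family_act_formulas equiv_class_self[OF equiv]
      by (blast intro: quotientI)
  next
    fix C assume C: "C \<in> A1_structures // A1_structure_iso
      \<and> (\<exists>act\<in>C. Sq_formulas x00 x10 x21 x31 y31 y41 y52 y62 v act)"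
    then obtain act where act: "act \<in> C" "Sq_formulas x00 x10 x21 x31 y31 y41 y52 y62 v act" by blast
    have "act \<in> A1_structures" using in_quotient_imp_subset[OF equiv] C act(1) by blast
    then have "(family_act v, act) \<in> A1_structure_iso"
      using formulas_unique family_act_structure family_act_formulas act(2) by blast
    moreover have "C = A1_structure_iso `` {act}"
      using C act(1) equiv by (metis Image_singleton_iff equiv_class_eq quotientE)
    ultimately show "C = A1_structure_iso `` {family_act v}"
      using equiv_class_eq[OF equiv] by simp
  qed
  moreover have "\<exists>v. \<exists>act'\<in>A1_structures. Sq_formulas x00 x10 x21 x31 y31 y41 y52 y62 v act'
      \<and> bigraded_isomorphic UNIV M G act A1 A1_deg act'"
    if M: "bigraded_module UNIV M G act" "A1_free_rank_one M G act" for M :: "'m set" and G act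
  proof -
    obtain act' where act': "act' \<in> A1_structures" "bigraded_isomorphic UNIV M G act A1 A1_deg act'"
      using A1_free_transport[OF M] by blast
    interpret A1_structure x00 x10 x21 x31 y31 y41 y52 y62 act'
      by unfold_locales (rule act'(1))
    show ?thesis using structure_formulas act' by blast
  qed
  ultimately show ?thesis by blast
qed

end
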